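(* Suppose that $A$ and $W$ are finite sets and that $(\mu_0,\Sigma_0)\in\mathcal{H}$. Then $$\lim_{N\to\infty}E^{BQO}\Big[\max_{x\in A}a_N(x)\Big]=E\Big[\max_{x\in A}G(x)\Big],$$ where $E^{BQO}$ denotes expectation when the sampling points are chosen by the BQO policy.
   Context: $p:W\to[0,\infty)$ is a known weight function. $\mathcal{H}$ is the set of pairs $(\mu,\Sigma)$ where $\mu$ is a real function on $A\times W$ and $\Sigma$ is a positive semidefinite function on $(A\times W)\times(A\times W)$. $F$ is a random function on $A\times W$ distributed as a Gaussian process with mean $\mu_0$ and covariance $\Sigma_0$ (known hyperparameters). The objective is $G(x)=\sum_{w\in W}F(x,w)p(w)$. Points $(x_1,w_1),(x_2,w_2),\ldots\in A\times W$ are chosen sequentially; after choosing $(x_{n},w_{n})$ one observes $y_{n}=F(x_{n},w_{n})+\epsilon_{n}$, where $\epsilon_n$ is independent normal noise with mean $0$ and known variance $\lambda_{(x_n,w_n)}\ge 0$. $E_n$ denotes conditional expectation given the first $n$ points and observations, $\mu_n(x,w)=E_n[F(x,w)]$, and $a_n(x)=E_n[G(x)]=\sum_{w}\mu_n(x,w)p(w)$. The value of information is $V_n(x,w)=E_n\big[\max_{x'\in A}a_{n+1}(x')\mid x_{n+1}=x,\,w_{n+1}=w\big]-\max_{x'\in A}a_n(x')$. The BQO policy chooses $(x_{n+1},w_{n+1})\in\arg\max_{(x,w)\in A\times W}V_n(x,w)$ for every $n\ge 0$. *)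

theory Defs
  imports "HOL-Probability.Probability"
begin

text \<open>The normal law with mean \<open>m\<close> and variance \<open>v \<ge> 0\<close>; variance zero is the point mass at \<open>m\<close>.\<close>

definition normal_law :: "real \<Rightarrow> real \<Rightarrow> real measure" where
  "normal_law m v =
     (if v = 0 then return borel m else density lborel (\<lambda>x. ennreal (normal_density m (sqrt v) x)))"

definition psd_on :: "'s set \<Rightarrow> ('s \<Rightarrow> 's \<Rightarrow> real) \<Rightarrow> bool" where
  "psd_on S K \<longleftrightarrow>
     (\<forall>s\<in>S. \<forall>t\<in>S. K s t = K t s) \<and>
     (\<forall>T c. finite T \<and> T \<subseteq> S \<longrightarrow> 0 \<le> (\<Sum>s\<in>T. \<Sum>t\<in>T. c s * c t * K s t))"

text \<open>The set \<open>\<H>\<close> of mean/covariance pairs, for the index set \<open>S = A \<times> W\<close>.\<close>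

definition hyperparameters :: "'s set \<Rightarrow> (('s \<Rightarrow> real) \<times> ('s \<Rightarrow> 's \<Rightarrow> real)) set" where
  "hyperparameters S = {(\<mu>, K). psd_on S K}"

text \<open>Finite-dimensional marginals are multivariate normal, possibly degenerate, in the sense that
  every linear combination is univariate normal. Since all coefficients are allowed, the given
  means and variances of the combinations say exactly that \<open>F\<close> has mean function \<open>\<mu>\<close> and
  covariance function \<open>K\<close>.\<close>

definition gaussian_process ::
  "'b measure \<Rightarrow> 's set \<Rightarrow> ('s \<Rightarrow> real) \<Rightarrow> ('s \<Rightarrow> 's \<Rightarrow> real) \<Rightarrow> ('s \<Rightarrow> 'b \<Rightarrow> real) \<Rightarrow> bool" where
  "gaussian_process M S \<mu> K F \<longleftrightarrow>
     (\<forall>s\<in>S. F s \<in> borel_measurable M) \<and>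
     (\<forall>T c. finite T \<and> T \<subseteq> S \<longrightarrow>
        distr M borel (\<lambda>\<omega>. \<Sum>s\<in>T. c s * F s \<omega>) =
        normal_law (\<Sum>s\<in>T. c s * \<mu> s) (\<Sum>s\<in>T. \<Sum>t\<in>T. c s * c t * K s t))"

text \<open>\<open>eps n s \<omega>\<close> is the noise that the observation number \<open>n\<close> carries if it is taken at the
  point \<open>s\<close>. The function \<open>F\<close> and the noise vectors of the successive steps are independent. Only
  one component of each noise vector is ever observed, so nothing is required about the dependence
  between the components belonging to the same step.\<close>

definition independent_normal_noise ::
  "'b measure \<Rightarrow> 's set \<Rightarrow> ('s \<Rightarrow> real) \<Rightarrow> ('s \<Rightarrow> 'b \<Rightarrow> real) \<Rightarrow> (nat \<Rightarrow> 's \<Rightarrow> 'b \<Rightarrow> real) \<Rightarrow> bool" where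
  "independent_normal_noise M S lam F eps \<longleftrightarrow>
     (\<forall>n. \<forall>s\<in>S. eps n s \<in> borel_measurable M \<and> distr M borel (eps n s) = normal_law 0 (lam s)) \<and>
     prob_space.indep_vars M (\<lambda>_. \<Pi>\<^sub>M s\<in>S. borel)
       (\<lambda>i \<omega>. \<lambda>s\<in>S. case i of None \<Rightarrow> F s \<omega> | Some n \<Rightarrow> eps n s \<omega>) (UNIV :: nat option set)"

text \<open>Steps are counted from zero: \<open>pt n\<close> is the random sampling point \<open>(x\<^sub>n\<^sub>+\<^sub>1, w\<^sub>n\<^sub>+\<^sub>1)\<close>, and the
  first \<open>n\<close> points are \<open>pt 0, \<dots>, pt (n - 1)\<close>.\<close>

definition observation ::
  "('s \<Rightarrow> 'b \<Rightarrow> real) \<Rightarrow> (nat \<Rightarrow> 's \<Rightarrow> 'b \<Rightarrow> real) \<Rightarrow> (nat \<Rightarrow> 'b \<Rightarrow> 's) \<Rightarrow> nat \<Rightarrow> 'b \<Rightarrow> real" where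
  "observation F eps pt n \<omega> = F (pt n \<omega>) \<omega> + eps n (pt n \<omega>) \<omega>"

text \<open>The sigma-algebra generated by the first \<open>n\<close> points and observations; the operator \<open>E\<^sub>n\<close> is
  \<open>real_cond_exp\<close> with respect to it.\<close>

definition history ::
  "'b measure \<Rightarrow> 's set \<Rightarrow> ('s \<Rightarrow> 'b \<Rightarrow> real) \<Rightarrow> (nat \<Rightarrow> 's \<Rightarrow> 'b \<Rightarrow> real) \<Rightarrow> (nat \<Rightarrow> 'b \<Rightarrow> 's) \<Rightarrow>
   nat \<Rightarrow> 'b measure" where
  "history M S F eps pt n =
     vimage_algebra (space M) (\<lambda>\<omega>. \<lambda>i\<in>{..<n}. (pt i \<omega>, observation F eps pt i \<omega>))
       (\<Pi>\<^sub>M i\<in>{..<n}. count_space S \<Otimes>\<^sub>M borel)"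

definition objective ::
  "'w set \<Rightarrow> ('w \<Rightarrow> real) \<Rightarrow> ('a \<times> 'w \<Rightarrow> 'b \<Rightarrow> real) \<Rightarrow> 'a \<Rightarrow> 'b \<Rightarrow> real" where
  "objective W p F x \<omega> = (\<Sum>w\<in>W. F (x, w) \<omega> * p w)"

definition objective_mean ::
  "'b measure \<Rightarrow> 'a set \<Rightarrow> 'w set \<Rightarrow> ('w \<Rightarrow> real) \<Rightarrow> ('a \<times> 'w \<Rightarrow> 'b \<Rightarrow> real) \<Rightarrow>
   (nat \<Rightarrow> 'a \<times> 'w \<Rightarrow> 'b \<Rightarrow> real) \<Rightarrow> (nat \<Rightarrow> 'b \<Rightarrow> 'a \<times> 'w) \<Rightarrow> nat \<Rightarrow> 'a \<Rightarrow> 'b \<Rightarrow> real" where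
  "objective_mean M A W p F eps pt n x =
     real_cond_exp M (history M (A \<times> W) F eps pt n) (objective W p F x)"

text \<open>Conditioning on \<open>(x\<^sub>n\<^sub>+\<^sub>1, w\<^sub>n\<^sub>+\<^sub>1) = q\<close> means that the next point is set to \<open>q\<close>, whatever the
  policy would choose: the process \<open>pt\<close> is replaced by \<open>pt(n := \<lambda>_. q)\<close>, which has the same first
  \<open>n\<close> points and observations.\<close>

definition value_of_information ::
  "'b measure \<Rightarrow> 'a set \<Rightarrow> 'w set \<Rightarrow> ('w \<Rightarrow> real) \<Rightarrow> ('a \<times> 'w \<Rightarrow> 'b \<Rightarrow> real) \<Rightarrow>
   (nat \<Rightarrow> 'a \<times> 'w \<Rightarrow> 'b \<Rightarrow> real) \<Rightarrow> (nat \<Rightarrow> 'b \<Rightarrow> 'a \<times> 'w) \<Rightarrow> nat \<Rightarrow> 'a \<times> 'w \<Rightarrow> 'b \<Rightarrow> real" where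
  "value_of_information M A W p F eps pt n q \<omega> =
     real_cond_exp M (history M (A \<times> W) F eps pt n)
       (\<lambda>\<omega>'. MAX x\<in>A. objective_mean M A W p F eps (pt(n := \<lambda>_. q)) (Suc n) x \<omega>') \<omega>
     - (MAX x\<in>A. objective_mean M A W p F eps pt n x \<omega>)"

text \<open>The sampling points are functions of the past points and observations, and maximize the value
  of information. The latter is required almost surely because conditional expectations are
  determined only up to null sets.\<close>

definition bqo_policy ::
  "'b measure \<Rightarrow> 'a set \<Rightarrow> 'w set \<Rightarrow> ('w \<Rightarrow> real) \<Rightarrow> ('a \<times> 'w \<Rightarrow> 'b \<Rightarrow> real) \<Rightarrow>
   (nat \<Rightarrow> 'a \<times> 'w \<Rightarrow> 'b \<Rightarrow> real) \<Rightarrow> (nat \<Rightarrow> 'b \<Rightarrow> 'a \<times> 'w) \<Rightarrow> bool" where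
  "bqo_policy M A W p F eps pt \<longleftrightarrow>
     (\<forall>n. pt n \<in> history M (A \<times> W) F eps pt n \<rightarrow>\<^sub>M count_space (A \<times> W) \<and>
          (AE \<omega> in M. is_arg_max (\<lambda>q. value_of_information M A W p F eps pt n q \<omega>)
                        (\<lambda>q. q \<in> A \<times> W) (pt n \<omega>)))"

end

theory Submission
  imports Defs
begin

text \<open>Fix a deterministic sequence \<open>q\<close> of sampling points. Then \<open>F\<close> and the observations along
  \<open>q\<close> are jointly Gaussian, so the conditional expectation of a linear combination \<open>D\<close> of the
  \<open>F s\<close> is the linear projection \<open>P\<^sub>n D\<close> and the residual is independent of the observations. On
  the event that the first \<open>n\<close> points are \<open>q\<close>, the adaptive history is generated by these
  observations, so the same formula gives \<open>E\<^sub>n D\<close> there.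

  The sequence \<open>E (max a\<^sub>n)\<close> is increasing and bounded, hence its increments tend to \<open>0\<close>. The
  greedy policy makes each increment at least the expected gain of sampling any fixed point \<open>s\<close>,
  so these gains tend to \<open>0\<close> too. Where \<open>a\<^sub>n x'\<close> is maximal, the gain from \<open>s\<close> dominates the
  positive part of the next posterior mean of \<open>D = G x - G x'\<close>, whose increment is normal and
  independent of the past; hence the standard deviation of this increment tends to \<open>0\<close> in mean.
  It bounds the posterior covariance of \<open>D\<close> with \<open>F s\<close>, and summing over \<open>s\<close> the posterior
  variance of \<open>D\<close> tends to \<open>0\<close>. So \<open>G x\<close> cannot exceed \<open>G x'\<close> by much there, and the gap between
  \<open>E (max G)\<close> and \<open>E (max a\<^sub>n)\<close> vanishes.\<close>

subsection \<open>Normal laws\<close>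

text \<open>Adaptive observations need not be jointly Gaussian, because each point is chosen from
  earlier values. So no Gaussian statement is made about the adaptive process itself: the index set
  is finite, the first \<open>n\<close> points take finitely many values, and expectations are split
  over the resulting events. On one such event the standard deviation of an increment is a number,
  but it varies with the event; what tends to 0 is its average weighted with the probabilities.
  Working with averages for each \<open>n\<close> separately avoids almost sure limits of the
  posterior and a limiting sigma-algebra. Two obstacles shape the estimates. The posterior mean of
  \<open>D\<close> may lie far below 0 where \<open>G x'\<close> looks best, and then even a large
  increment may gain little; a cutoff at \<open>- r\<close> with Markov's inequality handles this,
  uniformly in \<open>n\<close> because the mean of \<open>\<bar>D\<bar>\<close> bounds that of the
  absolute posterior mean. And variances may vanish, through noise-free observations or a degenerate
  covariance, so independence is derived from characteristic functions and not from normal densities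
  or inverse covariance matrices.\<close>

lemma real_distribution_std_normal_affine:
  "real_distribution (distr std_normal_distribution borel (\<lambda>z. m + c * z))"
proof -
  interpret real_distribution std_normal_distribution by (rule real_dist_normal_dist)
  show ?thesis by (rule real_distribution_distr) simp
qed

text \<open>The affine image of the standard normal treats the point mass \<open>v = 0\<close> and
  the proper densities alike; characteristic function, moments and tails all follow by a change of
  variables, without a further case distinction.\<close>

lemma normal_law_eq_distr:
  assumes "0 \<le> v"
  shows "normal_law m v = distr std_normal_distribution borel (\<lambda>z. m + sqrt v * z)"
proof (cases "v = 0")
  case True
  interpret real_distribution std_normal_distribution by (rule real_dist_normal_dist)
  show ?thesis using True by (simp add: normal_law_def distr_const)
next
  case False
  then have s: "sqrt v > 0" using assms by simp
  interpret P: real_distribution std_normal_distribution by (rule real_dist_normal_dist)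
  have "distributed std_normal_distribution lborel (\<lambda>z. z) std_normal_density"
    unfolding distributed_def by (auto simp: normal_density_nonneg intro!: distr_id2)
  from P.normal_density_affine[OF this, of "sqrt v" m] s False
  have "distributed std_normal_distribution lborel (\<lambda>z. m + sqrt v * z) (normal_density m (sqrt v))"
    by simp
  then have "distr std_normal_distribution lborel (\<lambda>z. m + sqrt v * z) = density lborel (normal_density m (sqrt v))"
    by (simp add: distributed_def)
  moreover have "distr std_normal_distribution lborel (\<lambda>z. m + sqrt v * z) = distr std_normal_distribution borel (\<lambda>z. m + sqrt v * z)"
    by (rule distr_cong) auto
  ultimately show ?thesis using False by (simp add: normal_law_def)
qed

lemma real_distribution_normal_law: "0 \<le> v \<Longrightarrow> real_distribution (normal_law m v)"
  using real_distribution_std_normal_affine[of m "sqrt v"] normal_law_eq_distr by metis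

lemma char_normal_law:
  assumes "0 \<le> v"
  shows "char (normal_law m v) t = exp (\<i> * (t * m) - t\<^sup>2 * v / 2)"
proof -
  have "char (normal_law m v) t = (CLINT z|std_normal_distribution. iexp (t * (m + sqrt v * z)))"
    unfolding normal_law_eq_distr[OF assms] char_def by (subst integral_distr) auto
  also have "\<dots> = (CLINT z|std_normal_distribution. iexp (t * m) * iexp ((t * sqrt v) * z))"
    by (intro Bochner_Integration.integral_cong refl) (simp add: exp_add[symmetric] algebra_simps)
  also have "\<dots> = iexp (t * m) * char std_normal_distribution (t * sqrt v)"
    unfolding char_def by simp
  also have "\<dots> = iexp (t * m) * exp (- ((t * sqrt v)\<^sup>2) / 2)"
    by (simp add: char_std_normal_distribution)
  also have "(t * sqrt v)\<^sup>2 = t\<^sup>2 * v" using assms by (simp add: power_mult_distrib)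
  also have "iexp (t * m) * exp (- (t\<^sup>2 * v) / 2) = exp (\<i> * (t * m) - t\<^sup>2 * v / 2)"
  proof -
    have "complex_of_real (exp (- (t\<^sup>2 * v) / 2)) = exp (of_real (- (t\<^sup>2 * v) / 2))"
      by (rule exp_of_real[symmetric])
    then have "iexp (t * m) * exp (- (t\<^sup>2 * v) / 2) = exp (\<i> * (t * m) + of_real (- (t\<^sup>2 * v) / 2))"
      by (metis exp_add)
    also have "\<i> * (t * m) + of_real (- (t\<^sup>2 * v) / 2) = \<i> * (t * m) - t\<^sup>2 * v / 2" by simp
    finally show ?thesis .
  qed
  finally show ?thesis .
qed

context prob_space begin

lemma normal_law_moments:
  assumes X[measurable]: "X \<in> borel_measurable M" and v: "0 \<le> v" and d: "distr M borel X = normal_law m v"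
  shows "integrable M X" "integrable M (\<lambda>\<omega>. (X \<omega>)\<^sup>2)" "expectation X = m"
    "expectation (\<lambda>\<omega>. (X \<omega>)\<^sup>2) = v + m\<^sup>2"
proof -
  interpret P: real_distribution std_normal_distribution by (rule real_dist_normal_dist)
  have i1: "integrable std_normal_distribution (\<lambda>z. z)"
    using integrable_std_normal_distribution_moment[of 1] by simp
  have i2: "integrable std_normal_distribution (\<lambda>z. z\<^sup>2)"
    using integrable_std_normal_distribution_moment[of 2] by simp
  have e1: "(LINT z|std_normal_distribution. z) = 0"
    using integral_std_normal_distribution_moment_odd[of 1] by simp
  have e2: "(LINT z|std_normal_distribution. z\<^sup>2) = 1"
    using std_normal_distribution_even_moments[of 1] by simp
  have ec: "(LINT z|std_normal_distribution. c) = c" for c :: real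
    by (simp only: lebesgue_integral_const P.prob_space scaleR_one)
  have d': "distr M borel X = distr std_normal_distribution borel (\<lambda>z. m + sqrt v * z)"
    using d normal_law_eq_distr[OF v] by simp
  have "integrable (distr M borel X) (\<lambda>x. x)"
    unfolding d' by (subst integrable_distr_eq)
      (auto intro!: Bochner_Integration.integrable_add i1 integrable_mult_right P.integrable_const simp del: integrable_density)
  then show "integrable M X" by (subst (asm) integrable_distr_eq) auto
  have sq: "(m + sqrt v * z)\<^sup>2 = m\<^sup>2 + (2 * m * sqrt v) * z + v * z\<^sup>2" for z
    using v by (simp add: power2_sum power_mult_distrib)
  have "integrable (distr M borel X) (\<lambda>x. x\<^sup>2)"
    unfolding d' by (subst integrable_distr_eq)
      (auto simp: sq simp del: integrable_density
        intro!: Bochner_Integration.integrable_add i1 i2 integrable_mult_right P.integrable_const)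
  then show "integrable M (\<lambda>\<omega>. (X \<omega>)\<^sup>2)" by (subst (asm) integrable_distr_eq) auto
  have "expectation X = (LINT x|distr M borel X. x)" by (subst integral_distr) auto
  also have "\<dots> = m" 
  proof -
    have "(LINT x|distr M borel X. x) = (LINT z|std_normal_distribution. m + sqrt v * z)"
      unfolding d' by (rule integral_distr) auto
    also have "\<dots> = (LINT z|std_normal_distribution. m) + (LINT z|std_normal_distribution. sqrt v * z)"
      by (intro Bochner_Integration.integral_add i1 integrable_mult_right P.integrable_const)
    also have "\<dots> = m" by (simp only: integral_mult_right_zero ec e1)
    finally show ?thesis .
  qed
  finally show "expectation X = m" .
  have "expectation (\<lambda>\<omega>. (X \<omega>)\<^sup>2) = (LINT x|distr M borel X. x\<^sup>2)" by (subst integral_distr) auto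
  also have "\<dots> = (LINT z|std_normal_distribution. m\<^sup>2 + (2 * m * sqrt v) * z + v * z\<^sup>2)"
    unfolding d' by (subst integral_distr) (simp_all add: sq)
  also have "\<dots> = m\<^sup>2 + v" 
  proof -
    have "(LINT z|std_normal_distribution. m\<^sup>2 + (2 * m * sqrt v) * z + v * z\<^sup>2)
        = (LINT z|std_normal_distribution. m\<^sup>2) + (LINT z|std_normal_distribution. (2 * m * sqrt v) * z)
          + (LINT z|std_normal_distribution. v * z\<^sup>2)"
      by (subst Bochner_Integration.integral_add,
          intro Bochner_Integration.integrable_add i1 integrable_mult_right P.integrable_const,
          intro i2 integrable_mult_right,
          subst Bochner_Integration.integral_add)
        (intro i1 integrable_mult_right P.integrable_const refl)+
    also have "\<dots> = m\<^sup>2 + v" by (simp only: integral_mult_right_zero ec e1 e2)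
    finally show ?thesis .
  qed
  finally show "expectation (\<lambda>\<omega>. (X \<omega>)\<^sup>2) = v + m\<^sup>2" by simp
qed

end

text \<open>The density vanishes nowhere, so a null tail would make a half-line Lebesgue null.
  Positivity is what allows dividing by this probability later, where it is fixed before the number
  of steps grows.\<close>

lemma std_normal_tail_pos: "0 < measure std_normal_distribution {c..}"
proof -
  interpret P: real_distribution std_normal_distribution by (rule real_dist_normal_dist)
  have "emeasure std_normal_distribution {c..} \<noteq> 0"
  proof
    assume "emeasure std_normal_distribution {c..} = 0"
    then have "(\<integral>\<^sup>+x. ennreal (std_normal_density x) * indicator {c..} x \<partial>lborel) = 0"
      by (subst (asm) emeasure_density) auto
    then have "AE x in lborel. ennreal (std_normal_density x) * indicator {c..} x = 0"
      by (subst (asm) nn_integral_0_iff_AE) auto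
    moreover have "ennreal (std_normal_density x) \<noteq> 0" for x
      using normal_density_pos[of 1 0 x] by (metis ennreal_eq_0_iff not_le zero_less_one)
    ultimately have "AE x in lborel. indicator {c..} x = (0::ennreal)" by (simp only: mult_eq_0_iff simp_thms)
    then have "AE x in lborel. x \<notin> {c..}" by (simp only: indicator_eq_0_iff)
    then have "emeasure lborel {c..} = 0"
      by (subst (asm) AE_iff_measurable[of "{c..}"]) auto
    moreover have "emeasure lborel {c..c+1} \<le> emeasure lborel {c..}"
      by (rule emeasure_mono) auto
    ultimately show False by simp
  qed
  then show ?thesis
    by (simp add: P.emeasure_eq_measure zero_less_measure_iff)
qed

text \<open>For a threshold \<open>0 \<le> K\<close> a larger standard deviation only fattens the
  upper tail. One constant therefore serves all standard deviations from \<eta> upwards, that is,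
  all paths and all times at once.\<close>

lemma normal_law_tail:
  assumes "0 < \<eta>" "\<eta>\<^sup>2 \<le> v" "0 \<le> K"
  shows "measure std_normal_distribution {K / \<eta>..} \<le> measure (normal_law 0 v) {K..}"
proof -
  interpret P: real_distribution std_normal_distribution by (rule real_dist_normal_dist)
  have v: "0 \<le> v" using assms(2) zero_le_power2[of \<eta>] by linarith
  have \<eta>: "\<eta> \<le> sqrt v" using assms by (simp add: real_le_rsqrt)
  have "measure (normal_law 0 v) {K..} = measure std_normal_distribution ((\<lambda>z. 0 + sqrt v * z) -` {K..} \<inter> space std_normal_distribution)"
    unfolding normal_law_eq_distr[OF v] by (subst measure_distr) auto
  moreover have "{K / \<eta>..} \<subseteq> (\<lambda>z. 0 + sqrt v * z) -` {K..} \<inter> space std_normal_distribution"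
  proof
    fix z assume "z \<in> {K/\<eta>..}"
    then have z: "K / \<eta> \<le> z" by simp
    then have "K \<le> \<eta> * z" using assms by (simp add: pos_divide_le_eq mult.commute)
    moreover have "0 \<le> K / \<eta>" using assms by simp
    with z have "0 \<le> z" by linarith
    ultimately have "K \<le> \<eta> * z" "0 \<le> z" by auto
    then have "K \<le> sqrt v * z" using \<eta> by (meson mult_right_mono order_trans)
    then show "z \<in> (\<lambda>z. 0 + sqrt v * z) -` {K..} \<inter> space std_normal_distribution" by simp
  qed
  moreover have "(\<lambda>z. 0 + sqrt v * z) -` {K..} \<inter> space std_normal_distribution \<in> P.events"
    by measurable
  ultimately show ?thesis by (metis P.finite_measure_mono)
qed

subsection \<open>Independence from characteristic functions\<close>

lemma Int_stable_vimages: "Int_stable {X -` A \<inter> \<Omega> |A. A \<in> sets N}"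
proof (rule Int_stableI)
  fix a b assume "a \<in> {X -` A \<inter> \<Omega> |A. A \<in> sets N}" "b \<in> {X -` A \<inter> \<Omega> |A. A \<in> sets N}"
  then obtain A B where "A \<in> sets N" "B \<in> sets N" "a = X -` A \<inter> \<Omega>" "b = X -` B \<inter> \<Omega>" by auto
  then have "a \<inter> b = X -` (A \<inter> B) \<inter> \<Omega>" "A \<inter> B \<in> sets N" by auto
  then show "a \<inter> b \<in> {X -` A \<inter> \<Omega> |A. A \<in> sets N}" by blast
qed

context prob_space begin

text \<open>The signed image measure of \<open>g\<close> under \<open>Y\<close> has vanishing
  Fourier transform, so it should vanish. Uniqueness of characteristic functions is a statement
  about probability laws, which is why \<open>g\<close> is scaled and shifted to become a positive
  density.\<close>

lemma fourier_zero_real: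
  fixes g Y :: "'a \<Rightarrow> real"
  assumes [measurable]: "g \<in> borel_measurable M" "Y \<in> borel_measurable M"
    and c: "\<And>\<omega>. \<omega> \<in> space M \<Longrightarrow> \<bar>g \<omega>\<bar> \<le> c"
    and zero: "\<And>s. (CLINT \<omega>|M. of_real (g \<omega>) * iexp (s * Y \<omega>)) = 0"
    and [measurable]: "B \<in> sets borel"
  shows "expectation (\<lambda>\<omega>. g \<omega> * indicator B (Y \<omega>)) = 0"
proof -
  define d where "d = \<bar>c\<bar> + 1"
  have d: "0 < d" by (simp add: d_def)
  define w where "w \<omega> = 1 + g \<omega> / d" for \<omega>
  have [measurable]: "w \<in> borel_measurable M" unfolding w_def by measurable
  have gd: "\<bar>g \<omega>\<bar> \<le> d" if "\<omega> \<in> space M" for \<omega> using c[OF that] by (simp add: d_def)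
  have wb: "0 \<le> w \<omega>" "w \<omega> \<le> 2" if "\<omega> \<in> space M" for \<omega>
    using gd[OF that] d by (auto simp: w_def field_simps abs_le_iff)
  have ig: "integrable M g"
    by (rule integrable_const_bound[of _ d]) (auto intro: gd)
  have igB: "integrable M (\<lambda>\<omega>. g \<omega> * indicator B (Y \<omega>))"
    by (rule integrable_const_bound[of _ d]) (use gd d in \<open>auto simp: indicator_def intro!: AE_I2\<close>)
  have iB: "integrable M (\<lambda>\<omega>. indicator B (Y \<omega>) :: real)"
    by (rule integrable_const_bound[of _ 1]) (auto simp: indicator_def intro!: AE_I2)
  \<comment> \<open>Frequency 0 shows that \<open>g\<close> has mean 0, so the shifted density
    \<open>w\<close> has total mass 1.\<close>
  have "complex_of_real (expectation g) = (CLINT \<omega>|M. of_real (g \<omega>) * iexp (0 * Y \<omega>))" by simp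
  then have eg: "expectation g = 0" using zero[of 0] by simp
  (* 1 + g/d is a probability density, and under it Y has the same characteristic function as under M *)
  define N1 where "N1 = distr (density M (\<lambda>\<omega>. ennreal (w \<omega>))) borel Y"
  define N2 where "N2 = distr M borel Y"
  have iw: "integrable M w" unfolding w_def using ig by simp
  have "(\<integral>\<^sup>+\<omega>. ennreal (w \<omega>) \<partial>M) = ennreal (expectation w)"
    by (intro nn_integral_eq_integral iw AE_I2 wb)
  also have "expectation w = 1" unfolding w_def using ig eg prob_space by simp
  finally have "prob_space (density M (\<lambda>\<omega>. ennreal (w \<omega>)))"
    by (intro prob_spaceI) (simp add: emeasure_density nn_integral_set_ennreal cong: nn_integral_cong)
  then interpret D: prob_space "density M (\<lambda>\<omega>. ennreal (w \<omega>))" .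
  have N1: "real_distribution N1"
    unfolding N1_def by (rule D.real_distribution_distr) simp
  have N2: "real_distribution N2" unfolding N2_def by (rule real_distribution_distr) simp
  have iexpY: "integrable M (\<lambda>\<omega>. iexp (s * Y \<omega>))" for s by (rule integrable_iexp) auto
  have igY: "integrable M (\<lambda>\<omega>. of_real (g \<omega>) * iexp (s * Y \<omega>))" for s
    by (rule integrable_const_bound[of _ d]) (auto simp: norm_mult gd intro!: AE_I2)
  have "char N1 s = char N2 s" for s
  proof -
    have "char N1 s = (CLINT \<omega>|M. w \<omega> *\<^sub>R iexp (s * Y \<omega>))"
      unfolding char_def N1_def
      by (subst integral_distr, simp, simp, subst integral_density) (auto intro!: AE_I2 wb)
    also have "\<dots> = (CLINT \<omega>|M. iexp (s * Y \<omega>) + (of_real (g \<omega>) * iexp (s * Y \<omega>)) / of_real d)"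
      by (intro Bochner_Integration.integral_cong refl) (simp add: w_def scaleR_conv_of_real algebra_simps)
    also have "\<dots> = (CLINT \<omega>|M. iexp (s * Y \<omega>))"
      using iexpY[of s] igY[of s] zero[of s] by simp
    also have "\<dots> = char N2 s" unfolding char_def N2_def by (subst integral_distr) auto
    finally show ?thesis .
  qed
  then have "N1 = N2" by (intro Levy_uniqueness N1 N2 ext)
  then have "integral\<^sup>L N1 (indicator B :: real \<Rightarrow> real) = integral\<^sup>L N2 (indicator B)" by simp
  moreover have "integral\<^sup>L N1 (indicator B :: real \<Rightarrow> real) = expectation (\<lambda>\<omega>. w \<omega> * indicator B (Y \<omega>))"
    unfolding N1_def by (subst integral_distr, simp, simp, subst integral_density) (auto intro!: AE_I2 wb)
  moreover have "\<dots> = expectation (\<lambda>\<omega>. indicator B (Y \<omega>) + (g \<omega> * indicator B (Y \<omega>)) / d)"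
    by (intro Bochner_Integration.integral_cong refl) (simp add: w_def algebra_simps)
  moreover have "\<dots> = expectation (\<lambda>\<omega>. indicator B (Y \<omega>)) + expectation (\<lambda>\<omega>. g \<omega> * indicator B (Y \<omega>)) / d"
    using iB igB by simp
  moreover have "integral\<^sup>L N2 (indicator B :: real \<Rightarrow> real) = expectation (\<lambda>\<omega>. indicator B (Y \<omega>))"
    unfolding N2_def by (subst integral_distr) auto
  ultimately show ?thesis using d by simp
qed

text \<open>Complex weights are needed because the induction over coordinates below multiplies
  \<open>g\<close> by exponentials. The conjugate of \<open>g\<close> satisfies the hypothesis as
  well, with \<open>s\<close> replaced by \<open>- s\<close>, and this reduces the claim to real and
  imaginary parts.\<close>

lemma fourier_zero:
  fixes g :: "'a \<Rightarrow> complex" and Y :: "'a \<Rightarrow> real"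
  assumes g[measurable]: "g \<in> borel_measurable M" and Y[measurable]: "Y \<in> borel_measurable M"
    and c: "\<And>\<omega>. \<omega> \<in> space M \<Longrightarrow> norm (g \<omega>) \<le> c"
    and zero: "\<And>s. (CLINT \<omega>|M. g \<omega> * iexp (s * Y \<omega>)) = 0"
    and B[measurable]: "B \<in> sets borel"
  shows "(CLINT \<omega>|M. g \<omega> * indicator B (Y \<omega>)) = 0"
proof -
  have i: "integrable M (\<lambda>\<omega>. g \<omega> * iexp (s * Y \<omega>))" for s
    by (rule integrable_const_bound[of _ c]) (auto simp: norm_mult c intro!: AE_I2)
  have [measurable]: "(\<lambda>\<omega>. cnj (g \<omega>)) \<in> borel_measurable M"
    by (rule measurable_compose[OF g borel_measurable_continuous_onI]) (intro continuous_intros)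
  have ic: "integrable M (\<lambda>\<omega>. cnj (g \<omega>) * iexp (s * Y \<omega>))" for s
    by (rule integrable_const_bound[of _ c]) (auto simp: norm_mult c intro!: AE_I2)
  have iB: "integrable M (\<lambda>\<omega>. g \<omega> * indicator B (Y \<omega>))"
    by (rule integrable_const_bound[of _ c])
      (use order_trans[OF norm_ge_zero c] in \<open>auto simp: norm_mult c indicator_def intro!: AE_I2\<close>)
  have zc: "(CLINT \<omega>|M. cnj (g \<omega>) * iexp (s * Y \<omega>)) = 0" for s
  proof -
    have "(CLINT \<omega>|M. cnj (g \<omega>) * iexp (s * Y \<omega>)) = (CLINT \<omega>|M. cnj (g \<omega> * iexp (- s * Y \<omega>)))"
      by (intro Bochner_Integration.integral_cong refl) (simp add: exp_cnj)
    also have "\<dots> = cnj (CLINT \<omega>|M. g \<omega> * iexp (- s * Y \<omega>))" by (rule Bochner_Integration.integral_cnj)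
    finally show ?thesis using zero[of "-s"] by simp
  qed
  have re: "expectation (\<lambda>\<omega>. Re (g \<omega>) * indicator B (Y \<omega>)) = 0"
  proof (rule fourier_zero_real[where c = c])
    fix s
    have "(CLINT \<omega>|M. of_real (Re (g \<omega>)) * iexp (s * Y \<omega>))
        = (CLINT \<omega>|M. (g \<omega> * iexp (s * Y \<omega>) + cnj (g \<omega>) * iexp (s * Y \<omega>)) / 2)"
      by (intro Bochner_Integration.integral_cong refl)
        (metis (no_types, lifting) complex_add_cnj distrib_right mult_2 nonzero_mult_div_cancel_left
          of_real_mult of_real_numeral times_divide_eq_left zero_neq_numeral)
    also have "\<dots> = 0" using i[of s] ic[of s] zero[of s] zc[of s] by simp
    finally show "(CLINT \<omega>|M. of_real (Re (g \<omega>)) * iexp (s * Y \<omega>)) = 0" .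
  qed (auto intro: order_trans[OF abs_Re_le_cmod c])
  have im: "expectation (\<lambda>\<omega>. Im (g \<omega>) * indicator B (Y \<omega>)) = 0"
  proof (rule fourier_zero_real[where c = c])
    fix s
    have *: "of_real (Im x) = (x - cnj x) / (2 * \<i>)" for x by (simp add: complex_eq_iff)
    have "(CLINT \<omega>|M. of_real (Im (g \<omega>)) * iexp (s * Y \<omega>))
        = (CLINT \<omega>|M. (g \<omega> * iexp (s * Y \<omega>) - cnj (g \<omega>) * iexp (s * Y \<omega>)) / (2 * \<i>))"
      unfolding * by (intro Bochner_Integration.integral_cong refl) (simp add: algebra_simps)
    also have "\<dots> = 0" using i[of s] ic[of s] zero[of s] zc[of s] by simp
    finally show "(CLINT \<omega>|M. of_real (Im (g \<omega>)) * iexp (s * Y \<omega>)) = 0" .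
  qed (auto intro: order_trans[OF abs_Im_le_cmod c])
  show ?thesis
  proof (rule complex_eqI)
    have "Re (CLINT \<omega>|M. g \<omega> * indicator B (Y \<omega>)) = expectation (\<lambda>\<omega>. Re (g \<omega> * indicator B (Y \<omega>)))"
      by (rule integral_Re[OF iB, symmetric])
    also have "\<dots> = expectation (\<lambda>\<omega>. Re (g \<omega>) * indicator B (Y \<omega>))"
      by (intro Bochner_Integration.integral_cong refl) (simp add: indicator_def)
    finally show "Re (CLINT \<omega>|M. g \<omega> * indicator B (Y \<omega>)) = Re 0" using re by simp
    have "Im (CLINT \<omega>|M. g \<omega> * indicator B (Y \<omega>)) = expectation (\<lambda>\<omega>. Im (g \<omega> * indicator B (Y \<omega>)))"
      by (rule integral_Im[OF iB, symmetric])
    also have "\<dots> = expectation (\<lambda>\<omega>. Im (g \<omega>) * indicator B (Y \<omega>))"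
      by (intro Bochner_Integration.integral_cong refl) (simp add: indicator_def)
    finally show "Im (CLINT \<omega>|M. g \<omega> * indicator B (Y \<omega>)) = Im 0" using im by simp
  qed
qed

text \<open>Exponentials are exchanged for indicators one coordinate at a time: the exponential of
  the last coordinate is first absorbed into the weight, so that the induction hypothesis treats the
  others, and is then exchanged itself with the indicators obtained so far in the weight.\<close>

lemma fourier_zero_box:
  fixes g :: "'a \<Rightarrow> complex" and z :: "nat \<Rightarrow> 'a \<Rightarrow> real"
  assumes "g \<in> borel_measurable M"
    and z: "\<And>j. j < m \<Longrightarrow> z j \<in> borel_measurable M"
    and "\<And>\<omega>. \<omega> \<in> space M \<Longrightarrow> norm (g \<omega>) \<le> c"
    and "\<And>s. (CLINT \<omega>|M. g \<omega> * (\<Prod>j<m. iexp (s j * z j \<omega>))) = 0"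
    and B: "\<And>j. j < m \<Longrightarrow> B j \<in> sets borel"
  shows "(CLINT \<omega>|M. g \<omega> * (\<Prod>j<m. indicator (B j) (z j \<omega>))) = 0"
  using assms
proof (induction m arbitrary: g)
  case 0
  then show ?case by simp
next
  case (Suc m)
  note [measurable] = Suc.prems(1)
  have zm[measurable]: "z m \<in> borel_measurable M" and Bm: "B m \<in> sets borel"
    using Suc.prems by auto
  have mz: "(\<lambda>\<omega>. \<Prod>j<m. indicator (B j) (z j \<omega>) :: complex) \<in> borel_measurable M"
  proof (rule borel_measurable_prod)
    fix j assume "j \<in> {..<m}"
    then have [measurable]: "z j \<in> borel_measurable M" "B j \<in> sets borel" using Suc.prems by auto
    show "(\<lambda>\<omega>. indicator (B j) (z j \<omega>) :: complex) \<in> borel_measurable M" by measurable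
  qed
  have "(CLINT \<omega>|M. (g \<omega> * (\<Prod>j<m. indicator (B j) (z j \<omega>))) * indicator (B m) (z m \<omega>)) = 0"
  proof (rule fourier_zero[where c = c])
    show "(\<lambda>\<omega>. g \<omega> * (\<Prod>j<m. indicator (B j) (z j \<omega>))) \<in> borel_measurable M"
      using mz by measurable
    show "norm (g \<omega> * (\<Prod>j<m. indicator (B j) (z j \<omega>))) \<le> c" if "\<omega> \<in> space M" for \<omega>
    proof -
      have "norm (\<Prod>j<m. indicator (B j) (z j \<omega>) :: complex) \<le> 1"
        by (simp add: prod_norm[symmetric] indicator_def) (intro prod_le_1, auto)
      then have "norm (g \<omega>) * norm (\<Prod>j<m. indicator (B j) (z j \<omega>) :: complex) \<le> norm (g \<omega>) * 1"
        by (intro mult_left_mono) auto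
      with Suc.prems(3)[OF that] show ?thesis by (simp add: norm_mult)
    qed
    fix t
    have "(CLINT \<omega>|M. (g \<omega> * iexp (t * z m \<omega>)) * (\<Prod>j<m. indicator (B j) (z j \<omega>))) = 0"
    proof (rule Suc.IH)
      show "(\<lambda>\<omega>. g \<omega> * iexp (t * z m \<omega>)) \<in> borel_measurable M" by measurable
      show "norm (g \<omega> * iexp (t * z m \<omega>)) \<le> c" if "\<omega> \<in> space M" for \<omega>
        using Suc.prems(3)[OF that] by (simp add: norm_mult)
      fix s :: "nat \<Rightarrow> real"
      have *: "(\<Prod>j<Suc m. iexp ((s(m := t)) j * z j \<omega>)) = iexp (t * z m \<omega>) * (\<Prod>j<m. iexp (s j * z j \<omega>))" for \<omega>
        by (simp add: mult.commute)
      show "(CLINT \<omega>|M. (g \<omega> * iexp (t * z m \<omega>)) * (\<Prod>j<m. iexp (s j * z j \<omega>))) = 0"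
        using Suc.prems(4)[of "s(m := t)"] unfolding * by (simp only: mult.assoc)
    qed (use Suc.prems in auto)
    then show "(CLINT \<omega>|M. (g \<omega> * (\<Prod>j<m. indicator (B j) (z j \<omega>))) * iexp (t * z m \<omega>)) = 0"
      by (simp only: mult_ac)
  qed (fact zm, fact Bm)
  then show ?case by (simp add: mult.assoc)
qed

text \<open>Kac's criterion: if joint characteristic functions factorize, \<open>R\<close> is
  independent of the vector of the \<open>y j\<close>. It is phrased for a single event
  \<open>U\<close> of the generated sigma-algebra, since later only products of an indicator with a
  function of \<open>R\<close> are integrated.\<close>

lemma indep_var_of_char:
  fixes R :: "'a \<Rightarrow> real" and y :: "nat \<Rightarrow> 'a \<Rightarrow> real"
  assumes R[measurable]: "R \<in> borel_measurable M"
    and y: "\<And>j. j < n \<Longrightarrow> y j \<in> borel_measurable M"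
    and fac: "\<And>r s. (CLINT \<omega>|M. iexp (r * R \<omega>) * (\<Prod>j<n. iexp (s j * y j \<omega>)))
        = (CLINT \<omega>|M. iexp (r * R \<omega>)) * (CLINT \<omega>|M. (\<Prod>j<n. iexp (s j * y j \<omega>)))"
    and U: "U \<in> sets (vimage_algebra (space M) (\<lambda>\<omega>. \<lambda>j\<in>{..<n}. y j \<omega>) (\<Pi>\<^sub>M j\<in>{..<n}. borel))"
  shows "indep_var borel (indicator U :: 'a \<Rightarrow> real) borel R"
proof -
  let ?P = "\<Pi>\<^sub>M j\<in>{..<n}. (borel :: real measure)"
  let ?y = "\<lambda>\<omega>. \<lambda>j\<in>{..<n}. y j \<omega>"
  have ym[measurable]: "?y \<in> measurable M ?P"
    by (rule measurable_restrict) (use y in auto)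
  have box: "prob (R -` B \<inter> (\<Inter>j<n. y j -` C j) \<inter> space M) = prob (R -` B \<inter> space M) * prob ((\<Inter>j<n. y j -` C j) \<inter> space M)"
    if B[measurable]: "B \<in> sets borel" and C: "\<And>j. j < n \<Longrightarrow> C j \<in> sets borel" for B C
  proof -
    define b where "b \<omega> = (\<Prod>j<n. indicator (C j) (y j \<omega>) :: complex)" for \<omega>
    define U where "U = (\<Inter>j<n. y j -` C j) \<inter> space M"
    have mjC: "y j -` C j \<inter> space M \<in> events" if "j < n" for j
      using y[OF that] C[OF that] by (rule measurable_sets)
    have U[measurable]: "U \<in> events"
    proof -
      have "U = space M \<inter> (\<Inter>j<n. y j -` C j \<inter> space M)" unfolding U_def by auto
      also have "\<dots> = {\<omega> \<in> space M. \<forall>j\<in>{..<n}. y j \<omega> \<in> C j}" by auto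
      also have "\<dots> \<in> events"
        by (intro sets.sets_Collect_finite_All) (use mjC in \<open>auto simp: vimage_def Int_def conj_commute\<close>)
      finally show ?thesis .
    qed
    have bU: "b \<omega> = indicator U \<omega>" if "\<omega> \<in> space M" for \<omega>
      using that unfolding b_def U_def by (auto simp: indicator_def prod_eq_1_iff[symmetric] intro!: prod_zero)
    have iy: "integrable M (\<lambda>\<omega>. \<Prod>j<n. iexp (s j * y j \<omega>))" for s
    proof (rule integrable_const_bound[of _ 1])
      show "AE \<omega> in M. norm (\<Prod>j<n. iexp (s j * y j \<omega>)) \<le> 1"
        by (intro AE_I2) (simp add: prod_norm[symmetric])
      show "(\<lambda>\<omega>. \<Prod>j<n. iexp (s j * y j \<omega>)) \<in> borel_measurable M"
      proof (rule borel_measurable_prod)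
        fix j assume "j \<in> {..<n}"
        then have [measurable]: "y j \<in> borel_measurable M" using y by auto
        show "(\<lambda>\<omega>. iexp (s j * y j \<omega>)) \<in> borel_measurable M" by measurable
      qed
    qed
    have iRy: "integrable M (\<lambda>\<omega>. iexp (r * R \<omega>) * (\<Prod>j<n. iexp (s j * y j \<omega>)))" for r s
      by (rule Bochner_Integration.integrable_bound[OF iy[of s]])
        (use iy[of s] in \<open>auto simp: norm_mult intro!: AE_I2\<close>)
    have iR: "integrable M (\<lambda>\<omega>. iexp (r * R \<omega>))" for r by (rule integrable_iexp) auto
    have iU: "integrable M (\<lambda>\<omega>. indicator U \<omega> :: complex)"
      by (rule integrable_const_bound[of _ 1]) (auto simp: indicator_def)
    have iRU: "integrable M (\<lambda>\<omega>. indicator U \<omega> * iexp (r * R \<omega>))" for r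
      by (rule integrable_const_bound[of _ 1]) (auto simp: indicator_def norm_mult)
    have eU: "(CLINT \<omega>|M. indicator U \<omega>) = of_real (prob U)"
    proof -
      have "(CLINT \<omega>|M. indicator U \<omega>) = (CLINT \<omega>|M. complex_of_real (indicator U \<omega>))"
        by (intro Bochner_Integration.integral_cong refl) (simp add: indicator_def)
      also have "\<dots> = of_real (expectation (indicator U))" by (rule integral_complex_of_real)
      finally show ?thesis by simp
    qed
    \<comment> \<open>The coordinates of \<open>y\<close> are exchanged first. The weight is the
      exponential of \<open>R\<close> minus its mean, which by the factorization integrates to 0
      against every exponential of \<open>y\<close>.\<close>
    have 1: "(CLINT \<omega>|M. (iexp (r * R \<omega>) - (CLINT \<omega>|M. iexp (r * R \<omega>))) * b \<omega>) = 0" for r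
      unfolding b_def
    proof (rule fourier_zero_box[where c = "1 + norm (CLINT \<omega>|M. iexp (r * R \<omega>))"])
      show "norm (iexp (r * R \<omega>) - (CLINT \<omega>|M. iexp (r * R \<omega>))) \<le> 1 + norm (CLINT \<omega>|M. iexp (r * R \<omega>))" for \<omega>
        by (rule order_trans[OF norm_triangle_ineq4]) simp
      fix s
      show "(CLINT \<omega>|M. (iexp (r * R \<omega>) - (CLINT \<omega>|M. iexp (r * R \<omega>))) * (\<Prod>j<n. iexp (s j * y j \<omega>))) = 0"
        using iy[of s] iRy[of r s] fac[of r s] by (simp add: left_diff_distrib)
    qed (use y C in auto)
    \<comment> \<open>Now the roles change: the centred indicator of \<open>U\<close> is the weight,
      and \<open>R\<close> is the variable still to be exchanged.\<close>
    have 2: "(CLINT \<omega>|M. of_real (indicator U \<omega> - prob U) * iexp (r * R \<omega>)) = 0" for r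
    proof -
      have "0 = (CLINT \<omega>|M. iexp (r * R \<omega>) * indicator U \<omega> - (CLINT \<omega>|M. iexp (r * R \<omega>)) * indicator U \<omega>)"
        by (subst 1[of r, symmetric], intro Bochner_Integration.integral_cong refl)
          (simp add: bU left_diff_distrib)
      also have "\<dots> = (CLINT \<omega>|M. indicator U \<omega> * iexp (r * R \<omega>)) - (CLINT \<omega>|M. iexp (r * R \<omega>)) * of_real (prob U)"
        using iRU[of r] iU eU by (simp add: mult.commute)
      also have "\<dots> = (CLINT \<omega>|M. indicator U \<omega> * iexp (r * R \<omega>) - of_real (prob U) * iexp (r * R \<omega>))"
        using iRU[of r] iR[of r] by (simp add: mult.commute)
      also have "\<dots> = (CLINT \<omega>|M. of_real (indicator U \<omega> - prob U) * iexp (r * R \<omega>))"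
        by (intro Bochner_Integration.integral_cong refl) (simp add: indicator_def algebra_simps)
      finally show ?thesis by simp
    qed
    have "expectation (\<lambda>\<omega>. (indicator U \<omega> - prob U) * indicator B (R \<omega>)) = 0"
    proof (rule fourier_zero_real[where c = 1])
      show "\<bar>indicator U \<omega> - prob U\<bar> \<le> 1" for \<omega> by (simp add: indicator_def)
    qed (use 2 in auto)
    moreover have "expectation (\<lambda>\<omega>. (indicator U \<omega> - prob U) * indicator B (R \<omega>))
        = expectation (\<lambda>\<omega>. indicator (U \<inter> (R -` B \<inter> space M)) \<omega> - prob U * indicator (R -` B \<inter> space M) \<omega>)"
      by (intro Bochner_Integration.integral_cong refl) (auto simp: indicator_def)
    moreover have "\<dots> = prob (U \<inter> (R -` B \<inter> space M)) - prob U * prob (R -` B \<inter> space M)"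
      by (subst Bochner_Integration.integral_diff) (auto simp: emeasure_eq_measure)
    moreover have "U \<inter> (R -` B \<inter> space M) = R -` B \<inter> (\<Inter>j<n. y j -` C j) \<inter> space M"
      unfolding U_def by auto
    ultimately show ?thesis unfolding U_def by (simp add: mult.commute)
  qed
  have main: "prob ((R -` B \<inter> space M) \<inter> (?y -` C \<inter> space M)) = prob (R -` B \<inter> space M) * prob (?y -` C \<inter> space M)"
    if B[measurable]: "B \<in> sets borel" and C[measurable]: "C \<in> sets ?P" for B C
  proof -
    define b where "b = prob (R -` B \<inter> space M)"
    let ?P1 = "distr (density M (indicator (R -` B \<inter> space M))) ?P ?y"
    let ?P2 = "density (distr M ?P ?y) (\<lambda>_. ennreal b)"
    have e1: "emeasure ?P1 C = ennreal (prob ((R -` B \<inter> space M) \<inter> (?y -` C \<inter> space M)))" if "C \<in> sets ?P" for C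
      using that by (subst emeasure_distr, simp, simp, subst emeasure_density)
        (auto simp: emeasure_eq_measure[symmetric] indicator_inter_arith[symmetric] Int_commute)
    have e2: "emeasure ?P2 C = ennreal (b * prob (?y -` C \<inter> space M))" if "C \<in> sets ?P" for C
      using that by (simp add: emeasure_density_const emeasure_distr emeasure_eq_measure ennreal_mult b_def)
    \<comment> \<open>The law of \<open>y\<close> restricted to the event on \<open>R\<close>, and
      the full law of \<open>y\<close> scaled by the probability of that event. They are finite and
      agree on boxes, which generate the product sigma-algebra.\<close>
    have "?P1 = ?P2"
    proof (rule measure_eqI_PiM_finite[where I = "{..<n}" and A = "\<lambda>_. space ?P"])
      fix A assume A: "\<And>i. i \<in> {..<n} \<Longrightarrow> A i \<in> sets (borel :: real measure)"
      have v: "?y -` Pi\<^sub>E {..<n} A \<inter> space M = (\<Inter>j<n. y j -` A j) \<inter> space M" by auto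
      have PA: "Pi\<^sub>E {..<n} A \<in> sets ?P" using A by (intro sets_PiM_I_finite) auto
      show "emeasure ?P1 (Pi\<^sub>E {..<n} A) = emeasure ?P2 (Pi\<^sub>E {..<n} A)"
        unfolding e1[OF PA] e2[OF PA] v
        using box[of B A] A by (simp add: b_def Int_ac)
    next
      show "range (\<lambda>_. space ?P) \<subseteq> prod_algebra {..<n} (\<lambda>_. borel :: real measure)"
        using prod_algebraI_finite[of "{..<n}" "\<lambda>_. UNIV" "\<lambda>_. borel :: real measure"] by (simp add: space_PiM)
    qed (auto simp: e1)
    then have "emeasure ?P1 C = emeasure ?P2 C" by simp
    then show ?thesis unfolding e1[OF C] e2[OF C] by (simp add: b_def)
  qed
  let ?V = "vimage_algebra (space M) ?y ?P"
  have V: "sets ?V = {?y -` C \<inter> space M | C. C \<in> sets ?P}"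
    by (rule sets_vimage_algebra2) (auto simp: space_PiM)
  have VM: "sets ?V \<subseteq> events" unfolding V using measurable_sets[OF ym] by auto
  have iU: "indicator U -` A \<inter> space M \<in> sets ?V" if "A \<in> sets borel" for A :: "real set"
    using measurable_sets[OF borel_measurable_indicator[OF U] that] by simp
  show ?thesis
    unfolding indep_var_eq
  proof (intro conjI indep_set_sigma_sets)
    show "indicator U \<in> borel_measurable M" using U VM by (intro borel_measurable_indicator) auto
    show "indep_set {indicator U -` A \<inter> space M |A. A \<in> sets (borel :: real measure)} {R -` A \<inter> space M |A. A \<in> sets borel}"
    proof (rule indep_setI)
      show "{R -` A \<inter> space M |A. A \<in> sets borel} \<subseteq> events" by auto
      show "{indicator U -` A \<inter> space M |A. A \<in> sets (borel :: real measure)} \<subseteq> events"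
        using iU VM by auto
      fix a b
      assume "a \<in> {indicator U -` A \<inter> space M |A. A \<in> sets (borel :: real measure)}"
      then have "a \<in> sets ?V" using iU by auto
      then obtain C where C: "C \<in> sets ?P" "a = ?y -` C \<inter> space M" unfolding V by auto
      assume "b \<in> {R -` A \<inter> space M |A. A \<in> sets borel}"
      then obtain B where B: "B \<in> sets borel" "b = R -` B \<inter> space M" by auto
      show "prob (a \<inter> b) = prob a * prob b"
        using main[OF B(1) C(1)] unfolding B C by (simp add: Int_commute mult.commute)
    qed
    show "Int_stable {R -` A \<inter> space M |A. A \<in> sets borel}"
      by (rule Int_stable_vimages)
    show "Int_stable {indicator U -` A \<inter> space M |A. A \<in> sets (borel :: real measure)}"
      by (rule Int_stable_vimages)
  qed (rule R)
qed

end

subsection \<open>Linear prediction in Gaussian spaces\<close>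

text \<open>The coefficient of the innovation is \<open>0\<close> (through \<open>x / 0 = 0\<close>) when the new variable
  already lies in the span of the earlier ones.\<close>

primrec lin_proj :: "'b measure \<Rightarrow> (nat \<Rightarrow> 'b \<Rightarrow> real) \<Rightarrow> nat \<Rightarrow> ('b \<Rightarrow> real) \<Rightarrow> 'b \<Rightarrow> real" where
  "lin_proj M y 0 D = (\<lambda>_. prob_space.expectation M D)"
| "lin_proj M y (Suc n) D = (\<lambda>\<omega>. lin_proj M y n D \<omega> +
     prob_space.expectation M (\<lambda>\<omega>. D \<omega> * (y n \<omega> - lin_proj M y n (y n) \<omega>)) /
     prob_space.expectation M (\<lambda>\<omega>. (y n \<omega> - lin_proj M y n (y n) \<omega>)\<^sup>2) *
     (y n \<omega> - lin_proj M y n (y n) \<omega>))"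

lemma lin_proj_cong: "(\<And>i. i < n \<Longrightarrow> y i = y' i) \<Longrightarrow> lin_proj M y n D = lin_proj M y' n D"
proof (induction n arbitrary: D)
  case (Suc n)
  then have "lin_proj M y n D = lin_proj M y' n D" for D by simp
  with Suc.prems[of n] show ?case by simp
qed simp

text \<open>Unnamed coefficients suffice: being affine in the observations gives measurability,
  membership in the Gaussian space, and orthogonality to whatever is centred and orthogonal to the
  observations.\<close>

lemma lin_proj_span:
  "\<exists>\<alpha> \<beta>. lin_proj M y n D = (\<lambda>\<omega>. \<alpha> + (\<Sum>i<n. \<beta> i * y i \<omega>))"
proof (induction n arbitrary: D)
  case 0
  then show ?case by (auto intro: exI[of _ "\<lambda>_. 0"])
next
  case (Suc n)
  obtain \<alpha> \<beta> where 1: "lin_proj M y n D = (\<lambda>\<omega>. \<alpha> + (\<Sum>i<n. \<beta> i * y i \<omega>))" using Suc by blast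
  obtain \<alpha>' \<beta>' where 2: "lin_proj M y n (y n) = (\<lambda>\<omega>. \<alpha>' + (\<Sum>i<n. \<beta>' i * y i \<omega>))" using Suc by blast
  define k where "k = prob_space.expectation M (\<lambda>\<omega>. D \<omega> * (y n \<omega> - lin_proj M y n (y n) \<omega>)) /
     prob_space.expectation M (\<lambda>\<omega>. (y n \<omega> - lin_proj M y n (y n) \<omega>)\<^sup>2)"
  have k: "lin_proj M y (Suc n) D = (\<lambda>\<omega>. lin_proj M y n D \<omega> + k * (y n \<omega> - lin_proj M y n (y n) \<omega>))"
    by (simp add: k_def)
  have "lin_proj M y (Suc n) D = (\<lambda>\<omega>. (\<alpha> - k * \<alpha>') + (\<Sum>i<Suc n. ((\<lambda>i. \<beta> i - k * \<beta>' i)(n := k)) i * y i \<omega>))"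
    unfolding k 1 2
    by (simp add: algebra_simps sum_subtractf sum_distrib_left sum.distrib)
  then show ?case by (intro exI)
qed

locale gaussian_space = prob_space M for M :: "'b measure" +
  fixes \<G> :: "('b \<Rightarrow> real) set"
  assumes const_in: "(\<lambda>_. c) \<in> \<G>"
    and lin_in: "X \<in> \<G> \<Longrightarrow> Y \<in> \<G> \<Longrightarrow> (\<lambda>\<omega>. X \<omega> + c * Y \<omega>) \<in> \<G>"
    and meas: "X \<in> \<G> \<Longrightarrow> X \<in> borel_measurable M"
    and normal: "X \<in> \<G> \<Longrightarrow> \<exists>m v. 0 \<le> v \<and> distr M borel X = normal_law m v"
begin

lemma scale_in: "X \<in> \<G> \<Longrightarrow> (\<lambda>\<omega>. c * X \<omega>) \<in> \<G>"
  using lin_in[OF const_in[of 0], of X c] by simp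

lemma add_in: "X \<in> \<G> \<Longrightarrow> Y \<in> \<G> \<Longrightarrow> (\<lambda>\<omega>. X \<omega> + Y \<omega>) \<in> \<G>"
  using lin_in[of X Y 1] by simp

lemma diff_in: "X \<in> \<G> \<Longrightarrow> Y \<in> \<G> \<Longrightarrow> (\<lambda>\<omega>. X \<omega> - Y \<omega>) \<in> \<G>"
  using lin_in[of X Y "-1"] by simp

lemma sum_in: "finite I \<Longrightarrow> (\<And>i. i \<in> I \<Longrightarrow> X i \<in> \<G>) \<Longrightarrow> (\<lambda>\<omega>. \<Sum>i\<in>I. c i * X i \<omega>) \<in> \<G>"
proof (induction I rule: finite_induct)
  case empty
  then show ?case using const_in[of 0] by simp
next
  case (insert i I)
  then show ?case using lin_in[of "\<lambda>\<omega>. \<Sum>i\<in>I. c i * X i \<omega>" "X i" "c i"] by (simp add: add.commute)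
qed

lemma integrable_in: "X \<in> \<G> \<Longrightarrow> integrable M X"
  using normal normal_law_moments(1) meas by blast

lemma integrable_sq: "X \<in> \<G> \<Longrightarrow> integrable M (\<lambda>\<omega>. (X \<omega>)\<^sup>2)"
  using normal normal_law_moments(2) meas by blast

lemma integrable_prod: 
  assumes "X \<in> \<G>" "Y \<in> \<G>"
  shows "integrable M (\<lambda>\<omega>. X \<omega> * Y \<omega>)"
proof -
  note [measurable] = meas[OF assms(1)] meas[OF assms(2)]
  have b: "\<bar>x * y\<bar> \<le> x\<^sup>2 + y\<^sup>2" for x y :: real
  proof -
    have "2 * (\<bar>x\<bar> * \<bar>y\<bar>) \<le> x\<^sup>2 + y\<^sup>2"
      using sum_squares_bound[of "\<bar>x\<bar>" "\<bar>y\<bar>"] by (simp add: mult.assoc)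
    moreover have "0 \<le> \<bar>x\<bar> * \<bar>y\<bar>" by simp
    ultimately show ?thesis unfolding abs_mult by linarith
  qed
  show ?thesis
    by (rule Bochner_Integration.integrable_bound[OF Bochner_Integration.integrable_add[OF integrable_sq[OF assms(1)] integrable_sq[OF assms(2)]]])
      (use b in \<open>auto intro!: AE_I2\<close>)
qed

lemma distr_eq:
  assumes "X \<in> \<G>"
  shows "distr M borel X = normal_law (expectation X) (expectation (\<lambda>\<omega>. (X \<omega>)\<^sup>2) - (expectation X)\<^sup>2)"
    and "0 \<le> expectation (\<lambda>\<omega>. (X \<omega>)\<^sup>2) - (expectation X)\<^sup>2"
proof -
  obtain m v where mv: "0 \<le> v" "distr M borel X = normal_law m v" using normal[OF assms] by blast
  note normal_law_moments(3,4)[OF meas[OF assms] mv]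
  with mv show "distr M borel X = normal_law (expectation X) (expectation (\<lambda>\<omega>. (X \<omega>)\<^sup>2) - (expectation X)\<^sup>2)"
    "0 \<le> expectation (\<lambda>\<omega>. (X \<omega>)\<^sup>2) - (expectation X)\<^sup>2" by simp_all
qed

lemma char_eq:
  assumes "X \<in> \<G>"
  shows "(CLINT \<omega>|M. iexp (X \<omega>)) =
    exp (\<i> * expectation X - (expectation (\<lambda>\<omega>. (X \<omega>)\<^sup>2) - (expectation X)\<^sup>2) / 2)"
proof -
  have "(CLINT \<omega>|M. iexp (X \<omega>)) = char (distr M borel X) 1"
    unfolding char_def by (subst integral_distr) (auto intro: meas assms)
  then show ?thesis
    unfolding distr_eq(1)[OF assms] char_normal_law[OF distr_eq(2)[OF assms]] by simp
qed

text \<open>Every combination of \<open>R\<close> and the \<open>y j\<close> is normal, so its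
  characteristic function depends only on mean and second moment. As \<open>R\<close> is centred,
  orthogonality means zero covariance; variances then add and the characteristic functions
  multiply.\<close>

lemma indep_residual:
  fixes y :: "nat \<Rightarrow> 'b \<Rightarrow> real"
  assumes R: "R \<in> \<G>" "expectation R = 0"
    and y: "\<And>j. j < n \<Longrightarrow> y j \<in> \<G>" "\<And>j. j < n \<Longrightarrow> expectation (\<lambda>\<omega>. R \<omega> * y j \<omega>) = 0"
    and U: "U \<in> sets (vimage_algebra (space M) (\<lambda>\<omega>. \<lambda>j\<in>{..<n}. y j \<omega>) (\<Pi>\<^sub>M j\<in>{..<n}. borel))"
  shows "indep_var borel (indicator U :: 'b \<Rightarrow> real) borel R"
proof (rule indep_var_of_char[OF _ _ _ U])
  fix r s
  define Z where "Z \<omega> = (\<Sum>j<n. s j * y j \<omega>)" for \<omega>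
  have Z: "Z \<in> \<G>" unfolding Z_def using y(1) by (intro sum_in) auto
  have ZR: "(\<lambda>\<omega>. Z \<omega> + r * R \<omega>) \<in> \<G>" by (intro lin_in Z R)
  have eRZ: "expectation (\<lambda>\<omega>. R \<omega> * Z \<omega>) = 0"
  proof -
    have "expectation (\<lambda>\<omega>. R \<omega> * Z \<omega>) = expectation (\<lambda>\<omega>. \<Sum>j<n. s j * (R \<omega> * y j \<omega>))"
      unfolding Z_def by (simp add: sum_distrib_left algebra_simps)
    also have "\<dots> = (\<Sum>j<n. s j * expectation (\<lambda>\<omega>. R \<omega> * y j \<omega>))"
      by (subst Bochner_Integration.integral_sum) (auto intro!: integrable_prod R y)
    finally show ?thesis using y(2) by simp
  qed
  have p: "(\<Prod>j<n. iexp (s j * y j \<omega>)) = iexp (Z \<omega>)" for \<omega>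
    unfolding Z_def by (simp add: exp_sum sum_distrib_left)
  have e1: "expectation (\<lambda>\<omega>. Z \<omega> + r * R \<omega>) = expectation Z"
    using integrable_in[OF Z] integrable_in[OF R(1)] R(2) by simp
  have "expectation (\<lambda>\<omega>. (Z \<omega> + r * R \<omega>)\<^sup>2) = expectation (\<lambda>\<omega>. (Z \<omega>)\<^sup>2 + (2 * r) * (R \<omega> * Z \<omega>) + r\<^sup>2 * (R \<omega>)\<^sup>2)"
    by (intro Bochner_Integration.integral_cong refl) (simp add: power2_eq_square algebra_simps)
  also have "\<dots> = expectation (\<lambda>\<omega>. (Z \<omega>)\<^sup>2) + r\<^sup>2 * expectation (\<lambda>\<omega>. (R \<omega>)\<^sup>2)"
    using integrable_sq[OF Z] integrable_sq[OF R(1)] integrable_prod[OF R(1) Z] eRZ by simp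
  finally have e2: "expectation (\<lambda>\<omega>. (Z \<omega> + r * R \<omega>)\<^sup>2) = expectation (\<lambda>\<omega>. (Z \<omega>)\<^sup>2) + r\<^sup>2 * expectation (\<lambda>\<omega>. (R \<omega>)\<^sup>2)" .
  have rR: "(\<lambda>\<omega>. r * R \<omega>) \<in> \<G>" by (intro scale_in R)
  have "(CLINT \<omega>|M. iexp (r * R \<omega>) * iexp (Z \<omega>)) = (CLINT \<omega>|M. iexp (Z \<omega> + r * R \<omega>))"
    by (intro Bochner_Integration.integral_cong refl) (simp add: exp_add distrib_left)
  also have "\<dots> = exp (\<i> * expectation Z - (expectation (\<lambda>\<omega>. (Z \<omega>)\<^sup>2) + r\<^sup>2 * expectation (\<lambda>\<omega>. (R \<omega>)\<^sup>2) - (expectation Z)\<^sup>2) / 2)"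
    unfolding char_eq[OF ZR] e1 e2 ..
  also have "\<dots> = exp ((\<i> * expectation (\<lambda>\<omega>. r * R \<omega>) - (expectation (\<lambda>\<omega>. (r * R \<omega>)\<^sup>2) - (expectation (\<lambda>\<omega>. r * R \<omega>))\<^sup>2) / 2) +
      (\<i> * expectation Z - (expectation (\<lambda>\<omega>. (Z \<omega>)\<^sup>2) - (expectation Z)\<^sup>2) / 2))"
    using R(2) by (simp add: power_mult_distrib add_divide_distrib diff_divide_distrib algebra_simps)
  also have "\<dots> = (CLINT \<omega>|M. iexp (r * R \<omega>)) * (CLINT \<omega>|M. iexp (Z \<omega>))"
    unfolding char_eq[OF rR] char_eq[OF Z] exp_add ..
  finally show "(CLINT \<omega>|M. iexp (r * R \<omega>) * (\<Prod>j<n. iexp (s j * y j \<omega>)))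
        = (CLINT \<omega>|M. iexp (r * R \<omega>)) * (CLINT \<omega>|M. (\<Prod>j<n. iexp (s j * y j \<omega>)))"
    unfolding p .
qed (auto intro: meas R y)

lemma lin_proj_in:
  assumes "\<And>j. j < n \<Longrightarrow> y j \<in> \<G>"
  shows "lin_proj M y n D \<in> \<G>"
proof -
  obtain \<alpha> \<beta> where "lin_proj M y n D = (\<lambda>\<omega>. \<alpha> + (\<Sum>i<n. \<beta> i * y i \<omega>))" using lin_proj_span by blast
  then show ?thesis using assms by (auto intro!: add_in const_in sum_in)
qed

lemma orth_lin_proj:
  assumes y: "\<And>j. j < n \<Longrightarrow> y j \<in> \<G>" and R: "R \<in> \<G>" "expectation R = 0"
    and o: "\<And>j. j < n \<Longrightarrow> expectation (\<lambda>\<omega>. R \<omega> * y j \<omega>) = 0"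
  shows "expectation (\<lambda>\<omega>. R \<omega> * lin_proj M y n D \<omega>) = 0"
proof -
  obtain \<alpha> \<beta> where p: "lin_proj M y n D = (\<lambda>\<omega>. \<alpha> + (\<Sum>i<n. \<beta> i * y i \<omega>))" using lin_proj_span by blast
  have "expectation (\<lambda>\<omega>. R \<omega> * lin_proj M y n D \<omega>) = expectation (\<lambda>\<omega>. \<alpha> * R \<omega> + (\<Sum>i<n. \<beta> i * (R \<omega> * y i \<omega>)))"
    unfolding p by (intro Bochner_Integration.integral_cong refl) (simp add: algebra_simps sum_distrib_left)
  also have "\<dots> = \<alpha> * expectation R + (\<Sum>i<n. \<beta> i * expectation (\<lambda>\<omega>. R \<omega> * y i \<omega>))"
  proof -
    have i: "integrable M (\<lambda>\<omega>. \<beta> i * (R \<omega> * y i \<omega>))" if "i < n" for i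
      using that by (intro integrable_mult_right integrable_prod R y)
    then have "integrable M (\<lambda>\<omega>. \<Sum>i<n. \<beta> i * (R \<omega> * y i \<omega>))"
      by (intro Bochner_Integration.integrable_sum) auto
    then show ?thesis
      using integrable_in[OF R(1)] i by (simp add: Bochner_Integration.integral_sum)
  qed
  finally show ?thesis using R o by simp
qed

text \<open>Gram-Schmidt: the innovation \<open>u\<close> is centred and orthogonal to the earlier
  variables, so subtracting a multiple of it keeps the relations already obtained, and the
  coefficient makes the residual orthogonal to \<open>u\<close>. Since \<open>y n\<close> is
  \<open>u\<close> plus an element of the earlier span, orthogonality to \<open>y n\<close>
  follows.\<close>

lemma lin_proj_residual:
  assumes "\<And>j. j < n \<Longrightarrow> y j \<in> \<G>" and "D \<in> \<G>"
  shows "expectation (\<lambda>\<omega>. D \<omega> - lin_proj M y n D \<omega>) = 0 \<and>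
    (\<forall>j<n. expectation (\<lambda>\<omega>. (D \<omega> - lin_proj M y n D \<omega>) * y j \<omega>) = 0)"
  using assms
proof (induction n arbitrary: D)
  case 0
  then show ?case using integrable_in prob_space by simp
next
  case (Suc n)
  have y: "y j \<in> \<G>" if "j < Suc n" for j using Suc.prems that by auto
  have D: "D \<in> \<G>" by fact
  define u where "u \<omega> = y n \<omega> - lin_proj M y n (y n) \<omega>" for \<omega>
  define d where "d \<omega> = D \<omega> - lin_proj M y n D \<omega>" for \<omega>
  define k where "k = expectation (\<lambda>\<omega>. D \<omega> * u \<omega>) / expectation (\<lambda>\<omega>. (u \<omega>)\<^sup>2)"
  have g: "lin_proj M y n Z \<in> \<G>" for Z using y by (intro lin_proj_in) auto
  have u: "u \<in> \<G>" unfolding u_def by (intro diff_in g y) simp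
  have d: "d \<in> \<G>" unfolding d_def by (intro diff_in g D)
  have IHu: "expectation u = 0" "\<And>j. j < n \<Longrightarrow> expectation (\<lambda>\<omega>. u \<omega> * y j \<omega>) = 0"
    using Suc.IH[of "y n"] y unfolding u_def by auto
  have IHd: "expectation d = 0" "\<And>j. j < n \<Longrightarrow> expectation (\<lambda>\<omega>. d \<omega> * y j \<omega>) = 0"
    using Suc.IH[of D] y D unfolding d_def by auto
  have e: "D \<omega> - lin_proj M y (Suc n) D \<omega> = d \<omega> - k * u \<omega>" for \<omega>
    by (simp add: d_def u_def k_def)
  have r: "(\<lambda>\<omega>. d \<omega> - k * u \<omega>) \<in> \<G>" by (intro diff_in scale_in d u)
  have r0: "expectation (\<lambda>\<omega>. d \<omega> - k * u \<omega>) = 0"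
    using integrable_in[OF d] integrable_in[OF u] IHd(1) IHu(1) by simp
  have rZ: "expectation (\<lambda>\<omega>. (d \<omega> - k * u \<omega>) * Z \<omega>) = expectation (\<lambda>\<omega>. d \<omega> * Z \<omega>) - k * expectation (\<lambda>\<omega>. u \<omega> * Z \<omega>)"
    if "Z \<in> \<G>" for Z
  proof -
    have "expectation (\<lambda>\<omega>. (d \<omega> - k * u \<omega>) * Z \<omega>) = expectation (\<lambda>\<omega>. d \<omega> * Z \<omega> - k * (u \<omega> * Z \<omega>))"
      by (simp add: algebra_simps)
    also have "\<dots> = expectation (\<lambda>\<omega>. d \<omega> * Z \<omega>) - k * expectation (\<lambda>\<omega>. u \<omega> * Z \<omega>)"
      using integrable_prod[OF d that] integrable_prod[OF u that] by simp
    finally show ?thesis .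
  qed
  have rj: "expectation (\<lambda>\<omega>. (d \<omega> - k * u \<omega>) * y j \<omega>) = 0" if "j < n" for j
    using rZ[of "y j"] that y IHd(2) IHu(2) by simp
  \<comment> \<open>\<open>D\<close> and its earlier residual have the same product moment with
    \<open>u\<close>, because \<open>u\<close> is orthogonal to the earlier projection. So
    \<open>k\<close>, written with \<open>D\<close>, is the coefficient of the residual too.\<close>
  have du: "expectation (\<lambda>\<omega>. d \<omega> * u \<omega>) = expectation (\<lambda>\<omega>. D \<omega> * u \<omega>)"
  proof -
    have "expectation (\<lambda>\<omega>. d \<omega> * u \<omega>) = expectation (\<lambda>\<omega>. D \<omega> * u \<omega> - u \<omega> * lin_proj M y n D \<omega>)"
      unfolding d_def by (simp add: algebra_simps)
    also have "\<dots> = expectation (\<lambda>\<omega>. D \<omega> * u \<omega>)"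
      using integrable_prod[OF D u] integrable_prod[OF u g] orth_lin_proj[OF _ u IHu, where D = D] y by simp
    finally show ?thesis .
  qed
  have ru: "expectation (\<lambda>\<omega>. (d \<omega> - k * u \<omega>) * u \<omega>) = 0"
  proof (cases "expectation (\<lambda>\<omega>. (u \<omega>)\<^sup>2) = 0")
    \<comment> \<open>A vanishing second moment makes the innovation vanish almost surely, so every
      coefficient would be correct.\<close>
    case True
    then have "AE \<omega> in M. (u \<omega>)\<^sup>2 = 0"
      using integrable_sq[OF u] by (subst (asm) integral_nonneg_eq_0_iff_AE) auto
    then have "expectation (\<lambda>\<omega>. (d \<omega> - k * u \<omega>) * u \<omega>) = expectation (\<lambda>\<omega>. 0)"
      using meas[OF u] meas[OF d] by (intro integral_cong_AE) auto
    then show ?thesis by simp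
  next
    case False
    then show ?thesis using rZ[OF u] du by (simp add: k_def power2_eq_square)
  qed
  have rn: "expectation (\<lambda>\<omega>. (d \<omega> - k * u \<omega>) * y n \<omega>) = 0"
  proof -
    have "expectation (\<lambda>\<omega>. (d \<omega> - k * u \<omega>) * y n \<omega>) =
      expectation (\<lambda>\<omega>. (d \<omega> - k * u \<omega>) * u \<omega> + (d \<omega> - k * u \<omega>) * lin_proj M y n (y n) \<omega>)"
      unfolding u_def by (simp add: algebra_simps)
    also have "\<dots> = 0"
      using integrable_prod[OF r u] integrable_prod[OF r g[of "y n"]] ru orth_lin_proj[OF _ r r0 rj, where D = "y n"] y by simp
    finally show ?thesis .
  qed
  show ?case unfolding e using r0 rj rn by (auto simp: less_Suc_eq)
qed

lemma lin_proj_diff: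
  assumes "\<And>j. j < n \<Longrightarrow> y j \<in> \<G>" and "D \<in> \<G>" "D' \<in> \<G>"
  shows "lin_proj M y n (\<lambda>\<omega>. D \<omega> - D' \<omega>) \<omega> = lin_proj M y n D \<omega> - lin_proj M y n D' \<omega>"
  using assms
proof (induction n arbitrary: \<omega>)
  case 0
  then show ?case using integrable_in by simp
next
  case (Suc n)
  define u where "u \<omega> = y n \<omega> - lin_proj M y n (y n) \<omega>" for \<omega>
  have u: "u \<in> \<G>" unfolding u_def using Suc.prems by (intro diff_in lin_proj_in) auto
  have "expectation (\<lambda>\<omega>. (D \<omega> - D' \<omega>) * u \<omega>) = expectation (\<lambda>\<omega>. D \<omega> * u \<omega>) - expectation (\<lambda>\<omega>. D' \<omega> * u \<omega>)"
    using integrable_prod[OF Suc.prems(2) u] integrable_prod[OF Suc.prems(3) u] by (simp add: left_diff_distrib)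
  note key = this
  have "lin_proj M y (Suc n) (\<lambda>\<omega>. D \<omega> - D' \<omega>) \<omega> = lin_proj M y n (\<lambda>\<omega>. D \<omega> - D' \<omega>) \<omega> +
      expectation (\<lambda>\<omega>. (D \<omega> - D' \<omega>) * u \<omega>) / expectation (\<lambda>\<omega>. (u \<omega>)\<^sup>2) * u \<omega>"
    by (simp add: u_def)
  also have "\<dots> = lin_proj M y n D \<omega> - lin_proj M y n D' \<omega> +
      (expectation (\<lambda>\<omega>. D \<omega> * u \<omega>) - expectation (\<lambda>\<omega>. D' \<omega> * u \<omega>)) / expectation (\<lambda>\<omega>. (u \<omega>)\<^sup>2) * u \<omega>"
    unfolding key using Suc by simp
  also have "\<dots> = lin_proj M y (Suc n) D \<omega> - lin_proj M y (Suc n) D' \<omega>"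
    by (simp add: u_def diff_divide_distrib left_diff_distrib)
  finally show ?case .
qed

text \<open>The increment is the multiple \<open>k * u\<close> of the innovation. The fourth claim
  is the essential one: if an observation hardly moves the projection of \<open>D\<close>, then the
  residual of \<open>D\<close> is almost uncorrelated with that observation. The last claim
  expresses that a projection does not increase second moments.\<close>

lemma lin_proj_increment:
  assumes y: "\<And>j. j < Suc n \<Longrightarrow> y j \<in> \<G>" and D: "D \<in> \<G>"
  defines "X \<equiv> \<lambda>\<omega>. lin_proj M y (Suc n) D \<omega> - lin_proj M y n D \<omega>"
  shows "X \<in> \<G>" "expectation X = 0" "\<And>j. j < n \<Longrightarrow> expectation (\<lambda>\<omega>. X \<omega> * y j \<omega>) = 0"
    "(expectation (\<lambda>\<omega>. (D \<omega> - lin_proj M y n D \<omega>) * y n \<omega>))\<^sup>2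
      \<le> expectation (\<lambda>\<omega>. (X \<omega>)\<^sup>2) * expectation (\<lambda>\<omega>. (y n \<omega>)\<^sup>2)"
    "expectation (\<lambda>\<omega>. (X \<omega>)\<^sup>2) \<le> expectation (\<lambda>\<omega>. (D \<omega>)\<^sup>2)"
proof -
  define u where "u \<omega> = y n \<omega> - lin_proj M y n (y n) \<omega>" for \<omega>
  define d where "d \<omega> = D \<omega> - lin_proj M y n D \<omega>" for \<omega>
  define k where "k = expectation (\<lambda>\<omega>. D \<omega> * u \<omega>) / expectation (\<lambda>\<omega>. (u \<omega>)\<^sup>2)"
  have g: "lin_proj M y n Z \<in> \<G>" for Z using y by (intro lin_proj_in) auto
  have u: "u \<in> \<G>" unfolding u_def by (intro diff_in g y) simp
  have d: "d \<in> \<G>" unfolding d_def by (intro diff_in g D)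
  have yn: "y n \<in> \<G>" using y by simp
  have u0: "expectation u = 0" "\<And>j. j < n \<Longrightarrow> expectation (\<lambda>\<omega>. u \<omega> * y j \<omega>) = 0"
    using lin_proj_residual[of n y "y n"] y unfolding u_def by auto
  have d0: "expectation d = 0" "\<And>j. j < n \<Longrightarrow> expectation (\<lambda>\<omega>. d \<omega> * y j \<omega>) = 0"
    using lin_proj_residual[of n y D] y D unfolding d_def by auto
  have X: "X = (\<lambda>\<omega>. k * u \<omega>)" unfolding X_def by (simp add: u_def k_def)
  show "X \<in> \<G>" unfolding X by (intro scale_in u)
  show "expectation X = 0" unfolding X using u0 by simp
  show "expectation (\<lambda>\<omega>. X \<omega> * y j \<omega>) = 0" if "j < n" for j
    unfolding X using u0(2)[OF that] by (simp add: mult.assoc)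
  have "expectation (\<lambda>\<omega>. D \<omega> * u \<omega>) = expectation (\<lambda>\<omega>. d \<omega> * u \<omega> + u \<omega> * lin_proj M y n D \<omega>)"
    unfolding d_def by (simp add: algebra_simps)
  also have "\<dots> = expectation (\<lambda>\<omega>. d \<omega> * u \<omega>)"
    using integrable_prod[OF d u] integrable_prod[OF u g] orth_lin_proj[OF _ u u0, where D = D] y by simp
  also have "\<dots> = expectation (\<lambda>\<omega>. d \<omega> * y n \<omega> - d \<omega> * lin_proj M y n (y n) \<omega>)"
    unfolding u_def by (simp add: algebra_simps)
  also have "\<dots> = expectation (\<lambda>\<omega>. d \<omega> * y n \<omega>)"
    using integrable_prod[OF d yn] integrable_prod[OF d g] orth_lin_proj[OF _ d d0, where D = "y n"] y by simp
  finally have Du: "expectation (\<lambda>\<omega>. D \<omega> * u \<omega>) = expectation (\<lambda>\<omega>. d \<omega> * y n \<omega>)" .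
  have eX: "expectation (\<lambda>\<omega>. (X \<omega>)\<^sup>2) = k\<^sup>2 * expectation (\<lambda>\<omega>. (u \<omega>)\<^sup>2)"
    unfolding X by (simp add: power_mult_distrib)
  \<comment> \<open>An equality, not merely Cauchy-Schwarz, because \<open>X\<close> is proportional
    to \<open>u\<close>; replacing \<open>u\<close> by the longer \<open>y n\<close> afterwards
    gives the inequality.\<close>
  have cs: "(expectation (\<lambda>\<omega>. D \<omega> * u \<omega>))\<^sup>2 = expectation (\<lambda>\<omega>. (X \<omega>)\<^sup>2) * expectation (\<lambda>\<omega>. (u \<omega>)\<^sup>2)"
  proof (cases "expectation (\<lambda>\<omega>. (u \<omega>)\<^sup>2) = 0")
    case True
    then have "AE \<omega> in M. (u \<omega>)\<^sup>2 = 0"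
      using integrable_sq[OF u] by (subst (asm) integral_nonneg_eq_0_iff_AE) auto
    then have "expectation (\<lambda>\<omega>. D \<omega> * u \<omega>) = expectation (\<lambda>\<omega>. 0)"
      using meas[OF u] meas[OF D] by (intro integral_cong_AE) auto
    then show ?thesis using True by simp
  next
    case False
    then show ?thesis unfolding eX by (simp add: k_def power2_eq_square)
  qed
  have "expectation (\<lambda>\<omega>. (y n \<omega>)\<^sup>2) = expectation (\<lambda>\<omega>. (u \<omega>)\<^sup>2 + 2 * (u \<omega> * lin_proj M y n (y n) \<omega>) + (lin_proj M y n (y n) \<omega>)\<^sup>2)"
    unfolding u_def by (intro Bochner_Integration.integral_cong refl) (simp add: power2_eq_square algebra_simps)
  also have "\<dots> = expectation (\<lambda>\<omega>. (u \<omega>)\<^sup>2) + expectation (\<lambda>\<omega>. (lin_proj M y n (y n) \<omega>)\<^sup>2)"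
    using integrable_sq[OF u] integrable_sq[OF g] integrable_prod[OF u g] orth_lin_proj[OF _ u u0, where D = "y n"] y by simp
  finally have uy: "expectation (\<lambda>\<omega>. (u \<omega>)\<^sup>2) \<le> expectation (\<lambda>\<omega>. (y n \<omega>)\<^sup>2)" by simp
  show "(expectation (\<lambda>\<omega>. (D \<omega> - lin_proj M y n D \<omega>) * y n \<omega>))\<^sup>2
      \<le> expectation (\<lambda>\<omega>. (X \<omega>)\<^sup>2) * expectation (\<lambda>\<omega>. (y n \<omega>)\<^sup>2)"
    using mult_left_mono[OF uy, of "expectation (\<lambda>\<omega>. (X \<omega>)\<^sup>2)"] cs unfolding Du d_def by simp
  have DX: "expectation (\<lambda>\<omega>. D \<omega> * X \<omega>) = expectation (\<lambda>\<omega>. (X \<omega>)\<^sup>2)"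
  proof -
    have "expectation (\<lambda>\<omega>. D \<omega> * X \<omega>) = k * expectation (\<lambda>\<omega>. D \<omega> * u \<omega>)"
      unfolding X by (simp add: mult.left_commute)
    also have "\<dots> = expectation (\<lambda>\<omega>. (X \<omega>)\<^sup>2)" unfolding eX
      by (simp add: k_def power2_eq_square)
    finally show ?thesis .
  qed
  have Xi: "X \<in> \<G>" by fact
  have "0 \<le> expectation (\<lambda>\<omega>. (D \<omega> - X \<omega>)\<^sup>2)" by (intro integral_nonneg_AE) auto
  also have "\<dots> = expectation (\<lambda>\<omega>. (D \<omega>)\<^sup>2 - 2 * (D \<omega> * X \<omega>) + (X \<omega>)\<^sup>2)"
    by (intro Bochner_Integration.integral_cong refl) (simp add: power2_eq_square algebra_simps)
  also have "\<dots> = expectation (\<lambda>\<omega>. (D \<omega>)\<^sup>2) - expectation (\<lambda>\<omega>. (X \<omega>)\<^sup>2)"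
    using integrable_sq[OF D] integrable_sq[OF Xi] integrable_prod[OF D Xi] DX by simp
  finally show "expectation (\<lambda>\<omega>. (X \<omega>)\<^sup>2) \<le> expectation (\<lambda>\<omega>. (D \<omega>)\<^sup>2)" by simp
qed

end

context prob_space begin

lemma char_affine:
  assumes [measurable]: "X \<in> borel_measurable M"
  shows "char (distr M borel (\<lambda>\<omega>. a + c * X \<omega>)) t = iexp (t * a) * char (distr M borel X) (t * c)"
proof -
  have "char (distr M borel (\<lambda>\<omega>. a + c * X \<omega>)) t = (CLINT \<omega>|M. iexp (t * (a + c * X \<omega>)))"
    unfolding char_def by (subst integral_distr) auto
  also have "\<dots> = (CLINT \<omega>|M. iexp (t * a) * iexp (t * c * X \<omega>))"
    by (intro Bochner_Integration.integral_cong refl) (simp add: exp_add[symmetric] algebra_simps)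
  also have "\<dots> = iexp (t * a) * (CLINT \<omega>|M. iexp (t * c * X \<omega>))" by simp
  also have "(CLINT \<omega>|M. iexp (t * c * X \<omega>)) = char (distr M borel X) (t * c)"
    unfolding char_def by (subst integral_distr) auto
  finally show ?thesis .
qed

lemma distr_eq_normal_law:
  assumes X: "X \<in> borel_measurable M" and v: "0 \<le> v"
    and c: "\<And>t. char (distr M borel X) t = exp (\<i> * (t * m) - t\<^sup>2 * v / 2)"
  shows "distr M borel X = normal_law m v"
proof (rule Levy_uniqueness)
  show "char (distr M borel X) = char (normal_law m v)"
    by (rule ext) (simp only: c char_normal_law[OF v])
qed (intro real_distribution_distr X real_distribution_normal_law v)+

end

subsection \<open>Gaussian observations along a fixed path\<close>

declare lin_proj.simps [simp del]

text \<open>The product structure of the points matters only for the form of the objective, so the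
  analysis runs over an arbitrary finite index set \<open>S\<close> and arbitrary linear
  combinations of the \<open>F s\<close>.\<close>

locale gp_sampling = prob_space M for M :: "'b measure" +
  fixes S :: "'s set" and \<mu> K lam and F :: "'s \<Rightarrow> 'b \<Rightarrow> real" and eps :: "nat \<Rightarrow> 's \<Rightarrow> 'b \<Rightarrow> real"
  assumes finite_S: "finite S"
    and psd: "psd_on S K"
    and gp: "gaussian_process M S \<mu> K F"
    and lam_nonneg: "\<And>s. s \<in> S \<Longrightarrow> 0 \<le> lam s"
    and noise: "independent_normal_noise M S lam F eps"
begin

lemma F_meas[measurable (raw)]: "s \<in> S \<Longrightarrow> F s \<in> borel_measurable M"
  using gp by (simp add: gaussian_process_def)

lemma eps_meas[measurable (raw)]: "s \<in> S \<Longrightarrow> eps n s \<in> borel_measurable M"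
  using noise by (simp add: independent_normal_noise_def)

lemma eps_distr: "s \<in> S \<Longrightarrow> distr M borel (eps n s) = normal_law 0 (lam s)"
  using noise by (simp add: independent_normal_noise_def)

lemma F_sum_distr:
  "\<exists>m v. 0 \<le> v \<and> distr M borel (\<lambda>\<omega>. \<Sum>s\<in>S. c s * F s \<omega>) = normal_law m v"
proof -
  have "distr M borel (\<lambda>\<omega>. \<Sum>s\<in>S. c s * F s \<omega>) = normal_law (\<Sum>s\<in>S. c s * \<mu> s) (\<Sum>s\<in>S. \<Sum>t\<in>S. c s * c t * K s t)"
    using conjunct2[OF gp[unfolded gaussian_process_def], rule_format, of S c] finite_S by blast
  moreover have "0 \<le> (\<Sum>s\<in>S. \<Sum>t\<in>S. c s * c t * K s t)"
    using conjunct2[OF psd[unfolded psd_on_def], rule_format, of S c] finite_S by blast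
  ultimately show ?thesis by blast
qed

definition block :: "nat option \<Rightarrow> 'b \<Rightarrow> 's \<Rightarrow> real" where
  "block i \<omega> = (\<lambda>s\<in>S. case i of None \<Rightarrow> F s \<omega> | Some n \<Rightarrow> eps n s \<omega>)"

lemma indep_block: "indep_vars (\<lambda>_. \<Pi>\<^sub>M s\<in>S. borel) block UNIV"
  using noise unfolding independent_normal_noise_def block_def by simp

text \<open>Only the noise actually met along \<open>q\<close> is included. The noise components of
  one step are not assumed to be jointly normal, so a space containing all of them need not be
  Gaussian; this is why the space depends on the path.\<close>

definition gspace :: "(nat \<Rightarrow> 's) \<Rightarrow> nat \<Rightarrow> ('b \<Rightarrow> real) set" where
  "gspace q n = {X. \<exists>a c d. X = (\<lambda>\<omega>. a + (\<Sum>s\<in>S. c s * F s \<omega>) + (\<Sum>i<n. d i * eps i (q i) \<omega>))}"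

lemma gspaceI: "X = (\<lambda>\<omega>. a + (\<Sum>s\<in>S. c s * F s \<omega>) + (\<Sum>i<n. d i * eps i (q i) \<omega>)) \<Longrightarrow> X \<in> gspace q n"
  unfolding gspace_def by blast

text \<open>The combination is a sum of independent terms, one from \<open>F\<close> with the
  constant and one from the noise of each step. Their characteristic functions multiply to that of a
  normal law.\<close>

lemma gspace_normal:
  assumes q: "\<And>i. i < n \<Longrightarrow> q i \<in> S" and X: "X \<in> gspace q n"
  shows "\<exists>m v. 0 \<le> v \<and> distr M borel X = normal_law m v"
proof -
  obtain a c d where X: "X = (\<lambda>\<omega>. a + (\<Sum>s\<in>S. c s * F s \<omega>) + (\<Sum>i<n. d i * eps i (q i) \<omega>))"
    using X unfolding gspace_def by blast
  obtain m v where v: "0 \<le> v" and mv: "distr M borel (\<lambda>\<omega>. \<Sum>s\<in>S. c s * F s \<omega>) = normal_law m v"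
    using F_sum_distr by blast
  define I where "I = insert None (Some ` {..<n})"
  define Y where "Y i f = (case i of None \<Rightarrow> a + (\<Sum>s\<in>S. c s * f s) | Some j \<Rightarrow> d j * f (q j))"
    for i :: "nat option" and f :: "'s \<Rightarrow> real"
  have Y: "Y i \<in> borel_measurable (\<Pi>\<^sub>M s\<in>S. borel)" if "i \<in> I" for i
  proof (cases i)
    case None
    then show ?thesis unfolding Y_def by simp
  next
    case (Some j)
    with that q have [measurable]: "q j \<in> S" by (auto simp: I_def)
    have "(\<lambda>f. f (q j)) \<in> borel_measurable (\<Pi>\<^sub>M s\<in>S. (borel :: real measure))"
      by (rule measurable_component_singleton) fact
    then show ?thesis unfolding Y_def Some by simp
  qed
  define Z where "Z i \<omega> = Y i (block i \<omega>)" for i \<omega>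
  have iZ: "indep_vars (\<lambda>_. borel) Z I"
    unfolding Z_def by (rule indep_vars_compose2[OF indep_vars_subset[OF indep_block]]) (auto intro: Y)
  have ZN: "Z None = (\<lambda>\<omega>. a + 1 * (\<Sum>s\<in>S. c s * F s \<omega>))"
    unfolding Z_def Y_def block_def by (auto intro!: sum.cong)
  have ZS: "Z (Some j) = (\<lambda>\<omega>. 0 + d j * eps j (q j) \<omega>)" if "j < n" for j
    unfolding Z_def Y_def block_def using q[OF that] by auto
  have XZ: "X = (\<lambda>\<omega>. \<Sum>i\<in>I. Z i \<omega>)"
    unfolding X I_def by (rule ext) (simp add: sum.reindex ZN ZS)
  have [measurable]: "X \<in> borel_measurable M" 
    unfolding X using q by (intro borel_measurable_add borel_measurable_sum borel_measurable_times
        borel_measurable_const F_meas eps_meas) auto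
  have "char (distr M borel X) t = exp (\<i> * (t * (a + m)) - t\<^sup>2 * (v + (\<Sum>j<n. (d j)\<^sup>2 * lam (q j))) / 2)" for t
  proof -
    have "char (distr M borel X) t = (\<Prod>i\<in>I. char (distr M borel (Z i)) t)"
      unfolding XZ by (rule char_distr_sum[OF iZ])
    also have "\<dots> = char (distr M borel (Z None)) t * (\<Prod>j<n. char (distr M borel (Z (Some j))) t)"
      unfolding I_def by (subst prod.insert) (auto simp: prod.reindex)
    also have "char (distr M borel (Z None)) t = iexp (t * a) * exp (\<i> * (t * m) - t\<^sup>2 * v / 2)"
      unfolding ZN by (subst char_affine) (simp_all add: mv char_normal_law[OF v])
    also have "(\<Prod>j<n. char (distr M borel (Z (Some j))) t) = (\<Prod>j<n. exp (complex_of_real (- (t * d j)\<^sup>2 * lam (q j) / 2)))"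
    proof (rule prod.cong[OF refl])
      fix j assume "j \<in> {..<n}"
      then have j: "j < n" "q j \<in> S" using q by auto
      show "char (distr M borel (Z (Some j))) t = exp (complex_of_real (- (t * d j)\<^sup>2 * lam (q j) / 2))"
        unfolding ZS[OF j(1)] using j
        by (subst char_affine) (simp_all add: eps_meas eps_distr char_normal_law lam_nonneg)
    qed
    also have "\<dots> = exp (\<Sum>j<n. complex_of_real (- (t * d j)\<^sup>2 * lam (q j) / 2))"
      by (rule exp_sum[symmetric]) simp
    also have "(\<Sum>j<n. complex_of_real (- (t * d j)\<^sup>2 * lam (q j) / 2)) = complex_of_real (- t\<^sup>2 * (\<Sum>j<n. (d j)\<^sup>2 * lam (q j)) / 2)"
      by (simp add: sum_distrib_left sum_negf power_mult_distrib sum_divide_distrib mult.assoc)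
    finally show ?thesis
      by (simp add: exp_add[symmetric] add_divide_distrib algebra_simps)
  qed
  moreover have "0 \<le> v + (\<Sum>j<n. (d j)\<^sup>2 * lam (q j))"
    using v q by (intro add_nonneg_nonneg sum_nonneg mult_nonneg_nonneg lam_nonneg) auto
  ultimately have "distr M borel X = normal_law (a + m) (v + (\<Sum>j<n. (d j)\<^sup>2 * lam (q j)))"
    by (intro distr_eq_normal_law) auto
  with \<open>0 \<le> v + _\<close> show ?thesis by blast
qed

lemma gaussian_space_gspace:
  assumes q: "\<And>i. i < n \<Longrightarrow> q i \<in> S"
  shows "gaussian_space M (gspace q n)"
proof unfold_locales
  show "(\<lambda>_. c) \<in> gspace q n" for c
    by (rule gspaceI[where a = c and c = "\<lambda>_. 0" and d = "\<lambda>_. 0"]) simp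
next
  fix X Y c assume "X \<in> gspace q n" "Y \<in> gspace q n"
  then obtain a1 c1 d1 a2 c2 d2 where
    X: "X = (\<lambda>\<omega>. a1 + (\<Sum>s\<in>S. c1 s * F s \<omega>) + (\<Sum>i<n. d1 i * eps i (q i) \<omega>))" and
    Y: "Y = (\<lambda>\<omega>. a2 + (\<Sum>s\<in>S. c2 s * F s \<omega>) + (\<Sum>i<n. d2 i * eps i (q i) \<omega>))"
    unfolding gspace_def by blast
  show "(\<lambda>\<omega>. X \<omega> + c * Y \<omega>) \<in> gspace q n"
    by (rule gspaceI[where a = "a1 + c * a2" and c = "\<lambda>s. c1 s + c * c2 s" and d = "\<lambda>i. d1 i + c * d2 i"])
      (simp add: X Y algebra_simps sum.distrib sum_distrib_left)
next
  fix X assume "X \<in> gspace q n"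
  then obtain a c d where X: "X = (\<lambda>\<omega>. a + (\<Sum>s\<in>S. c s * F s \<omega>) + (\<Sum>i<n. d i * eps i (q i) \<omega>))"
    unfolding gspace_def by blast
  show "X \<in> borel_measurable M" 
    unfolding X using q by (intro borel_measurable_add borel_measurable_sum borel_measurable_times
        borel_measurable_const F_meas eps_meas) auto
next
  fix X assume "X \<in> gspace q n"
  with q show "\<exists>m v. 0 \<le> v \<and> distr M borel X = normal_law m v" by (rule gspace_normal)
qed

lemma F_sum_in_gspace: "(\<lambda>\<omega>. \<Sum>s\<in>S. c s * F s \<omega>) \<in> gspace q n"
  by (rule gspaceI[where a = 0 and c = c and d = "\<lambda>_. 0"]) simp

lemma F_in_gspace: "s \<in> S \<Longrightarrow> F s \<in> gspace q n"
proof -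
  assume "s \<in> S"
  then have "F s \<omega> = (\<Sum>t\<in>S. of_bool (t = s) * F t \<omega>)" for \<omega>
  proof -
    have "(\<Sum>t\<in>S. of_bool (t = s) * F t \<omega>) = (\<Sum>t\<in>S. if t = s then F t \<omega> else 0)"
      by (intro sum.cong) auto
    with \<open>s \<in> S\<close> finite_S show ?thesis by simp
  qed
  then show ?thesis
    using F_sum_in_gspace[of "\<lambda>t. of_bool (t = s)" q n] by presburger
qed

definition path_obs :: "(nat \<Rightarrow> 's) \<Rightarrow> nat \<Rightarrow> 'b \<Rightarrow> real" where
  "path_obs q i \<omega> = F (q i) \<omega> + eps i (q i) \<omega>"

lemma eps_in_gspace:
  assumes "i < n"
  shows "eps i (q i) \<in> gspace q n"
proof -
  have e: "eps i (q i) \<omega> = (\<Sum>j<n. of_bool (j = i) * eps j (q j) \<omega>)" for \<omega>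
  proof -
    have "(\<Sum>j<n. of_bool (j = i) * eps j (q j) \<omega>) = (\<Sum>j<n. if j = i then eps j (q j) \<omega> else 0)"
      by (intro sum.cong) auto
    with assms show ?thesis by simp
  qed
  show ?thesis
    by (rule gspaceI[where a = 0 and c = "\<lambda>_. 0" and d = "\<lambda>j. of_bool (j = i)"])
      (rule ext, rule trans[OF e], simp)
qed

lemma path_obs_in_gspace:
  assumes q: "\<And>i. i < n \<Longrightarrow> q i \<in> S" and i: "i < n"
  shows "path_obs q i \<in> gspace q n"
proof -
  interpret gaussian_space M "gspace q n" by (rule gaussian_space_gspace) (use q in auto)
  show ?thesis unfolding path_obs_def[abs_def] using assms by (intro add_in F_in_gspace eps_in_gspace) auto
qed

text \<open>The space \<open>gspace q n\<close> uses noise with index below \<open>n\<close>, so the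
  noise with index \<open>n\<close> is centred and independent of it. Hence observing
  \<open>F s\<close> with noise leaves its covariance with earlier variables unchanged.\<close>

lemma eps_orth:
  assumes q: "\<And>i. i < n \<Longrightarrow> q i \<in> S" and X: "X \<in> gspace q n" and s: "s \<in> S"
  shows "expectation (\<lambda>\<omega>. X \<omega> * eps n s \<omega>) = 0" "integrable M (\<lambda>\<omega>. X \<omega> * eps n s \<omega>)"
proof -
  interpret gaussian_space M "gspace q n" by (rule gaussian_space_gspace) (use q in auto)
  obtain a c d where Xe: "X = (\<lambda>\<omega>. a + (\<Sum>s\<in>S. c s * F s \<omega>) + (\<Sum>i<n. d i * eps i (q i) \<omega>))"
    using X unfolding gspace_def by blast
  define I where "I = insert None (Some ` {..<n})"
  let ?P = "\<lambda>J. \<Pi>\<^sub>M i\<in>J. \<Pi>\<^sub>M s\<in>S. (borel :: real measure)"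
  have ind: "indep_var (?P I) (\<lambda>\<omega>. restrict (\<lambda>i. block i \<omega>) I) (?P {Some n}) (\<lambda>\<omega>. restrict (\<lambda>i. block i \<omega>) {Some n})"
    by (rule indep_var_restrict[OF indep_block]) (auto simp: I_def)
  have comp: "(\<lambda>f. f i t) \<in> borel_measurable (?P J)" if "i \<in> J" "t \<in> S" for i t J
    using that by (intro measurable_compose[OF measurable_component_singleton[of i] measurable_component_singleton[of t]])
  have 1: "(\<lambda>f. a + (\<Sum>s\<in>S. c s * f None s) + (\<Sum>i<n. d i * f (Some i) (q i))) \<in> borel_measurable (?P I)"
    using q by (intro borel_measurable_add borel_measurable_sum borel_measurable_times
        borel_measurable_const comp) (auto simp: I_def)
  have 2: "(\<lambda>f. f (Some n) s) \<in> borel_measurable (?P {Some n})"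
    using s by (intro comp) auto
  have X': "(\<lambda>f. a + (\<Sum>s\<in>S. c s * f None s) + (\<Sum>i<n. d i * f (Some i) (q i))) \<circ> (\<lambda>\<omega>. restrict (\<lambda>i. block i \<omega>) I) = X"
    unfolding Xe using q by (auto simp: block_def I_def fun_eq_iff intro!: sum.cong)
  have e': "(\<lambda>f. f (Some n) s) \<circ> (\<lambda>\<omega>. restrict (\<lambda>i. block i \<omega>) {Some n}) = eps n s"
    using s by (auto simp: block_def)
  have iv: "indep_var borel X borel (eps n s)"
    using indep_var_compose[OF ind 1 2] unfolding X' e' .
  have ie: "integrable M (eps n s)" "expectation (eps n s) = 0"
    using normal_law_moments(1,3)[OF eps_meas lam_nonneg eps_distr] s by auto
  show "expectation (\<lambda>\<omega>. X \<omega> * eps n s \<omega>) = 0"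
    using indep_var_lebesgue_integral[OF iv integrable_in[OF X] ie(1)] ie(2) by simp
  show "integrable M (\<lambda>\<omega>. X \<omega> * eps n s \<omega>)"
    using indep_var_integrable[OF iv integrable_in[OF X] ie(1)] .
qed

lemma path_obs_sq:
  assumes q: "\<And>i. i < n \<Longrightarrow> q i \<in> S" and s: "s \<in> S" "q n = s"
  shows "expectation (\<lambda>\<omega>. (path_obs q n \<omega>)\<^sup>2) = expectation (\<lambda>\<omega>. (F s \<omega>)\<^sup>2) + lam s"
proof -
  interpret gaussian_space M "gspace q n" by (rule gaussian_space_gspace) (use q in auto)
  have F: "F s \<in> gspace q n" by (rule F_in_gspace) fact
  have e: "integrable M (\<lambda>\<omega>. (eps n s \<omega>)\<^sup>2)" "expectation (\<lambda>\<omega>. (eps n s \<omega>)\<^sup>2) = lam s"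
    using normal_law_moments(2,4)[OF eps_meas lam_nonneg eps_distr] s by auto
  have "expectation (\<lambda>\<omega>. (path_obs q n \<omega>)\<^sup>2) = expectation (\<lambda>\<omega>. (F s \<omega>)\<^sup>2 + 2 * (F s \<omega> * eps n s \<omega>) + (eps n s \<omega>)\<^sup>2)"
    unfolding path_obs_def s(2) by (intro Bochner_Integration.integral_cong refl) (simp add: power2_eq_square algebra_simps)
  also have "\<dots> = expectation (\<lambda>\<omega>. (F s \<omega>)\<^sup>2) + lam s"
    using integrable_sq[OF F] eps_orth[OF q F s(1)] e by simp
  finally show ?thesis .
qed

section \<open>One-step changes of the posterior mean under a forced next point\<close>

definition increment :: "(nat \<Rightarrow> 's) \<Rightarrow> nat \<Rightarrow> 's \<Rightarrow> ('b \<Rightarrow> real) \<Rightarrow> 'b \<Rightarrow> real" where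
  "increment q n s D \<omega> = lin_proj M (path_obs (q(n := s))) (Suc n) D \<omega> - lin_proj M (path_obs q) n D \<omega>"

text \<open>A number rather than a random variable: posterior covariances in a Gaussian model depend
  on the points but not on the observed values. The standard deviation is used because it bounds
  covariances linearly.\<close>

definition increment_sd :: "(nat \<Rightarrow> 's) \<Rightarrow> nat \<Rightarrow> 's \<Rightarrow> ('b \<Rightarrow> real) \<Rightarrow> real" where
  "increment_sd q n s D = sqrt (expectation (\<lambda>\<omega>. (increment q n s D \<omega>)\<^sup>2))"

lemma lin_proj_path_obs_cong:
  assumes "\<And>i. i < n \<Longrightarrow> q i = q' i"
  shows "lin_proj M (path_obs q) n D = lin_proj M (path_obs q') n D"
  by (rule lin_proj_cong) (simp add: assms path_obs_def[abs_def])

lemma increment_eq: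
  "increment q n s D = (\<lambda>\<omega>. lin_proj M (path_obs (q(n := s))) (Suc n) D \<omega> - lin_proj M (path_obs (q(n := s))) n D \<omega>)"
proof -
  have "lin_proj M (path_obs q) n D = lin_proj M (path_obs (q(n := s))) n D" by (rule lin_proj_path_obs_cong) simp
  then show ?thesis unfolding increment_def[abs_def] by (simp only:)
qed

text \<open>The residual \<open>r\<close> is orthogonal to the projection, so its second moment
  equals that of \<open>r\<close> times \<open>D\<close> and is linear in the coefficients
  \<open>c s\<close>. Each covariance of \<open>r\<close> with \<open>F s\<close> equals that with a
  next observation at \<open>s\<close>, which the increment controls.\<close>

lemma resid_var_le:
  assumes q: "\<And>i. i < n \<Longrightarrow> q i \<in> S"
    and D_def: "D = (\<lambda>\<omega>. \<Sum>s\<in>S. c s * F s \<omega>)"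
  shows "expectation (\<lambda>\<omega>. (D \<omega> - lin_proj M (path_obs q) n D \<omega>)\<^sup>2)
    \<le> (\<Sum>s\<in>S. \<bar>c s\<bar> * sqrt (expectation (\<lambda>\<omega>. (F s \<omega>)\<^sup>2) + lam s) * increment_sd q n s D)"
proof -
  interpret gaussian_space M "gspace q n" by (rule gaussian_space_gspace) (use q in auto)
  have D: "D \<in> gspace q n" unfolding D_def by (rule F_sum_in_gspace)
  have y: "path_obs q i \<in> gspace q n" if "i < n" for i using q that by (intro path_obs_in_gspace) auto
  define r where "r \<omega> = D \<omega> - lin_proj M (path_obs q) n D \<omega>" for \<omega>
  have g: "lin_proj M (path_obs q) n D \<in> gspace q n" by (intro lin_proj_in y)
  have r: "r \<in> gspace q n" unfolding r_def by (intro diff_in D g)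
  have r0: "expectation r = 0" "\<And>i. i < n \<Longrightarrow> expectation (\<lambda>\<omega>. r \<omega> * path_obs q i \<omega>) = 0"
    using lin_proj_residual[where y = "path_obs q" and n = n, OF y D] unfolding r_def by auto
  have rF: "\<bar>expectation (\<lambda>\<omega>. r \<omega> * F s \<omega>)\<bar> \<le> sqrt (expectation (\<lambda>\<omega>. (F s \<omega>)\<^sup>2) + lam s) * increment_sd q n s D"
    if s: "s \<in> S" for s
  proof -
    let ?q = "q(n := s)"
    have q': "?q i \<in> S" if "i < Suc n" for i using that q s by auto
    interpret Q: gaussian_space M "gspace ?q (Suc n)" by (rule gaussian_space_gspace) (use q' in auto)
    have y': "path_obs ?q i \<in> gspace ?q (Suc n)" if "i < Suc n" for i using q' that by (rule path_obs_in_gspace)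
    have "expectation (\<lambda>\<omega>. r \<omega> * F s \<omega>) = expectation (\<lambda>\<omega>. r \<omega> * path_obs ?q n \<omega>)"
    proof -
      have "expectation (\<lambda>\<omega>. r \<omega> * path_obs ?q n \<omega>) = expectation (\<lambda>\<omega>. r \<omega> * F s \<omega> + r \<omega> * eps n s \<omega>)"
        unfolding path_obs_def by (simp add: algebra_simps)
      also have "\<dots> = expectation (\<lambda>\<omega>. r \<omega> * F s \<omega>)"
        using integrable_prod[OF r F_in_gspace[OF s]] eps_orth[OF q r s] by simp
      finally show ?thesis ..
    qed
    also have "\<dots> = expectation (\<lambda>\<omega>. (D \<omega> - lin_proj M (path_obs ?q) n D \<omega>) * path_obs ?q n \<omega>)"
      unfolding r_def using lin_proj_path_obs_cong[of n q ?q D] by simp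
    finally have "(expectation (\<lambda>\<omega>. r \<omega> * F s \<omega>))\<^sup>2 \<le>
      expectation (\<lambda>\<omega>. (increment q n s D \<omega>)\<^sup>2) * expectation (\<lambda>\<omega>. (path_obs ?q n \<omega>)\<^sup>2)"
      unfolding increment_eq
      using Q.lin_proj_increment(4)[where y = "path_obs ?q" and n = n and D = D, OF y'] F_sum_in_gspace[of c ?q "Suc n"]
      by (simp add: D_def del: lin_proj.simps)
    also have "expectation (\<lambda>\<omega>. (path_obs ?q n \<omega>)\<^sup>2) = expectation (\<lambda>\<omega>. (F s \<omega>)\<^sup>2) + lam s"
      using q s by (intro path_obs_sq) auto
    finally show ?thesis
      unfolding increment_sd_def real_sqrt_mult[symmetric]
      by (intro real_le_rsqrt) (simp add: mult.commute)
  qed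
  have "expectation (\<lambda>\<omega>. (r \<omega>)\<^sup>2) = expectation (\<lambda>\<omega>. r \<omega> * D \<omega> - r \<omega> * lin_proj M (path_obs q) n D \<omega>)"
    by (intro Bochner_Integration.integral_cong refl) (simp add: r_def power2_eq_square algebra_simps)
  also have "\<dots> = expectation (\<lambda>\<omega>. r \<omega> * D \<omega>)"
    using integrable_prod[OF r D] integrable_prod[OF r g] orth_lin_proj[where y = "path_obs q" and n = n and D = D, OF y r r0] by simp
  also have "\<dots> = expectation (\<lambda>\<omega>. \<Sum>s\<in>S. c s * (r \<omega> * F s \<omega>))"
    unfolding D_def by (simp add: sum_distrib_left algebra_simps)
  also have "\<dots> = (\<Sum>s\<in>S. c s * expectation (\<lambda>\<omega>. r \<omega> * F s \<omega>))"
    using integrable_prod[OF r F_in_gspace] by (subst Bochner_Integration.integral_sum) auto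
  also have "\<dots> \<le> (\<Sum>s\<in>S. \<bar>c s\<bar> * (sqrt (expectation (\<lambda>\<omega>. (F s \<omega>)\<^sup>2) + lam s) * increment_sd q n s D))"
  proof (rule sum_mono)
    fix s assume "s \<in> S"
    have "c s * expectation (\<lambda>\<omega>. r \<omega> * F s \<omega>) \<le> \<bar>c s\<bar> * \<bar>expectation (\<lambda>\<omega>. r \<omega> * F s \<omega>)\<bar>"
      by (metis abs_ge_self abs_mult)
    also have "\<dots> \<le> \<bar>c s\<bar> * (sqrt (expectation (\<lambda>\<omega>. (F s \<omega>)\<^sup>2) + lam s) * increment_sd q n s D)"
      by (intro mult_left_mono rF) (use \<open>s \<in> S\<close> in auto)
    finally show "c s * expectation (\<lambda>\<omega>. r \<omega> * F s \<omega>)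
      \<le> \<bar>c s\<bar> * (sqrt (expectation (\<lambda>\<omega>. (F s \<omega>)\<^sup>2) + lam s) * increment_sd q n s D)" .
  qed
  finally show ?thesis unfolding r_def by (simp add: mult.assoc)
qed

end

subsection \<open>Conditioning on an adaptive history\<close>

lemma vimages_subset_sets:
  assumes "f \<in> N \<rightarrow>\<^sub>M P" "space N = \<Omega>"
  shows "{f -` C \<inter> \<Omega> | C. C \<in> sets P} \<subseteq> sets N"
  using measurable_sets[OF assms(1)] assms(2) by auto

lemma integrable_indicator_mult:
  fixes f :: "'a \<Rightarrow> real"
  shows "A \<in> sets M \<Longrightarrow> integrable M f \<Longrightarrow> integrable M (\<lambda>x. indicator A x * f x)"
  using integrable_mult_indicator[of A M f] by simp

context gp_sampling begin

abbreviation hist :: "(nat \<Rightarrow> 'b \<Rightarrow> 's) \<Rightarrow> nat \<Rightarrow> 'b measure" where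
  "hist \<equiv> history M S F eps"

text \<open>The bound \<open>n\<close> is there for forced points: replacing the point of step
  \<open>n\<close> also alters the later histories, so the modified process is known to be adapted
  only through that step.\<close>

definition adapted :: "(nat \<Rightarrow> 'b \<Rightarrow> 's) \<Rightarrow> nat \<Rightarrow> bool" where
  "adapted pt n \<longleftrightarrow> (\<forall>i<n. pt i \<in> hist pt i \<rightarrow>\<^sub>M count_space S)"

lemma adapted_mono: "adapted pt n \<Longrightarrow> k \<le> n \<Longrightarrow> adapted pt k"
  unfolding adapted_def by simp

lemma space_hist [simp]: "space (hist pt n) = space M"
  by (simp add: history_def)

lemma adapted_point: "adapted pt n \<Longrightarrow> i < n \<Longrightarrow> \<omega> \<in> space M \<Longrightarrow> pt i \<omega> \<in> S"
  unfolding adapted_def using measurable_space[of "pt i" "hist pt i" "count_space S" \<omega>] by simp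

lemma hist_cong:
  assumes "\<And>i. i < n \<Longrightarrow> pt i = pt' i"
  shows "hist pt n = hist pt' n"
proof -
  have "(\<lambda>\<omega>. \<lambda>i\<in>{..<n}. (pt i \<omega>, observation F eps pt i \<omega>)) = (\<lambda>\<omega>. \<lambda>i\<in>{..<n}. (pt' i \<omega>, observation F eps pt' i \<omega>))"
    using assms by (auto simp: observation_def fun_eq_iff)
  then show ?thesis unfolding history_def by simp
qed

lemma adapted_cong: "(\<And>i. i < n \<Longrightarrow> pt i = pt' i) \<Longrightarrow> adapted pt n \<longleftrightarrow> adapted pt' n"
proof -
  assume e: "\<And>i. i < n \<Longrightarrow> pt i = pt' i"
  have "hist pt i = hist pt' i" if "i < n" for i
    by (rule hist_cong) (use that e in auto)
  then show ?thesis unfolding adapted_def using e by simp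
qed

lemma adapted_Suc_const: "adapted pt n \<Longrightarrow> s \<in> S \<Longrightarrow> adapted (pt(n := \<lambda>_. s)) (Suc n)"
proof -
  assume a: "adapted pt n" "s \<in> S"
  have "adapted (pt(n := \<lambda>_. s)) n"
    using a(1) by (subst adapted_cong[of n _ pt]) auto
  then show ?thesis using a(2) unfolding adapted_def by (auto simp: less_Suc_eq)
qed

abbreviation hist_space :: "nat \<Rightarrow> (nat \<Rightarrow> 's \<times> real) measure" where
  "hist_space n \<equiv> \<Pi>\<^sub>M i\<in>{..<n}. count_space S \<Otimes>\<^sub>M borel"

definition hist_map :: "(nat \<Rightarrow> 'b \<Rightarrow> 's) \<Rightarrow> nat \<Rightarrow> 'b \<Rightarrow> nat \<Rightarrow> 's \<times> real" where
  "hist_map pt n \<omega> = (\<lambda>i\<in>{..<n}. (pt i \<omega>, observation F eps pt i \<omega>))"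

lemma hist_map_space: "adapted pt n \<Longrightarrow> hist_map pt n \<in> space M \<rightarrow> space (hist_space n)"
  by (auto simp: hist_map_def space_PiM space_pair_measure adapted_point)

lemma hist_eq_vimage: "hist pt n = vimage_algebra (space M) (hist_map pt n) (hist_space n)"
  by (simp only: history_def hist_map_def[abs_def])

lemma sets_hist:
  "adapted pt n \<Longrightarrow> sets (hist pt n) = {hist_map pt n -` C \<inter> space M | C. C \<in> sets (hist_space n)}"
  unfolding hist_eq_vimage by (rule sets_vimage_algebra2[OF hist_map_space])

lemma hist_map_measurable_hist: "adapted pt n \<Longrightarrow> hist_map pt n \<in> hist pt n \<rightarrow>\<^sub>M hist_space n"
  unfolding hist_eq_vimage by (rule measurable_vimage_algebra1[OF hist_map_space])

lemma observation_measurable: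
  assumes "pt i \<in> M \<rightarrow>\<^sub>M count_space S"
  shows "observation F eps pt i \<in> borel_measurable M"
proof -
  have "(\<lambda>\<omega>. (\<lambda>s \<omega>. F s \<omega> + eps i s \<omega>) (pt i \<omega>) \<omega>) \<in> borel_measurable M"
    by (rule measurable_compose_countable'[OF _ assms])
      (auto intro!: borel_measurable_add F_meas eps_meas countable_finite finite_S)
  then show ?thesis unfolding observation_def[abs_def] by simp
qed

text \<open>Strong induction is forced by the mutual dependence: the history is measurable if the
  earlier points are, and each of these is measurable with respect to its own earlier
  history.\<close>

lemma hist_subalgebra: "adapted pt n \<Longrightarrow> subalgebra M (hist pt n)"
proof (induction n rule: less_induct)
  case (less n)
  have pt: "pt i \<in> M \<rightarrow>\<^sub>M count_space S" if "i < n" for i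
  proof -
    have "subalgebra M (hist pt i)"
      using that by (intro less.IH adapted_mono[OF less.prems]) auto
    moreover have "pt i \<in> hist pt i \<rightarrow>\<^sub>M count_space S" using less.prems that by (simp add: adapted_def)
    ultimately show ?thesis by (rule measurable_from_subalg)
  qed
  have "hist_map pt n \<in> M \<rightarrow>\<^sub>M hist_space n"
    unfolding hist_map_def[abs_def]
    by (intro measurable_restrict measurable_Pair pt observation_measurable) auto
  then have "sets (hist pt n) \<subseteq> sets M"
    unfolding sets_hist[OF less.prems] by (rule vimages_subset_sets) simp
  then show ?case by (simp add: subalgebra_def)
qed

lemma pt_hist: "adapted pt n \<Longrightarrow> i < n \<Longrightarrow> pt i \<in> hist pt n \<rightarrow>\<^sub>M count_space S"
  and observation_hist: "adapted pt n \<Longrightarrow> i < n \<Longrightarrow> observation F eps pt i \<in> borel_measurable (hist pt n)"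
proof -
  assume a: "adapted pt n" "i < n"
  have c: "(\<lambda>\<omega>. hist_map pt n \<omega> i) \<in> hist pt n \<rightarrow>\<^sub>M count_space S \<Otimes>\<^sub>M borel"
    using measurable_compose[OF hist_map_measurable_hist[OF a(1)] measurable_component_singleton[of i]] a(2) by simp
  have "(\<lambda>\<omega>. fst (hist_map pt n \<omega> i)) \<in> hist pt n \<rightarrow>\<^sub>M count_space S"
    "(\<lambda>\<omega>. snd (hist_map pt n \<omega> i)) \<in> borel_measurable (hist pt n)"
    using measurable_compose[OF c measurable_fst] measurable_compose[OF c measurable_snd] by auto
  then show "pt i \<in> hist pt n \<rightarrow>\<^sub>M count_space S" "observation F eps pt i \<in> borel_measurable (hist pt n)"
    using a(2) by (simp_all add: hist_map_def)
qed

lemma hist_mono: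
  assumes a: "adapted pt n" and k: "k \<le> n"
  shows "subalgebra (hist pt n) (hist pt k)"
proof -
  have "hist_map pt k \<in> hist pt n \<rightarrow>\<^sub>M hist_space k"
    unfolding hist_map_def[abs_def]
    by (intro measurable_restrict measurable_Pair pt_hist[OF a] observation_hist[OF a]) (use k in auto)
  then have "sets (hist pt k) \<subseteq> sets (hist pt n)"
    unfolding sets_hist[OF adapted_mono[OF a k]] by (rule vimages_subset_sets) simp
  then show ?thesis by (simp add: subalgebra_def)
qed

section \<open>Partition of the sample space by the points visited\<close>

definition on_path :: "(nat \<Rightarrow> 'b \<Rightarrow> 's) \<Rightarrow> (nat \<Rightarrow> 's) \<Rightarrow> nat \<Rightarrow> 'b set" where
  "on_path pt q n = {\<omega> \<in> space M. \<forall>i<n. pt i \<omega> = q i}"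

text \<open>Extensional functions, so that every outcome lies on exactly one path.\<close>

abbreviation paths :: "nat \<Rightarrow> (nat \<Rightarrow> 's) set" where
  "paths n \<equiv> \<Pi>\<^sub>E i\<in>{..<n}. S"

lemma finite_paths: "finite (paths n)"
  by (intro finite_PiE) (auto simp: finite_S)

lemma point_eq_hist:
  assumes "adapted pt n" "i < n"
  shows "{\<omega> \<in> space M. pt i \<omega> = s} \<in> sets (hist pt n)"
proof (cases "s \<in> S")
  case True
  have "{\<omega> \<in> space M. pt i \<omega> = s} = pt i -` {s} \<inter> space (hist pt n)" by auto
  also have "\<dots> \<in> sets (hist pt n)"
    by (rule measurable_sets[OF pt_hist[OF assms]]) (use True in simp)
  finally show ?thesis .
next
  case False
  then have e: "{\<omega> \<in> space M. pt i \<omega> = s} = {}" using adapted_point[OF assms] by auto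
  show ?thesis unfolding e by (rule sets.empty_sets)
qed

lemma on_path_hist:
  assumes a: "adapted pt n"
  shows "on_path pt q n \<in> sets (hist pt n)"
proof -
  have "on_path pt q n = {\<omega> \<in> space (hist pt n). \<forall>i\<in>{..<n}. pt i \<omega> = q i}"
    by (auto simp: on_path_def)
  also have "\<dots> \<in> sets (hist pt n)"
    by (intro sets.sets_Collect_finite_All) (use point_eq_hist[OF a] in auto)
  finally show ?thesis .
qed

lemma on_path_events: "adapted pt n \<Longrightarrow> on_path pt q n \<in> events"
  using on_path_hist hist_subalgebra unfolding subalgebra_def by blast

lemma sum_on_path:
  assumes a: "adapted pt n" and \<omega>: "\<omega> \<in> space M"
  shows "(\<Sum>q\<in>paths n. indicator (on_path pt q n) \<omega> * h q) = (h (\<lambda>i\<in>{..<n}. pt i \<omega>) :: real)"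
proof -
  let ?q = "\<lambda>i\<in>{..<n}. pt i \<omega>"
  have q: "?q \<in> paths n" by (auto simp: PiE_iff adapted_point[OF a _ \<omega>])
  have "indicator (on_path pt q n) \<omega> * h q = (if q = ?q then h q else 0)" if "q \<in> paths n" for q
  proof -
    have "\<omega> \<in> on_path pt q n \<longleftrightarrow> q = ?q"
      using that \<omega> by (auto simp: on_path_def fun_eq_iff PiE_iff extensional_def)
    then show ?thesis by (simp add: indicator_def)
  qed
  then have "(\<Sum>q\<in>paths n. indicator (on_path pt q n) \<omega> * h q) = (\<Sum>q\<in>paths n. if q = ?q then h q else 0)"
    by (intro sum.cong) auto
  also have "\<dots> = h ?q" using q finite_paths by simp
  finally show ?thesis .
qed

lemma integral_split_on_path:
  fixes f :: "'b \<Rightarrow> real"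
  assumes a: "adapted pt n" and f: "integrable M f"
  shows "(\<Sum>q\<in>paths n. expectation (\<lambda>\<omega>. indicator (on_path pt q n) \<omega> * f \<omega>)) = expectation f"
proof -
  have "(\<Sum>q\<in>paths n. expectation (\<lambda>\<omega>. indicator (on_path pt q n) \<omega> * f \<omega>)) =
    expectation (\<lambda>\<omega>. \<Sum>q\<in>paths n. indicator (on_path pt q n) \<omega> * f \<omega>)"
    by (rule Bochner_Integration.integral_sum[symmetric]) (intro integrable_indicator_mult on_path_events[OF a] f)
  also have "\<dots> = expectation f"
    by (intro Bochner_Integration.integral_cong refl) (rule sum_on_path[OF a, where h = "\<lambda>_. f _"])
  finally show ?thesis .
qed

definition path_algebra :: "(nat \<Rightarrow> 's) \<Rightarrow> nat \<Rightarrow> 'b measure" where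
  "path_algebra q n = vimage_algebra (space M) (\<lambda>\<omega>. \<lambda>j\<in>{..<n}. path_obs q j \<omega>) (\<Pi>\<^sub>M j\<in>{..<n}. borel)"

lemma space_path_algebra [simp]: "space (path_algebra q n) = space M"
  by (simp add: path_algebra_def)

lemma path_obs_path_algebra:
  assumes "j < n"
  shows "path_obs q j \<in> borel_measurable (path_algebra q n)"
proof -
  have "(\<lambda>\<omega>. \<lambda>j\<in>{..<n}. path_obs q j \<omega>) \<in> path_algebra q n \<rightarrow>\<^sub>M (\<Pi>\<^sub>M j\<in>{..<n}. borel)"
    unfolding path_algebra_def by (rule measurable_vimage_algebra1) (auto simp: space_PiM)
  from measurable_compose[OF this measurable_component_singleton[of j]] assms show ?thesis by simp
qed

lemma path_algebra_Suc: "sets (path_algebra q n) \<subseteq> sets (path_algebra q (Suc n))"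
proof -
  have e: "sets (path_algebra q n) = {(\<lambda>\<omega>. \<lambda>j\<in>{..<n}. path_obs q j \<omega>) -` C \<inter> space M | C. C \<in> sets (\<Pi>\<^sub>M j\<in>{..<n}. borel)}"
    unfolding path_algebra_def by (rule sets_vimage_algebra2) (auto simp: space_PiM)
  have "(\<lambda>\<omega>. \<lambda>j\<in>{..<n}. path_obs q j \<omega>) \<in> path_algebra q (Suc n) \<rightarrow>\<^sub>M (\<Pi>\<^sub>M j\<in>{..<n}. borel)"
    by (intro measurable_restrict path_obs_path_algebra) auto
  then show ?thesis unfolding e by (rule vimages_subset_sets) simp
qed

text \<open>On the path event the history map agrees with the map built from \<open>q\<close>, so
  preimages agree after intersection. That the path event itself is determined by the observations
  along \<open>q\<close> is assumed here and supplied by the induction that follows.\<close>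

lemma hist_Int_on_path_step:
  assumes a: "adapted pt n" and q: "\<And>i. i < n \<Longrightarrow> q i \<in> S" and e: "on_path pt q n \<in> sets (path_algebra q n)"
    and B: "B \<in> sets (hist pt n)"
  shows "B \<inter> on_path pt q n \<in> sets (path_algebra q n)"
proof -
  obtain C where C: "C \<in> sets (hist_space n)" "B = hist_map pt n -` C \<inter> space M"
    using B unfolding sets_hist[OF a] by blast
  let ?h = "\<lambda>\<omega>. \<lambda>i\<in>{..<n}. (q i, path_obs q i \<omega>)"
  have "?h \<in> path_algebra q n \<rightarrow>\<^sub>M hist_space n"
    by (intro measurable_restrict measurable_Pair path_obs_path_algebra) (use q in auto)
  then have "?h -` C \<inter> space M \<in> sets (path_algebra q n)" 
    using measurable_sets[OF _ C(1), of ?h "path_algebra q n"] by simp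
  moreover have "hist_map pt n \<omega> = ?h \<omega>" if "\<omega> \<in> on_path pt q n" for \<omega>
    using that by (auto simp: on_path_def hist_map_def path_obs_def observation_def fun_eq_iff)
  then have "B \<inter> on_path pt q n = (?h -` C \<inter> space M) \<inter> on_path pt q n" unfolding C(2) by auto
  ultimately show ?thesis using e by auto
qed

text \<open>On \<open>on_path pt q n\<close> the history coincides with the sigma-algebra of the observations at the
  deterministic points \<open>q\<close>, although the sampling is adaptive.\<close>

lemma hist_Int_on_path_path_algebra:
  assumes a: "adapted pt n" and q: "\<And>i. i < n \<Longrightarrow> q i \<in> S" and B: "B \<in> sets (hist pt n)"
  shows "B \<inter> on_path pt q n \<in> sets (path_algebra q n)"
  using assms
proof (induction n arbitrary: B)
  case 0
  have "on_path pt q 0 = space (path_algebra q 0)" by (simp add: on_path_def)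
  then show ?case using 0 by (intro hist_Int_on_path_step) (auto simp del: space_path_algebra)
next
  case (Suc n)
  have a: "adapted pt n" using Suc.prems(1) by (rule adapted_mono) simp
  have "pt n \<in> hist pt n \<rightarrow>\<^sub>M count_space S" using Suc.prems(1) unfolding adapted_def by simp
  then have "pt n -` {q n} \<inter> space (hist pt n) \<in> sets (hist pt n)"
    using Suc.prems(2)[of n] by (intro measurable_sets) auto
  then have "(pt n -` {q n} \<inter> space M) \<inter> on_path pt q n \<in> sets (path_algebra q n)"
    using Suc.prems(2) by (intro Suc.IH a) auto
  also have "(pt n -` {q n} \<inter> space M) \<inter> on_path pt q n = on_path pt q (Suc n)"
    by (auto simp: on_path_def less_Suc_eq)
  finally have "on_path pt q (Suc n) \<in> sets (path_algebra q (Suc n))" using path_algebra_Suc by blast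
  then show ?case using Suc.prems by (intro hist_Int_on_path_step) auto
qed

text \<open>The left side first selects the path through \<omega> and then evaluates its projection
  at \<omega>, so the coefficients are random. The finite sum over paths makes integrability and
  measurability accessible.\<close>

lemma lin_proj_pt:
  assumes a: "adapted pt n" and \<omega>: "\<omega> \<in> space M"
  shows "lin_proj M (path_obs (\<lambda>i. pt i \<omega>)) n D \<omega> = (\<Sum>q\<in>paths n. indicator (on_path pt q n) \<omega> * lin_proj M (path_obs q) n D \<omega>)"
  unfolding sum_on_path[OF a \<omega>] by (rule fun_cong[OF lin_proj_path_obs_cong]) simp

lemma lin_proj_on_path: "\<omega> \<in> on_path pt q n \<Longrightarrow> lin_proj M (path_obs (\<lambda>i. pt i \<omega>)) n D = lin_proj M (path_obs q) n D"
  by (rule lin_proj_path_obs_cong) (auto simp: on_path_def)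

lemma lin_proj_pt_hist:
  assumes a: "adapted pt n"
  shows "(\<lambda>\<omega>. lin_proj M (path_obs (\<lambda>i. pt i \<omega>)) n D \<omega>) \<in> borel_measurable (hist pt n)"
proof -
  have m: "(\<lambda>\<omega>. indicator (on_path pt q n) \<omega> * lin_proj M (path_obs q) n D \<omega>) \<in> borel_measurable (hist pt n)" for q
  proof -
    obtain \<alpha> \<beta> where p: "lin_proj M (path_obs q) n D = (\<lambda>\<omega>. \<alpha> + (\<Sum>i<n. \<beta> i * path_obs q i \<omega>))" using lin_proj_span by blast
    have "indicator (on_path pt q n) \<omega> * lin_proj M (path_obs q) n D \<omega> =
      indicator (on_path pt q n) \<omega> * (\<alpha> + (\<Sum>i<n. \<beta> i * observation F eps pt i \<omega>))" for \<omega>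
    proof (cases "\<omega> \<in> on_path pt q n")
      case True
      then have "(\<Sum>i<n. \<beta> i * path_obs q i \<omega>) = (\<Sum>i<n. \<beta> i * observation F eps pt i \<omega>)"
        by (intro sum.cong) (auto simp: on_path_def observation_def path_obs_def)
      then show ?thesis unfolding p by simp
    qed simp
    moreover have "(\<lambda>\<omega>. indicator (on_path pt q n) \<omega> * (\<alpha> + (\<Sum>i<n. \<beta> i * observation F eps pt i \<omega>))) \<in> borel_measurable (hist pt n)"
      by (intro borel_measurable_times borel_measurable_indicator on_path_hist[OF a] borel_measurable_add
          borel_measurable_const borel_measurable_sum observation_hist[OF a]) auto
    ultimately show ?thesis by (simp only:)
  qed
  have "(\<lambda>\<omega>. \<Sum>q\<in>paths n. indicator (on_path pt q n) \<omega> * lin_proj M (path_obs q) n D \<omega>) \<in> borel_measurable (hist pt n)"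
    by (intro borel_measurable_sum m)
  then show ?thesis
    by (subst measurable_cong[of "hist pt n"]) (auto simp: lin_proj_pt[OF a])
qed

text \<open>Two paths occur because \<open>R\<close> may involve a hypothetical further observation:
  \<open>q'\<close> continues \<open>q\<close> up to step \<open>m\<close>, while the event
  \<open>B\<close> still belongs to the history of the first \<open>n\<close> steps.\<close>

lemma indep_on_path:
  assumes a: "adapted pt n" and q: "\<And>i. i < n \<Longrightarrow> q i \<in> S" and B: "B \<in> sets (hist pt n)"
    and q': "\<And>i. i < n \<Longrightarrow> q' i = q i" "\<And>i. i < m \<Longrightarrow> q' i \<in> S" and m: "n \<le> m"
    and R: "R \<in> gspace q' m" "expectation R = 0" "\<And>j. j < n \<Longrightarrow> expectation (\<lambda>\<omega>. R \<omega> * path_obs q j \<omega>) = 0"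
  shows "indep_var borel (indicator (B \<inter> on_path pt q n) :: 'b \<Rightarrow> real) borel R"
proof -
  interpret gaussian_space M "gspace q' m" by (rule gaussian_space_gspace) (use q' in auto)
  show ?thesis
  proof (rule indep_residual[where y = "path_obs q" and n = n])
    show "B \<inter> on_path pt q n \<in> sets (vimage_algebra (space M) (\<lambda>\<omega>. \<lambda>j\<in>{..<n}. path_obs q j \<omega>) (\<Pi>\<^sub>M j\<in>{..<n}. borel))"
      using hist_Int_on_path_path_algebra[OF a q B] unfolding path_algebra_def by simp
    fix j assume "j < n"
    then have "path_obs q j = path_obs q' j" using q' by (simp add: path_obs_def[abs_def])
    then show "path_obs q j \<in> gspace q' m" using path_obs_in_gspace[of m q' j] q' m \<open>j < n\<close> by simp
  qed (use R in auto)
qed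

lemma residual_in:
  assumes q: "\<And>i. i < n \<Longrightarrow> q i \<in> S" and D: "D = (\<lambda>\<omega>. \<Sum>s\<in>S. c s * F s \<omega>)"
  shows "lin_proj M (path_obs q) n D \<in> gspace q n" "(\<lambda>\<omega>. D \<omega> - lin_proj M (path_obs q) n D \<omega>) \<in> gspace q n"
    "expectation (\<lambda>\<omega>. D \<omega> - lin_proj M (path_obs q) n D \<omega>) = 0"
    "\<And>j. j < n \<Longrightarrow> expectation (\<lambda>\<omega>. (D \<omega> - lin_proj M (path_obs q) n D \<omega>) * path_obs q j \<omega>) = 0"
proof -
  interpret gaussian_space M "gspace q n" by (rule gaussian_space_gspace) (use q in auto)
  have y: "path_obs q i \<in> gspace q n" if "i < n" for i using q that by (rule path_obs_in_gspace)
  have D': "D \<in> gspace q n" unfolding D by (rule F_sum_in_gspace)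
  show g: "lin_proj M (path_obs q) n D \<in> gspace q n" by (intro lin_proj_in y)
  show "(\<lambda>\<omega>. D \<omega> - lin_proj M (path_obs q) n D \<omega>) \<in> gspace q n" by (intro diff_in D' g)
  show "expectation (\<lambda>\<omega>. D \<omega> - lin_proj M (path_obs q) n D \<omega>) = 0"
    "\<And>j. j < n \<Longrightarrow> expectation (\<lambda>\<omega>. (D \<omega> - lin_proj M (path_obs q) n D \<omega>) * path_obs q j \<omega>) = 0"
    using lin_proj_residual[where y = "path_obs q" and n = n, OF y D'] by auto
qed

lemma integrable_gspace:
  assumes q: "\<And>i. i < n \<Longrightarrow> q i \<in> S" and X: "X \<in> gspace q n"
  shows "integrable M X"
proof -
  interpret gaussian_space M "gspace q n" by (rule gaussian_space_gspace) (use q in auto)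
  show ?thesis by (rule integrable_in[OF X])
qed

lemma integrable_F_sum: "integrable M (\<lambda>\<omega>. \<Sum>s\<in>S. c s * F s \<omega>)"
  by (rule integrable_gspace[of 0, OF _ F_sum_in_gspace]) simp

lemma integrable_lin_proj_pt:
  assumes a: "adapted pt n" and D: "D = (\<lambda>\<omega>. \<Sum>s\<in>S. c s * F s \<omega>)"
  shows "integrable M (\<lambda>\<omega>. lin_proj M (path_obs (\<lambda>i. pt i \<omega>)) n D \<omega>)"
proof -
  have "integrable M (\<lambda>\<omega>. \<Sum>q\<in>paths n. indicator (on_path pt q n) \<omega> * lin_proj M (path_obs q) n D \<omega>)"
  proof (intro Bochner_Integration.integrable_sum)
    fix q assume "q \<in> paths n"
    then have q: "\<And>i. i < n \<Longrightarrow> q i \<in> S" by auto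
    show "integrable M (\<lambda>\<omega>. indicator (on_path pt q n) \<omega> * lin_proj M (path_obs q) n D \<omega>)"
      by (intro integrable_indicator_mult on_path_events[OF a] integrable_gspace[OF q residual_in(1)[OF q D]])
  qed
  then show ?thesis
    by (subst Bochner_Integration.integrable_cong[OF refl lin_proj_pt[OF a]])
qed

text \<open>It suffices to compare integrals over history events. Split along paths, each
  contribution to the difference is the integral of a centred residual over an event independent of
  it.\<close>

lemma cond_exp_hist:
  assumes a: "adapted pt n" and D: "D = (\<lambda>\<omega>. \<Sum>s\<in>S. c s * F s \<omega>)"
  shows "AE \<omega> in M. real_cond_exp M (hist pt n) D \<omega> = lin_proj M (path_obs (\<lambda>i. pt i \<omega>)) n D \<omega>"
proof -
  interpret finite_measure_subalgebra M "hist pt n"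
    by unfold_locales (rule hist_subalgebra[OF a])
  let ?g = "\<lambda>\<omega>. lin_proj M (path_obs (\<lambda>i. pt i \<omega>)) n D \<omega>"
  have iD: "integrable M D" unfolding D by (rule integrable_F_sum)
  have ig: "integrable M ?g" by (rule integrable_lin_proj_pt[OF a D])
  show ?thesis
  proof (rule real_cond_exp_charact)
    fix B assume B: "B \<in> sets (hist pt n)"
    then have BM: "B \<in> events" using subalg unfolding subalgebra_def by blast
    have i: "integrable M (\<lambda>\<omega>. indicator B \<omega> * (D \<omega> - ?g \<omega>))"
      by (intro integrable_indicator_mult BM Bochner_Integration.integrable_diff iD ig)
    have "expectation (\<lambda>\<omega>. indicator B \<omega> * (D \<omega> - ?g \<omega>)) =
      (\<Sum>q\<in>paths n. expectation (\<lambda>\<omega>. indicator (on_path pt q n) \<omega> * (indicator B \<omega> * (D \<omega> - ?g \<omega>))))"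
      by (rule integral_split_on_path[OF a i, symmetric])
    also have "\<dots> = 0"
    proof (rule sum.neutral, rule ballI)
      fix q assume "q \<in> paths n"
      then have q: "\<And>i. i < n \<Longrightarrow> q i \<in> S" by auto
      let ?r = "\<lambda>\<omega>. D \<omega> - lin_proj M (path_obs q) n D \<omega>"
      note r = residual_in[OF q D]
      have ind: "indep_var borel (indicator (B \<inter> on_path pt q n) :: 'b \<Rightarrow> real) borel ?r"
        using q by (intro indep_on_path[where q' = q and m = n] a B r(2,3,4)) auto
      have "expectation (\<lambda>\<omega>. indicator (on_path pt q n) \<omega> * (indicator B \<omega> * (D \<omega> - ?g \<omega>))) =
          expectation (\<lambda>\<omega>. indicator (B \<inter> on_path pt q n) \<omega> * ?r \<omega>)"
        by (intro Bochner_Integration.integral_cong refl) (auto simp: indicator_def lin_proj_on_path)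
      also have "\<dots> = expectation (indicator (B \<inter> on_path pt q n)) * expectation ?r"
        using BM on_path_events[OF a] integrable_gspace[OF q r(2)]
        by (intro indep_var_lebesgue_integral ind) (auto simp: integrable_indicator_iff emeasure_eq_measure)
      finally show "expectation (\<lambda>\<omega>. indicator (on_path pt q n) \<omega> * (indicator B \<omega> * (D \<omega> - ?g \<omega>))) = 0"
        using r(3) by simp
    qed
    finally have "expectation (\<lambda>\<omega>. indicator B \<omega> * D \<omega> - indicator B \<omega> * ?g \<omega>) = 0"
      by (simp add: right_diff_distrib)
    then show "(\<integral>\<omega>\<in>B. D \<omega> \<partial>M) = (\<integral>\<omega>\<in>B. ?g \<omega> \<partial>M)"
      using integrable_indicator_mult[OF BM iD] integrable_indicator_mult[OF BM ig]
      by (simp add: set_lebesgue_integral_def mult.commute)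
  qed (auto intro: iD ig lin_proj_pt_hist[OF a])
qed

end

subsection \<open>Maxima of conditional expectations\<close>

lemma integrable_Max:
  fixes Z :: "'i \<Rightarrow> 'a \<Rightarrow> real"
  assumes "finite A" "A \<noteq> {}" "\<And>x. x \<in> A \<Longrightarrow> integrable M (Z x)"
  shows "integrable M (\<lambda>\<omega>. MAX x\<in>A. Z x \<omega>)"
  using assms
proof (induction A rule: finite_ne_induct)
  case (insert x A)
  then have "(\<lambda>\<omega>. MAX x\<in>insert x A. Z x \<omega>) = (\<lambda>\<omega>. max (Z x \<omega>) (MAX x\<in>A. Z x \<omega>))"
    by (simp add: fun_eq_iff)
  with insert show ?case by simp
qed simp

lemma Max_minus_le_sum:
  fixes z :: "'i \<Rightarrow> real"
  assumes "finite A" "A \<noteq> {}"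
  shows "(MAX x\<in>A. z x) - c \<le> (\<Sum>x\<in>A. max 0 (z x - c))"
proof -
  have "(MAX x\<in>A. z x) \<in> z ` A" using assms by (intro Max_in) auto
  then obtain x where x: "(MAX x\<in>A. z x) = z x" "x \<in> A" by (elim imageE)
  have "z x - c \<le> max 0 (z x - c)" by simp
  also have "\<dots> \<le> (\<Sum>x\<in>A. max 0 (z x - c))"
    using assms x by (intro member_le_sum) auto
  finally show ?thesis unfolding x(1) .
qed

text \<open>Serves two purposes with the same \<open>a\<close>, the current posterior means:
  \<open>Z\<close> is either the objective itself or its posterior mean after one more observation
  at a forced point.\<close>

locale cond_exp_family = finite_measure_subalgebra M H for M H :: "'b measure" +
  fixes A :: "'i set" and Z a :: "'i \<Rightarrow> 'b \<Rightarrow> real"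
  assumes A: "finite A" "A \<noteq> {}"
    and Z: "\<And>x. x \<in> A \<Longrightarrow> integrable M (Z x)"
    and a_meas: "\<And>x. x \<in> A \<Longrightarrow> a x \<in> borel_measurable H"
    and a_int: "\<And>x. x \<in> A \<Longrightarrow> integrable M (a x)"
    and cond: "\<And>x. x \<in> A \<Longrightarrow> AE \<omega> in M. real_cond_exp M H (Z x) \<omega> = a x \<omega>"
begin

abbreviation mZ :: "'b \<Rightarrow> real" where "mZ \<omega> \<equiv> (MAX x\<in>A. Z x \<omega>)"
abbreviation ma :: "'b \<Rightarrow> real" where "ma \<omega> \<equiv> (MAX x\<in>A. a x \<omega>)"

text \<open>Ties are kept, so these sets may overlap; together they cover the space.\<close>

definition best :: "'i \<Rightarrow> 'b set" where "best x = {\<omega> \<in> space M. a x \<omega> = ma \<omega>}"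

lemma integrable_mZ: "integrable M mZ" and integrable_ma: "integrable M ma"
  using integrable_Max[OF A Z] integrable_Max[OF A a_int] by auto

lemma ma_meas: "ma \<in> borel_measurable H"
  by (rule borel_measurable_Max) (auto intro: A a_meas)

lemma best_sets: "x \<in> A \<Longrightarrow> best x \<in> sets H"
proof -
  assume [measurable]: "x \<in> A"
  note [measurable] = a_meas[OF \<open>x \<in> A\<close>] ma_meas
  have "best x = {\<omega> \<in> space H. a x \<omega> = ma \<omega>}" using subalg by (simp add: best_def subalgebra_def)
  also have "\<dots> \<in> sets H" by measurable
  finally show ?thesis .
qed

lemma sets_H: "B \<in> sets H \<Longrightarrow> B \<in> sets M"
  using subalg unfolding subalgebra_def by blast

text \<open>Conditional Jensen inequality for a finite maximum, from monotonicity in each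
  member.\<close>

lemma cond_mZ_ge: "AE \<omega> in M. ma \<omega> \<le> real_cond_exp M H mZ \<omega>"
proof -
  have "AE \<omega> in M. a x \<omega> \<le> real_cond_exp M H mZ \<omega>" if x: "x \<in> A" for x
  proof -
    have "AE \<omega> in M. real_cond_exp M H (Z x) \<omega> \<le> real_cond_exp M H mZ \<omega>"
      by (intro real_cond_exp_mono Z[OF x] integrable_mZ AE_I2) (use A x in auto)
    with cond[OF x] show ?thesis by eventually_elim simp
  qed
  then have "AE \<omega> in M. \<forall>x\<in>A. a x \<omega> \<le> real_cond_exp M H mZ \<omega>"
    using A by (intro AE_finite_allI) auto
  then show ?thesis by eventually_elim (use A in auto)
qed

lemma integral_cond_mZ:
  assumes B: "B \<in> sets H"
  shows "(\<integral>\<omega>. indicator B \<omega> * (real_cond_exp M H mZ \<omega> - ma \<omega>) \<partial>M) = (\<integral>\<omega>. indicator B \<omega> * (mZ \<omega> - ma \<omega>) \<partial>M)"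
proof -
  have "(\<integral>\<omega>. indicator B \<omega> * real_cond_exp M H mZ \<omega> \<partial>M) = (\<integral>\<omega>. indicator B \<omega> * mZ \<omega> \<partial>M)"
    using real_cond_exp_intA[OF integrable_mZ B] by (simp add: set_lebesgue_integral_def)
  then show ?thesis
    using integrable_indicator_mult[OF sets_H[OF B]] integrable_mZ integrable_ma real_cond_exp_int(1)[OF integrable_mZ]
    by (simp add: right_diff_distrib)
qed

lemma integral_gap_nonneg:
  assumes B: "B \<in> sets H"
  shows "0 \<le> (\<integral>\<omega>. indicator B \<omega> * (mZ \<omega> - ma \<omega>) \<partial>M)"
  unfolding integral_cond_mZ[OF B, symmetric]
  by (rule integral_nonneg_AE) (use cond_mZ_ge in \<open>eventually_elim, simp\<close>)

lemma ma_le_mZ: "(\<integral>\<omega>. ma \<omega> \<partial>M) \<le> (\<integral>\<omega>. mZ \<omega> \<partial>M)"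
proof -
  have "0 \<le> (\<integral>\<omega>. indicator (space H) \<omega> * (mZ \<omega> - ma \<omega>) \<partial>M)"
    by (rule integral_gap_nonneg) simp
  also have "\<dots> = (\<integral>\<omega>. mZ \<omega> - ma \<omega> \<partial>M)"
    using subalg by (intro Bochner_Integration.integral_cong) (auto simp: subalgebra_def)
  finally show ?thesis using integrable_mZ integrable_ma by simp
qed

text \<open>The gap integrated over the complement of \<open>B\<close> is nonnegative as well, so
  restricting to \<open>B\<close> can only decrease it.\<close>

lemma integral_gap_le:
  assumes B: "B \<in> sets H"
  shows "(\<integral>\<omega>. indicator B \<omega> * (mZ \<omega> - ma \<omega>) \<partial>M) \<le> (\<integral>\<omega>. mZ \<omega> \<partial>M) - (\<integral>\<omega>. ma \<omega> \<partial>M)"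
proof -
  have B': "space H - B \<in> sets H" using B by auto
  have i: "integrable M (\<lambda>\<omega>. indicator C \<omega> * (mZ \<omega> - ma \<omega>))" if "C \<in> sets H" for C
    by (intro integrable_indicator_mult sets_H that Bochner_Integration.integrable_diff integrable_mZ integrable_ma)
  have "(\<integral>\<omega>. indicator B \<omega> * (mZ \<omega> - ma \<omega>) \<partial>M) + (\<integral>\<omega>. indicator (space H - B) \<omega> * (mZ \<omega> - ma \<omega>) \<partial>M)
      = (\<integral>\<omega>. indicator B \<omega> * (mZ \<omega> - ma \<omega>) + indicator (space H - B) \<omega> * (mZ \<omega> - ma \<omega>) \<partial>M)"
    by (rule Bochner_Integration.integral_add[symmetric]) (rule i[OF B], rule i[OF B'])
  also have "\<dots> = (\<integral>\<omega>. mZ \<omega> - ma \<omega> \<partial>M)"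
    using subalg by (intro Bochner_Integration.integral_cong refl) (auto simp: subalgebra_def indicator_def)
  also have "\<dots> = (\<integral>\<omega>. mZ \<omega> \<partial>M) - (\<integral>\<omega>. ma \<omega> \<partial>M)" using integrable_mZ integrable_ma by simp
  finally show ?thesis using integral_gap_nonneg[OF B'] by simp
qed

text \<open>On \<open>best x\<close> the maximum of the conditional means is that of
  \<open>Z x\<close>, and \<open>best x\<close> lies in \<open>H\<close>; so under the integral the
  maximum may be replaced by \<open>Z x\<close> itself.\<close>

lemma integral_best:
  assumes x: "x \<in> A"
  shows "(\<integral>\<omega>. indicator (best x) \<omega> * (mZ \<omega> - Z x \<omega>) \<partial>M) = (\<integral>\<omega>. indicator (best x) \<omega> * (mZ \<omega> - ma \<omega>) \<partial>M)"
proof -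
  note i = integrable_indicator_mult[OF sets_H[OF best_sets[OF x]]]
  have "(\<integral>\<omega>. indicator (best x) \<omega> * Z x \<omega> \<partial>M) = (\<integral>\<omega>. indicator (best x) \<omega> * real_cond_exp M H (Z x) \<omega> \<partial>M)"
    using real_cond_exp_intA[OF Z[OF x] best_sets[OF x]] by (simp add: set_lebesgue_integral_def)
  also have "\<dots> = (\<integral>\<omega>. indicator (best x) \<omega> * ma \<omega> \<partial>M)"
  proof (rule integral_cong_AE)
    show "AE \<omega> in M. indicator (best x) \<omega> * real_cond_exp M H (Z x) \<omega> = indicator (best x) \<omega> * ma \<omega>"
      using cond[OF x] by eventually_elim (auto simp: indicator_def best_def)
  qed (use i[OF real_cond_exp_int(1)[OF Z[OF x]]] i[OF integrable_ma] in auto)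
  finally show ?thesis
    using i[OF integrable_mZ] i[OF Z[OF x]] i[OF integrable_ma] by (simp add: right_diff_distrib)
qed

text \<open>With next posterior means for \<open>Z\<close>, the right side is the expected gain of
  one observation; pairwise comparisons with the current best alternative are thereby controlled by
  that gain.\<close>

lemma integral_best_le:
  assumes x: "x \<in> A" "y \<in> A"
  shows "(\<integral>\<omega>. indicator (best x) \<omega> * max 0 (Z y \<omega> - Z x \<omega>) \<partial>M) \<le> (\<integral>\<omega>. mZ \<omega> \<partial>M) - (\<integral>\<omega>. ma \<omega> \<partial>M)"
proof -
  note i = integrable_indicator_mult[OF sets_H[OF best_sets[OF x(1)]]]
  have "(\<integral>\<omega>. indicator (best x) \<omega> * max 0 (Z y \<omega> - Z x \<omega>) \<partial>M) \<le> (\<integral>\<omega>. indicator (best x) \<omega> * (mZ \<omega> - Z x \<omega>) \<partial>M)"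
  proof (rule integral_mono)
    show "integrable M (\<lambda>\<omega>. indicator (best x) \<omega> * max 0 (Z y \<omega> - Z x \<omega>))"
      using Z x by (intro i) auto
    show "integrable M (\<lambda>\<omega>. indicator (best x) \<omega> * (mZ \<omega> - Z x \<omega>))"
      using Z x integrable_mZ by (intro i) auto
    have "Z y \<omega> \<le> mZ \<omega>" "Z x \<omega> \<le> mZ \<omega>" for \<omega> using A x by auto
    then show "indicator (best x) \<omega> * max 0 (Z y \<omega> - Z x \<omega>) \<le> indicator (best x) \<omega> * (mZ \<omega> - Z x \<omega>)" for \<omega>
      by (intro mult_left_mono) auto
  qed
  then show ?thesis using integral_best[OF x(1)] integral_gap_le[OF best_sets[OF x(1)]] by simp
qed

text \<open>The counterpart of the previous bound, used with the objective for \<open>Z\<close>.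
  Overlaps of the sets \<open>best x\<close> only enlarge the right side, because the conditional
  gap is nonnegative.\<close>

lemma gap_le_sum_best:
  "(\<integral>\<omega>. mZ \<omega> \<partial>M) - (\<integral>\<omega>. ma \<omega> \<partial>M)
    \<le> (\<Sum>x\<in>A. \<Sum>y\<in>A. \<integral>\<omega>. indicator (best x) \<omega> * max 0 (Z y \<omega> - Z x \<omega>) \<partial>M)"
proof -
  let ?U = "\<lambda>\<omega>. real_cond_exp M H mZ \<omega> - ma \<omega>"
  have iU: "integrable M ?U"
    by (intro Bochner_Integration.integrable_diff real_cond_exp_int(1) integrable_mZ integrable_ma)
  have iBU: "integrable M (\<lambda>\<omega>. indicator (best x) \<omega> * ?U \<omega>)" if "x \<in> A" for x
    using that by (intro integrable_indicator_mult iU sets_H best_sets)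
  have "(\<integral>\<omega>. mZ \<omega> \<partial>M) - (\<integral>\<omega>. ma \<omega> \<partial>M) = (\<integral>\<omega>. ?U \<omega> \<partial>M)"
    using integrable_mZ integrable_ma real_cond_exp_int[OF integrable_mZ] by simp
  also have "\<dots> \<le> (\<integral>\<omega>. (\<Sum>x\<in>A. indicator (best x) \<omega> * ?U \<omega>) \<partial>M)"
  proof (rule integral_mono_AE)
    show "AE \<omega> in M. ?U \<omega> \<le> (\<Sum>x\<in>A. indicator (best x) \<omega> * ?U \<omega>)"
      using cond_mZ_ge AE_space
    proof eventually_elim
      case (elim \<omega>)
      have "ma \<omega> \<in> (\<lambda>x. a x \<omega>) ` A" using A by (intro Max_in) auto
      then obtain x where x: "ma \<omega> = a x \<omega>" "x \<in> A" by (elim imageE)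
      then have "?U \<omega> = indicator (best x) \<omega> * ?U \<omega>" using elim by (simp add: best_def)
      also have "\<dots> \<le> (\<Sum>x\<in>A. indicator (best x) \<omega> * ?U \<omega>)"
        by (rule member_le_sum) (use x A elim in auto)
      finally show ?case .
    qed
  qed (use iU iBU in auto)
  also have "\<dots> = (\<Sum>x\<in>A. \<integral>\<omega>. indicator (best x) \<omega> * ?U \<omega> \<partial>M)"
    by (rule Bochner_Integration.integral_sum) (rule iBU)
  also have "\<dots> \<le> (\<Sum>x\<in>A. \<Sum>y\<in>A. \<integral>\<omega>. indicator (best x) \<omega> * max 0 (Z y \<omega> - Z x \<omega>) \<partial>M)"
  proof (rule sum_mono)
    fix x assume x: "x \<in> A"
    note i = integrable_indicator_mult[OF sets_H[OF best_sets[OF x]]]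
    have iy: "integrable M (\<lambda>\<omega>. indicator (best x) \<omega> * max 0 (Z y \<omega> - Z x \<omega>))" if "y \<in> A" for y
      using Z x that by (intro i) auto
    have "(\<integral>\<omega>. indicator (best x) \<omega> * ?U \<omega> \<partial>M) = (\<integral>\<omega>. indicator (best x) \<omega> * (mZ \<omega> - Z x \<omega>) \<partial>M)"
      unfolding integral_best[OF x] by (rule integral_cond_mZ[OF best_sets[OF x]])
    also have "\<dots> \<le> (\<integral>\<omega>. (\<Sum>y\<in>A. indicator (best x) \<omega> * max 0 (Z y \<omega> - Z x \<omega>)) \<partial>M)"
    proof (rule integral_mono)
      show "integrable M (\<lambda>\<omega>. indicator (best x) \<omega> * (mZ \<omega> - Z x \<omega>))"
        using Z x integrable_mZ by (intro i) auto
      show "integrable M (\<lambda>\<omega>. \<Sum>y\<in>A. indicator (best x) \<omega> * max 0 (Z y \<omega> - Z x \<omega>))"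
        by (intro Bochner_Integration.integrable_sum iy)
      show "indicator (best x) \<omega> * (mZ \<omega> - Z x \<omega>) \<le> (\<Sum>y\<in>A. indicator (best x) \<omega> * max 0 (Z y \<omega> - Z x \<omega>))" for \<omega>
        unfolding sum_distrib_left[symmetric]
        by (intro mult_left_mono Max_minus_le_sum A) simp
    qed
    also have "\<dots> = (\<Sum>y\<in>A. \<integral>\<omega>. indicator (best x) \<omega> * max 0 (Z y \<omega> - Z x \<omega>) \<partial>M)"
      by (rule Bochner_Integration.integral_sum) (rule iy)
    finally show "(\<integral>\<omega>. indicator (best x) \<omega> * ?U \<omega> \<partial>M) \<le> (\<Sum>y\<in>A. \<integral>\<omega>. indicator (best x) \<omega> * max 0 (Z y \<omega> - Z x \<omega>) \<partial>M)" .
  qed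
  finally show ?thesis .
qed

end

section \<open>Small gains force small increments\<close>

context gp_sampling begin

text \<open>Given \<open>on_path pt q n\<close>, the increment is centred normal and independent of the history. If its
  standard deviation exceeds \<open>\<eta>\<close> and the current value is not below \<open>- r\<close>, then the next value is at
  least \<open>1\<close> with a probability bounded away from \<open>0\<close>.\<close>

lemma increment_sd_le:
  fixes pt :: "nat \<Rightarrow> 'b \<Rightarrow> 's"
  assumes a: "adapted pt n" and D: "D = (\<lambda>\<omega>. \<Sum>s\<in>S. c s * F s \<omega>)" and s: "s \<in> S"
    and B: "B \<in> sets (hist pt n)" and q: "q \<in> paths n" and r: "0 < r" and \<eta>: "0 < \<eta>"
  defines "\<kappa> \<equiv> measure std_normal_distribution {(r + 1) / \<eta>..}"
  shows "prob (B \<inter> on_path pt q n) * increment_sd q n s D \<le> \<eta> * prob (on_path pt q n) +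
    sqrt (expectation (\<lambda>\<omega>. (D \<omega>)\<^sup>2)) *
      (expectation (\<lambda>\<omega>. indicator (on_path pt q n) \<omega> * \<bar>lin_proj M (path_obs q) n D \<omega>\<bar>) / r +
       expectation (\<lambda>\<omega>. indicator (on_path pt q n) \<omega> * (indicator B \<omega> * max 0 (lin_proj M (path_obs (q(n := s))) (Suc n) D \<omega>))) / \<kappa>)"
    (is "?l \<le> _ + ?T * (?e1 / r + ?e2 / \<kappa>)")
proof -
  have \<kappa>: "0 < \<kappa>" unfolding \<kappa>_def by (rule std_normal_tail_pos)
  have q: "\<And>i. i < n \<Longrightarrow> q i \<in> S" using q by auto
  let ?q = "q(n := s)"
  have q': "?q i \<in> S" if "i < Suc n" for i using that q s by auto
  interpret gaussian_space M "gspace ?q (Suc n)" by (rule gaussian_space_gspace) (use q' in auto)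
  have y': "path_obs ?q i \<in> gspace ?q (Suc n)" if "i < Suc n" for i using q' that by (rule path_obs_in_gspace)
  have D': "D \<in> gspace ?q (Suc n)" unfolding D by (rule F_sum_in_gspace)
  define X where "X = increment q n s D"
  define g where "g = lin_proj M (path_obs q) n D"
  have Xe: "X = (\<lambda>\<omega>. lin_proj M (path_obs ?q) (Suc n) D \<omega> - lin_proj M (path_obs ?q) n D \<omega>)"
    unfolding X_def by (rule increment_eq)
  note i = lin_proj_increment[where y = "path_obs ?q" and n = n, OF y' D']
  have inc: "X \<in> gspace ?q (Suc n)" "expectation X = 0"
    "\<And>j. j < n \<Longrightarrow> expectation (\<lambda>\<omega>. X \<omega> * path_obs ?q j \<omega>) = 0"
    "expectation (\<lambda>\<omega>. (X \<omega>)\<^sup>2) \<le> expectation (\<lambda>\<omega>. (D \<omega>)\<^sup>2)"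
    unfolding Xe using i(1,2,3,5) by auto
  have gX: "lin_proj M (path_obs ?q) (Suc n) D \<omega> = g \<omega> + X \<omega>" for \<omega>
    unfolding g_def X_def increment_def by simp
  have g': "g = lin_proj M (path_obs ?q) n D" unfolding g_def by (rule lin_proj_path_obs_cong) simp
  have gin: "g \<in> gspace ?q (Suc n)" unfolding g' by (rule lin_proj_in) (use y' in auto)
  note gm[measurable] = meas[OF gin] and Xm[measurable] = meas[OF inc(1)]
  have em: "on_path pt q n \<in> events" by (rule on_path_events[OF a])
  have Bm: "B \<in> events" using B hist_subalgebra[OF a] unfolding subalgebra_def by blast
  note [measurable] = em Bm
  have sd: "increment_sd q n s D = sqrt (expectation (\<lambda>\<omega>. (X \<omega>)\<^sup>2))"
    unfolding increment_sd_def X_def ..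
  have T: "increment_sd q n s D \<le> ?T" unfolding sd using inc(4) by simp
  have T0: "0 \<le> ?T" by simp
  have e1: "0 \<le> ?e1" by (intro integral_nonneg_AE AE_I2) auto
  have e2: "0 \<le> ?e2" by (intro integral_nonneg_AE AE_I2) auto
  have pe: "prob (B \<inter> on_path pt q n) \<le> prob (on_path pt q n)" by (rule finite_measure_mono) (auto simp: em)
  show ?thesis
  proof (cases "increment_sd q n s D < \<eta>")
    \<comment> \<open>A standard deviation below \<eta> is absorbed by the first term of the
      bound.\<close>
    case True
    have "?l \<le> prob (on_path pt q n) * \<eta>"
      using pe True by (intro mult_mono) (auto simp: increment_sd_def)
    moreover have "0 \<le> ?T * (?e1 / r + ?e2 / \<kappa>)"
      using T0 e1 e2 r \<kappa> by (intro mult_nonneg_nonneg add_nonneg_nonneg divide_nonneg_pos) auto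
    ultimately show ?thesis by (simp add: mult.commute)
  next
    case False
    define V where "V = expectation (\<lambda>\<omega>. (X \<omega>)\<^sup>2)"
    have "\<eta> \<le> sqrt V" using False unfolding sd V_def by simp
    then have V: "\<eta>\<^sup>2 \<le> V" using \<eta> by (metis less_eq_real_def real_sqrt_le_iff real_sqrt_unique zero_le_power2 abs_of_pos real_sqrt_abs)
    have dX: "distr M borel X = normal_law 0 V"
      using distr_eq(1)[OF inc(1)] inc(2) unfolding V_def by simp
    have tail: "\<kappa> \<le> prob (X -` {r + 1..} \<inter> space M)"
    proof -
      have "\<kappa> \<le> measure (distr M borel X) {r + 1..}"
        using normal_law_tail[OF \<eta> V, of "r + 1"] r unfolding \<kappa>_def dX by simp
      also have "\<dots> = prob (X -` {r + 1..} \<inter> space M)" by (rule measure_distr) auto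
      finally show ?thesis .
    qed
    define L where "L = {\<omega> \<in> space M. - r \<le> g \<omega>}"
    have gh: "(\<lambda>\<omega>. lin_proj M (path_obs (\<lambda>i. pt i \<omega>)) n D \<omega>) \<in> borel_measurable (hist pt n)"
      by (rule lin_proj_pt_hist[OF a])
    \<comment> \<open>\<open>L\<close> refers to the projection along the fixed path and need not be
      a history event. On the path it coincides with a condition on the adaptive posterior mean,
      which is one, so independence from \<open>X\<close> applies.\<close>
    define B' where "B' = B \<inter> {\<omega> \<in> space (hist pt n). - r \<le> lin_proj M (path_obs (\<lambda>i. pt i \<omega>)) n D \<omega>}"
    have B': "B' \<in> sets (hist pt n)"
      unfolding B'_def by (intro sets.Int B borel_measurable_le[OF borel_measurable_const gh])
    have B'm: "B' \<in> events" using B' hist_subalgebra[OF a] unfolding subalgebra_def by blast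
    have B'L: "B' \<inter> on_path pt q n = B \<inter> on_path pt q n \<inter> L"
      unfolding B'_def L_def g_def using lin_proj_on_path[of _ pt q n D] sets.sets_into_space[OF em]
      by auto
    have ind: "indep_var borel (indicator (B' \<inter> on_path pt q n) :: 'b \<Rightarrow> real) borel X"
    proof (rule indep_on_path[where q' = ?q and m = "Suc n", OF a q B' _ q'])
      show "expectation (\<lambda>\<omega>. X \<omega> * path_obs q j \<omega>) = 0" if "j < n" for j
        using inc(3)[OF that] that by (simp add: path_obs_def)
    qed (use inc in auto)
    have indX: "indep_var borel (indicator (B' \<inter> on_path pt q n) :: 'b \<Rightarrow> real) borel (indicator {r + 1..} \<circ> X :: 'b \<Rightarrow> real)"
      using indep_var_compose[OF ind, of "\<lambda>x. x" borel "indicator {r + 1..}" borel] by (simp add: comp_def)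
    have "prob (B' \<inter> on_path pt q n) * \<kappa> \<le> prob (B' \<inter> on_path pt q n) * prob (X -` {r + 1..} \<inter> space M)"
      by (intro mult_left_mono tail) simp
    also have "\<dots> = expectation (indicator (B' \<inter> on_path pt q n)) * expectation (indicator {r + 1..} \<circ> X)"
    proof -
      have "expectation (indicator {r + 1..} \<circ> X :: 'b \<Rightarrow> real) = expectation (indicator (X -` {r + 1..} \<inter> space M))"
        by (intro Bochner_Integration.integral_cong refl) (auto simp: indicator_def)
      then show ?thesis using B'm by simp
    qed
    also have "\<dots> = expectation (\<lambda>\<omega>. indicator (B' \<inter> on_path pt q n) \<omega> * (indicator {r + 1..} \<circ> X) \<omega>)"
    proof (rule indep_var_lebesgue_integral[OF indX, symmetric])
      show "integrable M (indicator (B' \<inter> on_path pt q n) :: 'b \<Rightarrow> real)"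
        using B'm by (simp add: integrable_indicator_iff emeasure_eq_measure)
      show "integrable M (indicator {r + 1..} \<circ> X :: 'b \<Rightarrow> real)"
        by (rule integrable_const_bound[of _ 1]) (auto simp: indicator_def comp_def)
    qed
    also have "\<dots> \<le> ?e2"
    proof (rule integral_mono)
      show "integrable M (\<lambda>\<omega>. indicator (B' \<inter> on_path pt q n) \<omega> * (indicator {r + 1..} \<circ> X) \<omega> :: real)"
        using B'm by (intro integrable_const_bound[of _ 1]) (auto simp: indicator_def comp_def)
      have "integrable M (\<lambda>\<omega>. g \<omega> + X \<omega>)" by (intro integrable_in add_in gin inc(1))
      then show "integrable M (\<lambda>\<omega>. indicator (on_path pt q n) \<omega> * (indicator B \<omega> * max 0 (lin_proj M (path_obs ?q) (Suc n) D \<omega>)))"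
        unfolding gX by (intro integrable_indicator_mult em Bm) auto
      \<comment> \<open>On this event \<open>- r \<le> g \<omega>\<close> and
        \<open>r + 1 \<le> X \<omega>\<close>, so the next posterior mean is at least 1; this is the
        origin of the threshold \<open>r + 1\<close>.\<close>
      show "indicator (B' \<inter> on_path pt q n) \<omega> * (indicator {r + 1..} \<circ> X) \<omega>
          \<le> indicator (on_path pt q n) \<omega> * (indicator B \<omega> * max 0 (lin_proj M (path_obs ?q) (Suc n) D \<omega>))" for \<omega>
        unfolding B'L gX by (auto simp: indicator_def L_def)
    qed
    finally have b1: "prob (B' \<inter> on_path pt q n) \<le> ?e2 / \<kappa>" using \<kappa> by (simp add: pos_le_divide_eq)
    have ig: "integrable M (\<lambda>\<omega>. indicator (on_path pt q n) \<omega> * \<bar>g \<omega>\<bar>)"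
      by (intro integrable_indicator_mult em integrable_abs integrable_in gin)
    have Lm: "L \<in> events" unfolding L_def by measurable
    \<comment> \<open>Markov's inequality: on the path but outside \<open>L\<close> the absolute
      current mean exceeds \<open>r\<close>.\<close>
    have "prob (on_path pt q n - L) * r = expectation (\<lambda>\<omega>. r * indicator (on_path pt q n - L) \<omega>)"
      using Lm em by simp
    also have "\<dots> \<le> expectation (\<lambda>\<omega>. indicator (on_path pt q n) \<omega> * \<bar>g \<omega>\<bar>)"
    proof (rule integral_mono[OF _ ig])
      show "integrable M (\<lambda>\<omega>. r * indicator (on_path pt q n - L) \<omega>)"
        using Lm em by (simp add: integrable_indicator_iff emeasure_eq_measure)
      show "r * indicator (on_path pt q n - L) \<omega> \<le> indicator (on_path pt q n) \<omega> * \<bar>g \<omega>\<bar>" if "\<omega> \<in> space M" for \<omega>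
        using that by (auto simp: indicator_def L_def)
    qed
    finally have b2: "prob (on_path pt q n - L) \<le> ?e1 / r" using r unfolding g_def by (simp add: pos_le_divide_eq)
    have "prob (B \<inter> on_path pt q n) \<le> prob ((B' \<inter> on_path pt q n) \<union> (on_path pt q n - L))"
      unfolding B'L using Lm by (intro finite_measure_mono) auto
    also have "\<dots> \<le> prob (B' \<inter> on_path pt q n) + prob (on_path pt q n - L)"
      using B'm Lm by (intro measure_Un_le) auto
    finally have le: "prob (B \<inter> on_path pt q n) \<le> ?e1 / r + ?e2 / \<kappa>" using b1 b2 by simp
    have "0 \<le> ?e1 / r + ?e2 / \<kappa>" by (rule order_trans[OF measure_nonneg le])
    note le this
    then have "?l \<le> (?e1 / r + ?e2 / \<kappa>) * ?T"
      using T by (intro mult_mono) (auto simp: increment_sd_def)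
    moreover have "0 \<le> \<eta> * prob (on_path pt q n)" using \<eta> by simp
    ultimately show ?thesis by (simp add: mult.commute)
  qed
qed


subsection \<open>Convergence of the posterior maximum\<close>

abbreviation post :: "(nat \<Rightarrow> 'b \<Rightarrow> 's) \<Rightarrow> nat \<Rightarrow> ('b \<Rightarrow> real) \<Rightarrow> 'b \<Rightarrow> real" where
  "post pt n D \<omega> \<equiv> lin_proj M (path_obs (\<lambda>i. pt i \<omega>)) n D \<omega>"

lemma post_on_path: "\<omega> \<in> on_path pt q n \<Longrightarrow> post pt n D \<omega> = lin_proj M (path_obs q) n D \<omega>"
  by (simp add: lin_proj_on_path)

lemma post_const_on_path:
  "\<omega> \<in> on_path pt q n \<Longrightarrow> post (pt(n := \<lambda>_. s)) (Suc n) D \<omega> = lin_proj M (path_obs (q(n := s))) (Suc n) D \<omega>"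
  by (intro fun_cong[OF lin_proj_path_obs_cong]) (auto simp: on_path_def less_Suc_eq)

text \<open>Conditional Jensen inequality for the absolute value. It makes the Markov term uniform
  in \<open>n\<close>.\<close>

lemma cond_exp_abs_le:
  assumes a: "adapted pt n" and D: "D = (\<lambda>\<omega>. \<Sum>s\<in>S. c s * F s \<omega>)"
  shows "expectation (\<lambda>\<omega>. \<bar>post pt n D \<omega>\<bar>) \<le> expectation (\<lambda>\<omega>. \<bar>D \<omega>\<bar>)"
proof -
  interpret H: finite_measure_subalgebra M "hist pt n"
    by unfold_locales (rule hist_subalgebra[OF a])
  have iD: "integrable M D" unfolding D by (rule integrable_F_sum)
  have iA: "integrable M (\<lambda>\<omega>. \<bar>D \<omega>\<bar>)" "integrable M (\<lambda>\<omega>. - D \<omega>)" using iD by auto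
  have "expectation (\<lambda>\<omega>. \<bar>post pt n D \<omega>\<bar>) \<le> expectation (real_cond_exp M (hist pt n) (\<lambda>\<omega>. \<bar>D \<omega>\<bar>))"
  proof (rule integral_mono_AE)
    show "integrable M (\<lambda>\<omega>. \<bar>post pt n D \<omega>\<bar>)"
      using integrable_lin_proj_pt[OF a D] by (rule integrable_abs)
    show "integrable M (real_cond_exp M (hist pt n) (\<lambda>\<omega>. \<bar>D \<omega>\<bar>))"
      by (rule H.real_cond_exp_int(1)[OF iA(1)])
    have "AE \<omega> in M. real_cond_exp M (hist pt n) D \<omega> \<le> real_cond_exp M (hist pt n) (\<lambda>\<omega>. \<bar>D \<omega>\<bar>) \<omega>"
      by (intro H.real_cond_exp_mono iD iA) auto
    moreover have "AE \<omega> in M. real_cond_exp M (hist pt n) (\<lambda>\<omega>. -1 * D \<omega>) \<omega> \<le> real_cond_exp M (hist pt n) (\<lambda>\<omega>. \<bar>D \<omega>\<bar>) \<omega>"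
      using iA by (intro H.real_cond_exp_mono) auto
    moreover have "AE \<omega> in M. real_cond_exp M (hist pt n) (\<lambda>\<omega>. -1 * D \<omega>) \<omega> = -1 * real_cond_exp M (hist pt n) D \<omega>"
      by (rule H.real_cond_exp_cmult[OF iD])
    moreover note cond_exp_hist[OF a D]
    ultimately show "AE \<omega> in M. \<bar>post pt n D \<omega>\<bar> \<le> real_cond_exp M (hist pt n) (\<lambda>\<omega>. \<bar>D \<omega>\<bar>) \<omega>"
      by eventually_elim linarith
  qed
  also have "\<dots> = expectation (\<lambda>\<omega>. \<bar>D \<omega>\<bar>)" by (rule H.real_cond_exp_int(2)[OF iA(1)])
  finally show ?thesis .
qed

lemma sum_prob_on_path: "adapted pt n \<Longrightarrow> (\<Sum>q\<in>paths n. prob (on_path pt q n)) = 1"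
  using integral_split_on_path[of pt n "\<lambda>_. 1"] prob_space by (simp add: on_path_events)

text \<open>After summation over paths only the positive part of the next posterior mean depends on
  \<open>n\<close>, so \<eta> and \<open>r\<close> can be fixed before \<open>n\<close> tends to
  infinity.\<close>

lemma sum_increment_sd_le:
  fixes pt :: "nat \<Rightarrow> 'b \<Rightarrow> 's"
  assumes a: "adapted pt n" and D: "D = (\<lambda>\<omega>. \<Sum>s\<in>S. c s * F s \<omega>)" and s: "s \<in> S"
    and B: "B \<in> sets (hist pt n)" and r: "0 < r" and \<eta>: "0 < \<eta>"
  shows "(\<Sum>q\<in>paths n. prob (B \<inter> on_path pt q n) * increment_sd q n s D) \<le> \<eta> +
    sqrt (expectation (\<lambda>\<omega>. (D \<omega>)\<^sup>2)) *
      (expectation (\<lambda>\<omega>. \<bar>D \<omega>\<bar>) / r +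
       expectation (\<lambda>\<omega>. indicator B \<omega> * max 0 (post (pt(n := \<lambda>_. s)) (Suc n) D \<omega>))
         / measure std_normal_distribution {(r + 1) / \<eta>..})"
proof -
  let ?T = "sqrt (expectation (\<lambda>\<omega>. (D \<omega>)\<^sup>2))" and ?\<kappa> = "measure std_normal_distribution {(r + 1) / \<eta>..}"
  let ?D = "post pt n D" and ?D' = "post (pt(n := \<lambda>_. s)) (Suc n) D"
  have Bm: "B \<in> events" using B hist_subalgebra[OF a] unfolding subalgebra_def by blast
  have a': "adapted (pt(n := \<lambda>_. s)) (Suc n)" by (rule adapted_Suc_const[OF a s])
  have i1: "integrable M (\<lambda>\<omega>. \<bar>?D \<omega>\<bar>)" using integrable_lin_proj_pt[OF a D] by (rule integrable_abs)
  have i2: "integrable M (\<lambda>\<omega>. indicator B \<omega> * max 0 (?D' \<omega>))"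
    using integrable_lin_proj_pt[OF a' D] by (intro integrable_indicator_mult Bm) auto
  have e1: "expectation (\<lambda>\<omega>. indicator (on_path pt q n) \<omega> * \<bar>lin_proj M (path_obs q) n D \<omega>\<bar>)
      = expectation (\<lambda>\<omega>. indicator (on_path pt q n) \<omega> * \<bar>?D \<omega>\<bar>)" for q
    by (intro Bochner_Integration.integral_cong refl) (auto simp: indicator_def post_on_path)
  have e2: "expectation (\<lambda>\<omega>. indicator (on_path pt q n) \<omega> * (indicator B \<omega> * max 0 (lin_proj M (path_obs (q(n := s))) (Suc n) D \<omega>)))
      = expectation (\<lambda>\<omega>. indicator (on_path pt q n) \<omega> * (indicator B \<omega> * max 0 (?D' \<omega>)))" for q
    by (intro Bochner_Integration.integral_cong refl)
      (auto simp: indicator_def post_const_on_path simp del: fun_upd_apply)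
  have "(\<Sum>q\<in>paths n. prob (B \<inter> on_path pt q n) * increment_sd q n s D) \<le>
    (\<Sum>q\<in>paths n. \<eta> * prob (on_path pt q n) + ?T * (expectation (\<lambda>\<omega>. indicator (on_path pt q n) \<omega> * \<bar>?D \<omega>\<bar>) / r +
      expectation (\<lambda>\<omega>. indicator (on_path pt q n) \<omega> * (indicator B \<omega> * max 0 (?D' \<omega>))) / ?\<kappa>))"
    using increment_sd_le[OF a D s B _ r \<eta>] unfolding e1 e2 by (rule sum_mono)
  also have "\<dots> = \<eta> * (\<Sum>q\<in>paths n. prob (on_path pt q n)) +
      ?T * ((\<Sum>q\<in>paths n. expectation (\<lambda>\<omega>. indicator (on_path pt q n) \<omega> * \<bar>?D \<omega>\<bar>)) / r +
      (\<Sum>q\<in>paths n. expectation (\<lambda>\<omega>. indicator (on_path pt q n) \<omega> * (indicator B \<omega> * max 0 (?D' \<omega>)))) / ?\<kappa>)"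
    by (simp only: sum.distrib sum_divide_distrib sum_distrib_left[symmetric])
  also have "\<dots> = \<eta> + ?T * (expectation (\<lambda>\<omega>. \<bar>?D \<omega>\<bar>) / r + expectation (\<lambda>\<omega>. indicator B \<omega> * max 0 (?D' \<omega>)) / ?\<kappa>)"
    unfolding sum_prob_on_path[OF a] integral_split_on_path[OF a i1] integral_split_on_path[OF a i2] by simp
  also have "\<dots> \<le> \<eta> + ?T * (expectation (\<lambda>\<omega>. \<bar>D \<omega>\<bar>) / r + expectation (\<lambda>\<omega>. indicator B \<omega> * max 0 (?D' \<omega>)) / ?\<kappa>)"
    using cond_exp_abs_le[OF a D] r by (intro add_left_mono mult_left_mono add_right_mono divide_right_mono) auto
  finally show ?thesis .
qed

text \<open>Where the posterior mean is at most 0, the positive part of \<open>D\<close> is at most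
  the absolute residual. On each path the residual is independent of \<open>B\<close>, so its first
  absolute moment factors out and is bounded by its variance.\<close>

lemma positive_part_le:
  assumes a: "adapted pt n" and D: "D = (\<lambda>\<omega>. \<Sum>s\<in>S. c s * F s \<omega>)"
    and B: "B \<in> sets (hist pt n)" and neg: "\<And>\<omega>. \<omega> \<in> B \<Longrightarrow> post pt n D \<omega> \<le> 0" and \<eta>: "0 < \<eta>"
  shows "expectation (\<lambda>\<omega>. indicator B \<omega> * max 0 (D \<omega>)) \<le> \<eta> +
    (\<Sum>s\<in>S. \<bar>c s\<bar> * sqrt (expectation (\<lambda>\<omega>. (F s \<omega>)\<^sup>2) + lam s) *
      (\<Sum>q\<in>paths n. prob (B \<inter> on_path pt q n) * increment_sd q n s D)) / \<eta>"
proof -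
  have Bm: "B \<in> events" using B hist_subalgebra[OF a] unfolding subalgebra_def by blast
  have iD: "integrable M D" unfolding D by (rule integrable_F_sum)
  have iP: "integrable M (post pt n D)" by (rule integrable_lin_proj_pt[OF a D])
  have i: "integrable M (\<lambda>\<omega>. indicator B \<omega> * \<bar>D \<omega> - post pt n D \<omega>\<bar>)"
    using iD iP by (intro integrable_indicator_mult Bm integrable_abs Bochner_Integration.integrable_diff)
  let ?v = "\<lambda>q. \<Sum>s\<in>S. \<bar>c s\<bar> * sqrt (expectation (\<lambda>\<omega>. (F s \<omega>)\<^sup>2) + lam s) * increment_sd q n s D"
  have "expectation (\<lambda>\<omega>. indicator B \<omega> * max 0 (D \<omega>)) \<le> expectation (\<lambda>\<omega>. indicator B \<omega> * \<bar>D \<omega> - post pt n D \<omega>\<bar>)"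
  proof (rule integral_mono[OF _ i])
    show "integrable M (\<lambda>\<omega>. indicator B \<omega> * max 0 (D \<omega>))"
      using iD by (intro integrable_indicator_mult Bm) auto
    show "indicator B \<omega> * max 0 (D \<omega>) \<le> indicator B \<omega> * \<bar>D \<omega> - post pt n D \<omega>\<bar>" for \<omega>
      using neg[of \<omega>] by (auto simp: indicator_def)
  qed
  also have "\<dots> = (\<Sum>q\<in>paths n. expectation (\<lambda>\<omega>. indicator (on_path pt q n) \<omega> * (indicator B \<omega> * \<bar>D \<omega> - post pt n D \<omega>\<bar>)))"
    by (rule integral_split_on_path[OF a i, symmetric])
  also have "\<dots> \<le> (\<Sum>q\<in>paths n. \<eta> * prob (on_path pt q n) + (prob (B \<inter> on_path pt q n) * ?v q) / \<eta>)"
  proof (rule sum_mono)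
    fix q assume "q \<in> paths n"
    then have q: "\<And>i. i < n \<Longrightarrow> q i \<in> S" by auto
    interpret gaussian_space M "gspace q n" by (rule gaussian_space_gspace) (use q in auto)
    let ?r = "\<lambda>\<omega>. D \<omega> - lin_proj M (path_obs q) n D \<omega>"
    note r = residual_in[OF q D]
    have [measurable]: "on_path pt q n \<in> events" by (rule on_path_events[OF a])
    have ind: "indep_var borel (indicator (B \<inter> on_path pt q n) :: 'b \<Rightarrow> real) borel ?r"
      using q by (intro indep_on_path[where q' = q and m = n] a B r(2,3,4)) auto
    have ind': "indep_var borel (indicator (B \<inter> on_path pt q n) :: 'b \<Rightarrow> real) borel (\<lambda>\<omega>. \<bar>?r \<omega>\<bar>)"
      using indep_var_compose[OF ind, of "\<lambda>x. x" borel abs borel] by (simp add: comp_def)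
    have "expectation (\<lambda>\<omega>. indicator (on_path pt q n) \<omega> * (indicator B \<omega> * \<bar>D \<omega> - post pt n D \<omega>\<bar>))
        = expectation (\<lambda>\<omega>. indicator (B \<inter> on_path pt q n) \<omega> * \<bar>?r \<omega>\<bar>)"
      by (intro Bochner_Integration.integral_cong refl) (auto simp: indicator_def post_on_path)
    also have "\<dots> = expectation (indicator (B \<inter> on_path pt q n)) * expectation (\<lambda>\<omega>. \<bar>?r \<omega>\<bar>)"
      using Bm integrable_in[OF r(2)]
      by (intro indep_var_lebesgue_integral ind') (auto simp: integrable_indicator_iff emeasure_eq_measure)
    also have "\<dots> = prob (B \<inter> on_path pt q n) * expectation (\<lambda>\<omega>. \<bar>?r \<omega>\<bar>)" using Bm by simp
    also have "\<dots> \<le> prob (B \<inter> on_path pt q n) * (\<eta> + ?v q / \<eta>)"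
    proof (rule mult_left_mono)
      \<comment> \<open>This elementary bound replaces the square root of the variance, so the
        estimate stays linear in the increments and can be summed over points and paths.\<close>
      have b: "\<bar>x\<bar> \<le> \<eta> + x\<^sup>2 / \<eta>" for x
      proof (cases "\<bar>x\<bar> \<le> \<eta>")
        case False
        then have "\<eta> * \<bar>x\<bar> \<le> \<bar>x\<bar> * \<bar>x\<bar>" by (intro mult_right_mono) auto
        then have "\<bar>x\<bar> \<le> x\<^sup>2 / \<eta>" using \<eta> by (simp add: pos_le_divide_eq power2_eq_square mult.commute)
        with \<eta> show ?thesis by simp
      qed (use \<eta> in \<open>simp add: add_increasing2\<close>)
      have "expectation (\<lambda>\<omega>. \<bar>?r \<omega>\<bar>) \<le> expectation (\<lambda>\<omega>. \<eta> + (?r \<omega>)\<^sup>2 / \<eta>)"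
        using integrable_in[OF r(2)] integrable_sq[OF r(2)] by (intro integral_mono b) auto
      also have "\<dots> = \<eta> + expectation (\<lambda>\<omega>. (?r \<omega>)\<^sup>2) / \<eta>"
        using integrable_sq[OF r(2)] prob_space by simp
      also have "\<dots> \<le> \<eta> + ?v q / \<eta>"
        using resid_var_le[OF q D] \<eta> by (intro add_left_mono divide_right_mono) auto
      finally show "expectation (\<lambda>\<omega>. \<bar>?r \<omega>\<bar>) \<le> \<eta> + ?v q / \<eta>" .
    qed simp
    also have "\<dots> \<le> \<eta> * prob (on_path pt q n) + (prob (B \<inter> on_path pt q n) * ?v q) / \<eta>"
      using finite_measure_mono[of "B \<inter> on_path pt q n" "on_path pt q n"] \<eta> by (simp add: distrib_left mult.commute)
    finally show "expectation (\<lambda>\<omega>. indicator (on_path pt q n) \<omega> * (indicator B \<omega> * \<bar>D \<omega> - post pt n D \<omega>\<bar>))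
      \<le> \<eta> * prob (on_path pt q n) + (prob (B \<inter> on_path pt q n) * ?v q) / \<eta>" .
  qed
  also have "\<dots> = \<eta> * (\<Sum>q\<in>paths n. prob (on_path pt q n)) + (\<Sum>q\<in>paths n. prob (B \<inter> on_path pt q n) * ?v q) / \<eta>"
    by (simp only: sum.distrib sum_divide_distrib sum_distrib_left[symmetric])
  also have "(\<Sum>q\<in>paths n. prob (B \<inter> on_path pt q n) * ?v q) =
    (\<Sum>s\<in>S. \<bar>c s\<bar> * sqrt (expectation (\<lambda>\<omega>. (F s \<omega>)\<^sup>2) + lam s) *
      (\<Sum>q\<in>paths n. prob (B \<inter> on_path pt q n) * increment_sd q n s D))"
    unfolding sum_distrib_left by (subst sum.swap) (simp add: mult_ac)
  finally show ?thesis unfolding sum_prob_on_path[OF a] by simp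
qed

text \<open>Two stages: the hypothesis \<open>lim\<close> makes the weighted increments of every
  point vanish, and these bound the positive part of \<open>D\<close>, both with auxiliary constants
  chosen before \<open>n\<close>.\<close>

lemma positive_part_tendsto_0:
  assumes a: "\<And>n. adapted pt n" and D: "D = (\<lambda>\<omega>. \<Sum>s\<in>S. c s * F s \<omega>)"
    and B: "\<And>n. B n \<in> sets (hist pt n)" and neg: "\<And>n \<omega>. \<omega> \<in> B n \<Longrightarrow> post pt n D \<omega> \<le> 0"
    and lim: "\<And>s. s \<in> S \<Longrightarrow>
      (\<lambda>n. expectation (\<lambda>\<omega>. indicator (B n) \<omega> * max 0 (post (pt(n := \<lambda>_. s)) (Suc n) D \<omega>))) \<longlonglongrightarrow> 0"
  shows "(\<lambda>n. expectation (\<lambda>\<omega>. indicator (B n) \<omega> * max 0 (D \<omega>))) \<longlonglongrightarrow> 0"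
proof -
  let ?t = "\<lambda>s n. \<Sum>q\<in>paths n. prob (B n \<inter> on_path pt q n) * increment_sd q n s D"
  let ?T = "sqrt (expectation (\<lambda>\<omega>. (D \<omega>)\<^sup>2))"
  have t: "?t s \<longlonglongrightarrow> 0" if s: "s \<in> S" for s
  proof (rule order_tendstoI)
    fix b :: real assume "b < 0"
    moreover have "0 \<le> ?t s n" for n
      by (intro sum_nonneg mult_nonneg_nonneg) (auto simp: increment_sd_def)
    ultimately show "\<forall>\<^sub>F n in sequentially. b < ?t s n" by (intro always_eventually allI) (meson less_le_trans)
  next
    fix b :: real assume b: "0 < b"
    \<comment> \<open>Each of three terms receives \<open>b / 3\<close>: the small increments
      through \<eta>, the Markov term through the choice of \<open>r\<close>, and the gain term for
      large \<open>n\<close>. The summand 1 in \<open>r\<close> keeps it positive and the second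
      bound strict.\<close>
    define \<eta> where "\<eta> = b / 3"
    define r where "r = 3 * (?T * expectation (\<lambda>\<omega>. \<bar>D \<omega>\<bar>) + 1) / b"
    have nn: "0 \<le> ?T * expectation (\<lambda>\<omega>. \<bar>D \<omega>\<bar>)"
      by (intro mult_nonneg_nonneg integral_nonneg_AE) auto
    have \<eta>: "0 < \<eta>" using b by (simp add: \<eta>_def)
    have "0 < 3 * (?T * expectation (\<lambda>\<omega>. \<bar>D \<omega>\<bar>) + 1)"
      by (intro mult_pos_pos add_nonneg_pos nn) auto
    then have r: "0 < r" unfolding r_def using b by (rule divide_pos_pos)
    have rb: "?T * (expectation (\<lambda>\<omega>. \<bar>D \<omega>\<bar>) / r) < b / 3"
    proof -
      have "?T * expectation (\<lambda>\<omega>. \<bar>D \<omega>\<bar>) < b / 3 * r"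
        using b by (simp add: r_def)
      then show ?thesis using r by (simp add: pos_divide_less_eq)
    qed
    let ?\<kappa> = "measure std_normal_distribution {(r + 1) / \<eta>..}"
    let ?w = "\<lambda>n. expectation (\<lambda>\<omega>. indicator (B n) \<omega> * max 0 (post (pt(n := \<lambda>_. s)) (Suc n) D \<omega>))"
    have "(\<lambda>n. ?T * (?w n / ?\<kappa>)) \<longlonglongrightarrow> ?T * (0 / ?\<kappa>)"
      by (intro tendsto_intros lim s) (use std_normal_tail_pos[of "(r + 1) / \<eta>"] in simp)
    then have "\<forall>\<^sub>F n in sequentially. ?T * (?w n / ?\<kappa>) < b / 3"
      by (rule order_tendstoD(2)) (use b in simp)
    then show "\<forall>\<^sub>F n in sequentially. ?t s n < b"
    proof eventually_elim
      case (elim n)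
      have "?t s n \<le> \<eta> + ?T * (expectation (\<lambda>\<omega>. \<bar>D \<omega>\<bar>) / r + ?w n / ?\<kappa>)"
        by (rule sum_increment_sd_le[OF a D s B r \<eta>])
      also have "\<dots> = b / 3 + ?T * (expectation (\<lambda>\<omega>. \<bar>D \<omega>\<bar>) / r) + ?T * (?w n / ?\<kappa>)"
        by (simp only: distrib_left \<eta>_def add.assoc)
      also have "\<dots> < b" using elim rb by linarith
      finally show ?case .
    qed
  qed
  show ?thesis
  proof (rule order_tendstoI)
    fix b :: real assume "b < 0"
    moreover have "0 \<le> expectation (\<lambda>\<omega>. indicator (B n) \<omega> * max 0 (D \<omega>))" for n
      by (intro integral_nonneg_AE) auto
    ultimately show "\<forall>\<^sub>F n in sequentially. b < expectation (\<lambda>\<omega>. indicator (B n) \<omega> * max 0 (D \<omega>))"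
      by (intro always_eventually allI) (meson less_le_trans)
  next
    fix b :: real assume b: "0 < b"
    let ?C = "\<lambda>s. \<bar>c s\<bar> * sqrt (expectation (\<lambda>\<omega>. (F s \<omega>)\<^sup>2) + lam s)"
    \<comment> \<open>The divisor is the parameter \<open>b / 2\<close> of the preceding estimate,
      whose own contribution takes the other half of \<open>b\<close>.\<close>
    have "(\<lambda>n. (\<Sum>s\<in>S. ?C s * ?t s n) / (b / 2)) \<longlonglongrightarrow> (\<Sum>s\<in>S. ?C s * 0) / (b / 2)"
      by (intro tendsto_divide tendsto_sum tendsto_mult tendsto_const t) (use b in auto)
    then have "\<forall>\<^sub>F n in sequentially. (\<Sum>s\<in>S. ?C s * ?t s n) / (b / 2) < b / 2"
      by (rule order_tendstoD(2)) (use b in simp)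
    then show "\<forall>\<^sub>F n in sequentially. expectation (\<lambda>\<omega>. indicator (B n) \<omega> * max 0 (D \<omega>)) < b"
    proof eventually_elim
      case (elim n)
      have "expectation (\<lambda>\<omega>. indicator (B n) \<omega> * max 0 (D \<omega>)) \<le> b / 2 + (\<Sum>s\<in>S. ?C s * ?t s n) / (b / 2)"
        using b by (intro positive_part_le[OF a D B neg]) auto
      then show ?case using elim by linarith
    qed
  qed
qed


lemma post_diff:
  assumes a: "adapted pt n" and \<omega>: "\<omega> \<in> space M"
    and D: "D = (\<lambda>\<omega>. \<Sum>s\<in>S. c s * F s \<omega>)" "D' = (\<lambda>\<omega>. \<Sum>s\<in>S. c' s * F s \<omega>)"
  shows "post pt n (\<lambda>\<omega>. D \<omega> - D' \<omega>) \<omega> = post pt n D \<omega> - post pt n D' \<omega>"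
proof -
  have q: "(\<lambda>i. pt i \<omega>) i \<in> S" if "i < n" for i using adapted_point[OF a that \<omega>] .
  interpret gaussian_space M "gspace (\<lambda>i. pt i \<omega>) n" by (rule gaussian_space_gspace) (use q in auto)
  show ?thesis
    by (rule lin_proj_diff) (use q in \<open>auto simp: D intro: path_obs_in_gspace F_sum_in_gspace\<close>)
qed

section \<open>Expected gain and final gap as maxima of conditional expectations\<close>

lemma cond_exp_family_post:
  assumes a: "adapted pt n" and A: "finite A" "A \<noteq> {}"
    and G: "\<And>x. x \<in> A \<Longrightarrow> G x = (\<lambda>\<omega>. \<Sum>s\<in>S. c x s * F s \<omega>)"
  shows "cond_exp_family M (hist pt n) A G (\<lambda>x. post pt n (G x))"
proof unfold_locales
  show "subalgebra M (hist pt n)" by (rule hist_subalgebra[OF a])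
  fix x assume x: "x \<in> A"
  show "integrable M (G x)" unfolding G[OF x] by (rule integrable_F_sum)
  show "post pt n (G x) \<in> borel_measurable (hist pt n)" by (rule lin_proj_pt_hist[OF a])
  show "integrable M (post pt n (G x))" by (rule integrable_lin_proj_pt[OF a G[OF x]])
  show "AE \<omega> in M. real_cond_exp M (hist pt n) (G x) \<omega> = post pt n (G x) \<omega>"
    by (rule cond_exp_hist[OF a G[OF x]])
qed (rule A)+

text \<open>The tower property. Forcing the point of step \<open>n\<close> does not change the
  history of the first \<open>n\<close> steps, which is contained in the history after the forced
  observation.\<close>

lemma cond_exp_family_post_Suc:
  assumes a: "adapted pt n" and s: "s \<in> S" and A: "finite A" "A \<noteq> {}"
    and G: "\<And>x. x \<in> A \<Longrightarrow> G x = (\<lambda>\<omega>. \<Sum>s\<in>S. c x s * F s \<omega>)"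
  shows "cond_exp_family M (hist pt n) A (\<lambda>x. post (pt(n := \<lambda>_. s)) (Suc n) (G x)) (\<lambda>x. post pt n (G x))"
proof unfold_locales
  let ?pt = "pt(n := \<lambda>_. s)"
  have a': "adapted ?pt (Suc n)" by (rule adapted_Suc_const[OF a s])
  have h: "hist ?pt n = hist pt n" by (rule hist_cong) simp
  show sub: "subalgebra M (hist pt n)" by (rule hist_subalgebra[OF a])
  interpret H: finite_measure_subalgebra M "hist pt n" by unfold_locales (rule sub)
  interpret H': finite_measure_subalgebra M "hist ?pt (Suc n)"
    by unfold_locales (rule hist_subalgebra[OF a'])
  fix x assume x: "x \<in> A"
  have iG: "integrable M (G x)" unfolding G[OF x] by (rule integrable_F_sum)
  show i': "integrable M (post ?pt (Suc n) (G x))" by (rule integrable_lin_proj_pt[OF a' G[OF x]])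
  show "post pt n (G x) \<in> borel_measurable (hist pt n)" by (rule lin_proj_pt_hist[OF a])
  show "integrable M (post pt n (G x))" by (rule integrable_lin_proj_pt[OF a G[OF x]])
  have "subalgebra (hist ?pt (Suc n)) (hist pt n)"
    using hist_mono[OF a', of n] unfolding h by simp
  then have "AE \<omega> in M. real_cond_exp M (hist pt n) (real_cond_exp M (hist ?pt (Suc n)) (G x)) \<omega> = real_cond_exp M (hist pt n) (G x) \<omega>"
    by (rule H.real_cond_exp_nested_subalg[OF H'.subalg _ iG])
  moreover have "AE \<omega> in M. real_cond_exp M (hist pt n) (real_cond_exp M (hist ?pt (Suc n)) (G x)) \<omega> =
      real_cond_exp M (hist pt n) (post ?pt (Suc n) (G x)) \<omega>"
    using i' by (intro H.real_cond_exp_cong cond_exp_hist[OF a' G[OF x]]) auto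
  moreover note cond_exp_hist[OF a G[OF x]]
  ultimately show "AE \<omega> in M. real_cond_exp M (hist pt n) (post ?pt (Suc n) (G x)) \<omega> = post pt n (G x) \<omega>"
    by eventually_elim simp
qed (rule A)+

text \<open>\<open>step\<close> isolates what the policy provides beyond adaptedness. The family
  bounds enter twice: for next posterior means they bound positive parts by gains, and for the
  objective they bound the final gap by positive parts.\<close>

lemma max_post_tendsto:
  assumes a: "\<And>n. adapted pt n" and A: "finite A" "A \<noteq> {}"
    and G: "\<And>x. x \<in> A \<Longrightarrow> G x = (\<lambda>\<omega>. \<Sum>s\<in>S. c x s * F s \<omega>)"
    and step: "\<And>n s. s \<in> S \<Longrightarrow> expectation (\<lambda>\<omega>. MAX x\<in>A. post (pt(n := \<lambda>_. s)) (Suc n) (G x) \<omega>)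
      \<le> expectation (\<lambda>\<omega>. MAX x\<in>A. post pt (Suc n) (G x) \<omega>)"
  shows "(\<lambda>n. expectation (\<lambda>\<omega>. MAX x\<in>A. post pt n (G x) \<omega>)) \<longlonglongrightarrow> expectation (\<lambda>\<omega>. MAX x\<in>A. G x \<omega>)"
    (is "?V \<longlonglongrightarrow> ?L")
proof -
  let ?U = "\<lambda>n s. expectation (\<lambda>\<omega>. MAX x\<in>A. post (pt(n := \<lambda>_. s)) (Suc n) (G x) \<omega>)"
  define B where "B n x = {\<omega> \<in> space M. post pt n (G x) \<omega> = (MAX x\<in>A. post pt n (G x) \<omega>)}" for n x
  have fam1: "cond_exp_family M (hist pt n) A G (\<lambda>x. post pt n (G x))" for n
    by (rule cond_exp_family_post[OF a A G])
  have fam2: "cond_exp_family M (hist pt n) A (\<lambda>x. post (pt(n := \<lambda>_. s)) (Suc n) (G x)) (\<lambda>x. post pt n (G x))"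
    if "s \<in> S" for n s
    by (rule cond_exp_family_post_Suc[OF a that A G])
  have best: "cond_exp_family.best M A (\<lambda>x. post pt n (G x)) x = B n x" for n x
    unfolding B_def by (rule cond_exp_family.best_def[OF fam1])
  have VL: "?V n \<le> ?L" for n by (rule cond_exp_family.ma_le_mZ[OF fam1])
  have VU: "?V n \<le> ?U n s" if "s \<in> S" for n s by (rule cond_exp_family.ma_le_mZ[OF fam2[OF that]])
  have UV: "(\<lambda>n. ?U n s - ?V n) \<longlonglongrightarrow> 0" if s: "s \<in> S" for s
  proof -
    have "incseq ?V" by (rule incseq_SucI) (rule order_trans[OF VU[OF s] step[OF s]])
    then obtain l where l: "?V \<longlonglongrightarrow> l" by (rule incseq_convergent[of ?V ?L]) (use VL in blast)
    then have "(\<lambda>n. ?V (Suc n) - ?V n) \<longlonglongrightarrow> l - l" by (intro tendsto_diff LIMSEQ_Suc)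
    then have "(\<lambda>n. ?V (Suc n) - ?V n) \<longlonglongrightarrow> 0" by simp
    then show ?thesis
      by (rule tendsto_sandwich[OF _ _ tendsto_const, rotated 2])
        (use VU[OF s] step[OF s] in \<open>auto intro!: always_eventually\<close>)
  qed
  have pos: "(\<lambda>n. expectation (\<lambda>\<omega>. indicator (B n x) \<omega> * max 0 (G y \<omega> - G x \<omega>))) \<longlonglongrightarrow> 0"
    if x: "x \<in> A" and y: "y \<in> A" for x y
  proof (rule positive_part_tendsto_0[where c = "\<lambda>s. c y s - c x s", OF a])
    show D: "(\<lambda>\<omega>. G y \<omega> - G x \<omega>) = (\<lambda>\<omega>. \<Sum>s\<in>S. (c y s - c x s) * F s \<omega>)"
      unfolding G[OF x] G[OF y] by (simp add: left_diff_distrib sum_subtractf)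
    show "B n x \<in> sets (hist pt n)" for n
      using cond_exp_family.best_sets[OF fam1 x] unfolding best .
    show "post pt n (\<lambda>\<omega>. G y \<omega> - G x \<omega>) \<omega> \<le> 0" if "\<omega> \<in> B n x" for n \<omega>
    proof -
      have "post pt n (G y) \<omega> \<le> (MAX x\<in>A. post pt n (G x) \<omega>)" using A y by (intro Max_ge) auto
      then show ?thesis using that post_diff[OF a _ G[OF y] G[OF x], of \<omega> n] by (simp add: B_def)
    qed
    fix s assume s: "s \<in> S"
    let ?pt = "\<lambda>n. pt(n := \<lambda>_. s)"
    have a': "adapted (?pt n) (Suc n)" for n by (rule adapted_Suc_const[OF a s])
    have e: "expectation (\<lambda>\<omega>. indicator (B n x) \<omega> * max 0 (post (?pt n) (Suc n) (\<lambda>\<omega>. G y \<omega> - G x \<omega>) \<omega>)) =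
      expectation (\<lambda>\<omega>. indicator (B n x) \<omega> * max 0 (post (?pt n) (Suc n) (G y) \<omega> - post (?pt n) (Suc n) (G x) \<omega>))" for n
      using post_diff[OF a' _ G[OF y] G[OF x]] by (intro Bochner_Integration.integral_cong refl) (simp del: fun_upd_apply)
    show "(\<lambda>n. expectation (\<lambda>\<omega>. indicator (B n x) \<omega> * max 0 (post (?pt n) (Suc n) (\<lambda>\<omega>. G y \<omega> - G x \<omega>) \<omega>))) \<longlonglongrightarrow> 0"
    proof (rule tendsto_sandwich[OF _ _ tendsto_const UV[OF s]])
      show "\<forall>\<^sub>F n in sequentially. 0 \<le> expectation (\<lambda>\<omega>. indicator (B n x) \<omega> * max 0 (post (?pt n) (Suc n) (\<lambda>\<omega>. G y \<omega> - G x \<omega>) \<omega>))"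
        by (intro always_eventually allI integral_nonneg_AE AE_I2) auto
      show "\<forall>\<^sub>F n in sequentially. expectation (\<lambda>\<omega>. indicator (B n x) \<omega> * max 0 (post (?pt n) (Suc n) (\<lambda>\<omega>. G y \<omega> - G x \<omega>) \<omega>)) \<le> ?U n s - ?V n"
        unfolding e using cond_exp_family.integral_best_le[OF fam2[OF s] x y]
        unfolding best by (intro always_eventually allI) auto
    qed
  qed
  have sum0: "(\<lambda>n. \<Sum>x\<in>A. \<Sum>y\<in>A. expectation (\<lambda>\<omega>. indicator (B n x) \<omega> * max 0 (G y \<omega> - G x \<omega>))) \<longlonglongrightarrow> 0"
    by (intro tendsto_null_sum pos)
  have "(\<lambda>n. ?L - ?V n) \<longlonglongrightarrow> 0"
  proof (rule tendsto_sandwich[OF _ _ tendsto_const sum0])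
    show "\<forall>\<^sub>F n in sequentially. 0 \<le> ?L - ?V n" using VL by (intro always_eventually allI) simp
    show "\<forall>\<^sub>F n in sequentially. ?L - ?V n \<le> (\<Sum>x\<in>A. \<Sum>y\<in>A. expectation (\<lambda>\<omega>. indicator (B n x) \<omega> * max 0 (G y \<omega> - G x \<omega>)))"
      using cond_exp_family.gap_le_sum_best[OF fam1] unfolding best by (intro always_eventually allI)
  qed
  from tendsto_diff[OF tendsto_const[of ?L] this] show ?thesis by simp
qed

text \<open>In \<open>opt\<close> the conditional expectation is formed with a frozen point and only
  afterwards evaluated where that point is the chosen one, so it is not literally a conditional
  expectation of the adaptive quantity. Splitting by the finitely many values of
  \<open>pt n\<close>, whose events belong to the history, connects the two.\<close>

lemma greedy_step:
  assumes a: "\<And>n. adapted pt n" and A: "finite A" "A \<noteq> {}"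
    and G: "\<And>x. x \<in> A \<Longrightarrow> G x = (\<lambda>\<omega>. \<Sum>s\<in>S. c x s * F s \<omega>)"
    and opt: "\<And>s. s \<in> S \<Longrightarrow> AE \<omega> in M.
      real_cond_exp M (hist pt n) (\<lambda>\<omega>. MAX x\<in>A. post (pt(n := \<lambda>_. s)) (Suc n) (G x) \<omega>) \<omega> \<le>
      real_cond_exp M (hist pt n) (\<lambda>\<omega>'. MAX x\<in>A. post (pt(n := \<lambda>_. pt n \<omega>)) (Suc n) (G x) \<omega>') \<omega>"
    and s: "s \<in> S"
  shows "expectation (\<lambda>\<omega>. MAX x\<in>A. post (pt(n := \<lambda>_. s)) (Suc n) (G x) \<omega>)
      \<le> expectation (\<lambda>\<omega>. MAX x\<in>A. post pt (Suc n) (G x) \<omega>)"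
proof -
  interpret H: finite_measure_subalgebra M "hist pt n" by unfold_locales (rule hist_subalgebra[OF a])
  define m where "m s \<omega> = (MAX x\<in>A. post (pt(n := \<lambda>_. s)) (Suc n) (G x) \<omega>)" for s \<omega>
  let ?C = "\<lambda>s. real_cond_exp M (hist pt n) (m s)"
  define P where "P s = {\<omega> \<in> space M. pt n \<omega> = s}" for s
  have P: "P s \<in> sets (hist pt n)" if "s \<in> S" for s
  proof -
    have "P s = pt n -` {s} \<inter> space (hist pt n)" by (auto simp: P_def)
    also have "\<dots> \<in> sets (hist pt n)"
      using a[of "Suc n"] that by (intro measurable_sets[of _ _ "count_space S"]) (auto simp: adapted_def)
    finally show ?thesis .
  qed
  have PM: "P s \<in> events" if "s \<in> S" for s using P[OF that] H.subalg unfolding subalgebra_def by blast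
  have im: "integrable M (m s)" if "s \<in> S" for s
    unfolding m_def
    by (intro integrable_Max A) (rule integrable_lin_proj_pt[OF adapted_Suc_const[OF a that] G])
  have iC: "integrable M (?C s)" if "s \<in> S" for s by (rule H.real_cond_exp_int(1)[OF im[OF that]])
  have split: "f \<omega> = (\<Sum>t\<in>S. indicator (P t) \<omega> * f \<omega>)" if "\<omega> \<in> space M" for f :: "'b \<Rightarrow> real" and \<omega>
  proof -
    have "pt n \<omega> \<in> S" using adapted_point[OF a[of "Suc n"] _ that] by simp
    moreover have "(\<Sum>t\<in>S. indicator (P t) \<omega> * f \<omega>) = (\<Sum>t\<in>S. if t = pt n \<omega> then f \<omega> else 0)"
      using that by (intro sum.cong) (auto simp: P_def)
    ultimately show ?thesis using finite_S by simp
  qed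
  have opt': "AE \<omega> in M. indicator (P t) \<omega> * ?C s \<omega> \<le> indicator (P t) \<omega> * ?C t \<omega>" for t
    using opt[OF s] unfolding m_def by eventually_elim (auto simp: indicator_def P_def)
  \<comment> \<open>The posterior at \<omega> depends on the process only through the points at
    \<omega>, so on \<open>P t\<close> freezing the point of step \<open>n\<close> at
    \<open>t\<close> changes nothing.\<close>
  have m_eq: "indicator (P t) \<omega> * m t \<omega> = indicator (P t) \<omega> * (MAX x\<in>A. post pt (Suc n) (G x) \<omega>)" for t \<omega>
  proof (cases "\<omega> \<in> P t")
    case True
    then have "(\<lambda>i. (pt(n := \<lambda>_. t)) i \<omega>) = (\<lambda>i. pt i \<omega>)" by (auto simp: P_def fun_eq_iff)
    then show ?thesis unfolding m_def by (simp only:)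
  qed simp
  have "expectation (m s) = expectation (?C s)" by (rule H.real_cond_exp_int(2)[OF im[OF s], symmetric])
  also have "\<dots> = expectation (\<lambda>\<omega>. \<Sum>t\<in>S. indicator (P t) \<omega> * ?C s \<omega>)"
    by (intro Bochner_Integration.integral_cong refl split)
  also have "\<dots> = (\<Sum>t\<in>S. expectation (\<lambda>\<omega>. indicator (P t) \<omega> * ?C s \<omega>))"
    by (rule Bochner_Integration.integral_sum) (intro integrable_indicator_mult PM iC s)
  also have "\<dots> \<le> (\<Sum>t\<in>S. expectation (\<lambda>\<omega>. indicator (P t) \<omega> * ?C t \<omega>))"
    by (intro sum_mono integral_mono_AE integrable_indicator_mult PM iC s opt')
  also have "\<dots> = (\<Sum>t\<in>S. expectation (\<lambda>\<omega>. indicator (P t) \<omega> * m t \<omega>))"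
    using H.real_cond_exp_intA[OF im P] by (intro sum.cong refl) (simp add: set_lebesgue_integral_def)
  also have "\<dots> = (\<Sum>t\<in>S. expectation (\<lambda>\<omega>. indicator (P t) \<omega> * (MAX x\<in>A. post pt (Suc n) (G x) \<omega>)))"
    by (simp only: m_eq)
  also have "\<dots> = expectation (\<lambda>\<omega>. \<Sum>t\<in>S. indicator (P t) \<omega> * (MAX x\<in>A. post pt (Suc n) (G x) \<omega>))"
    by (rule Bochner_Integration.integral_sum[symmetric])
      (intro integrable_indicator_mult PM integrable_Max A, assumption, rule integrable_lin_proj_pt[OF a G])
  also have "\<dots> = expectation (\<lambda>\<omega>. MAX x\<in>A. post pt (Suc n) (G x) \<omega>)"
    by (intro Bochner_Integration.integral_cong refl split[symmetric])
  finally show ?thesis unfolding m_def .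
qed

end

section \<open>Convergence under the BQO policy\<close>

theorem theorem2:
  fixes M :: "'b measure"
    and A :: "'a set" and W :: "'w set"
    and p :: "'w \<Rightarrow> real"
    and \<mu>\<^sub>0 :: "'a \<times> 'w \<Rightarrow> real" and \<Sigma>\<^sub>0 :: "'a \<times> 'w \<Rightarrow> 'a \<times> 'w \<Rightarrow> real"
    and lam :: "'a \<times> 'w \<Rightarrow> real"
    and F :: "'a \<times> 'w \<Rightarrow> 'b \<Rightarrow> real"
    and eps :: "nat \<Rightarrow> 'a \<times> 'w \<Rightarrow> 'b \<Rightarrow> real"
    and pt :: "nat \<Rightarrow> 'b \<Rightarrow> 'a \<times> 'w"
  assumes "prob_space M"
    and "finite A" and "A \<noteq> {}" and "finite W" and "W \<noteq> {}"
    and "\<And>w. w \<in> W \<Longrightarrow> 0 \<le> p w"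
    and "(\<mu>\<^sub>0, \<Sigma>\<^sub>0) \<in> hyperparameters (A \<times> W)"
    and "gaussian_process M (A \<times> W) \<mu>\<^sub>0 \<Sigma>\<^sub>0 F"
    and "\<And>s. s \<in> A \<times> W \<Longrightarrow> 0 \<le> lam s"
    and "independent_normal_noise M (A \<times> W) lam F eps"
    and "bqo_policy M A W p F eps pt"
  shows "(\<lambda>N. prob_space.expectation M (\<lambda>\<omega>. MAX x\<in>A. objective_mean M A W p F eps pt N x \<omega>))
           \<longlonglongrightarrow> prob_space.expectation M (\<lambda>\<omega>. MAX x\<in>A. objective W p F x \<omega>)"
proof -
  interpret prob_space M by fact
  interpret gp_sampling M "A \<times> W" \<mu>\<^sub>0 \<Sigma>\<^sub>0 lam F eps
    using assms by unfold_locales (auto simp: hyperparameters_def)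
  have A: "finite A" "A \<noteq> {}" by fact+
  have a: "adapted pt n" for n
    using assms(11) unfolding bqo_policy_def adapted_def by blast
  let ?G = "objective W p F"
  \<comment> \<open>The coefficients vanish off the row of \<open>x\<close>, which presents the
    objective as a linear combination over the whole index set.\<close>
  define c where "c x s = (if fst s = x then p (snd s) else 0)" for x :: 'a and s :: "'a \<times> 'w"
  have G: "?G x = (\<lambda>\<omega>. \<Sum>s\<in>A \<times> W. c x s * F s \<omega>)" if x: "x \<in> A" for x
  proof
    fix \<omega>
    have "(\<Sum>s\<in>A \<times> W. c x s * F s \<omega>) = (\<Sum>x'\<in>A. \<Sum>w\<in>W. c x (x', w) * F (x', w) \<omega>)"
      by (simp add: sum.cartesian_product)
    also have "\<dots> = (\<Sum>x'\<in>A. if x' = x then (\<Sum>w\<in>W. p w * F (x', w) \<omega>) else 0)"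
      by (intro sum.cong) (auto simp: c_def)
    also have "\<dots> = objective W p F x \<omega>" using x A by (simp add: objective_def mult.commute)
    finally show "?G x \<omega> = (\<Sum>s\<in>A \<times> W. c x s * F s \<omega>)" ..
  qed
  have om: "objective_mean M A W p F eps pt' n x = real_cond_exp M (hist pt' n) (?G x)" for pt' n x
    by (simp add: objective_mean_def)
  have max_om: "AE \<omega> in M. (MAX x\<in>A. objective_mean M A W p F eps pt' n x \<omega>) = (MAX x\<in>A. post pt' n (?G x) \<omega>)"
    if a': "adapted pt' n" for pt' n
  proof -
    have "AE \<omega> in M. \<forall>x\<in>A. objective_mean M A W p F eps pt' n x \<omega> = post pt' n (?G x) \<omega>"
      unfolding om by (intro AE_finite_allI A cond_exp_hist[OF a' G])
    then show ?thesis by eventually_elim (auto intro!: arg_cong[where f = Max] image_cong)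
  qed
  have om_meas: "(\<lambda>\<omega>. MAX x\<in>A. objective_mean M A W p F eps pt' n x \<omega>) \<in> borel_measurable M" for pt' n
    unfolding om by (intro borel_measurable_Max A) auto
  have post_meas: "(\<lambda>\<omega>. MAX x\<in>A. post pt' n (?G x) \<omega>) \<in> borel_measurable M"
    if a': "adapted pt' n" for pt' n
    using integrable_Max[OF A integrable_lin_proj_pt[OF a' G]] by auto
  have "expectation (\<lambda>\<omega>. MAX x\<in>A. objective_mean M A W p F eps pt n x \<omega>) = expectation (\<lambda>\<omega>. MAX x\<in>A. post pt n (?G x) \<omega>)" for n
    by (intro integral_cong_AE om_meas post_meas max_om a)
  moreover have "(\<lambda>n. expectation (\<lambda>\<omega>. MAX x\<in>A. post pt n (?G x) \<omega>)) \<longlonglongrightarrow> expectation (\<lambda>\<omega>. MAX x\<in>A. ?G x \<omega>)"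
  proof (rule max_post_tendsto[OF a A G])
    fix n and s assume s: "s \<in> A \<times> W"
    interpret H: finite_measure_subalgebra M "hist pt n" by unfold_locales (rule hist_subalgebra[OF a])
    let ?m = "\<lambda>t \<omega>. MAX x\<in>A. post (pt(n := \<lambda>_. t)) (Suc n) (?G x) \<omega>"
    have voi: "AE \<omega> in M. value_of_information M A W p F eps pt n t \<omega> =
        real_cond_exp M (hist pt n) (?m t) \<omega> - (MAX x\<in>A. objective_mean M A W p F eps pt n x \<omega>)"
      if t: "t \<in> A \<times> W" for t
    proof -
      have a': "adapted (pt(n := \<lambda>_. t)) (Suc n)" by (rule adapted_Suc_const[OF a t])
      show ?thesis
        using H.real_cond_exp_cong[OF max_om[OF a'] om_meas post_meas[OF a']]
        unfolding value_of_information_def by eventually_elim simp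
    qed
    \<comment> \<open>The formula is needed at the random point \<open>pt n \<omega>\<close>, so one
      null set must serve all \<open>t\<close>; finiteness of the index set provides it.\<close>
    have all: "AE \<omega> in M. \<forall>t\<in>A \<times> W. value_of_information M A W p F eps pt n t \<omega> =
        real_cond_exp M (hist pt n) (?m t) \<omega> - (MAX x\<in>A. objective_mean M A W p F eps pt n x \<omega>)"
      using finite_S voi by (intro AE_finite_allI)
    have arg: "AE \<omega> in M. is_arg_max (\<lambda>q. value_of_information M A W p F eps pt n q \<omega>) (\<lambda>q. q \<in> A \<times> W) (pt n \<omega>)"
      using assms(11) unfolding bqo_policy_def by blast
    show "expectation (?m s) \<le> expectation (\<lambda>\<omega>. MAX x\<in>A. post pt (Suc n) (?G x) \<omega>)"
    proof (rule greedy_step[OF a A G _ s])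
      fix t assume t: "t \<in> A \<times> W"
      show "AE \<omega> in M. real_cond_exp M (hist pt n) (?m t) \<omega> \<le> real_cond_exp M (hist pt n) (?m (pt n \<omega>)) \<omega>"
        using all arg
      proof eventually_elim
        case (elim \<omega>)
        then have "value_of_information M A W p F eps pt n t \<omega> \<le> value_of_information M A W p F eps pt n (pt n \<omega>) \<omega>"
          and "pt n \<omega> \<in> A \<times> W"
          using t unfolding is_arg_max_linorder by blast+
        then show ?case using elim(1) t by simp
      qed
    qed
  qed
  ultimately show ?thesis by (simp only:)
qed

end
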